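(* Let $v_0\in Y_S^{\zeta}\cap Y_1$. Then the operator $\mathscr{L}_{v_0,\epsilon,\zeta}\colon C_\eta\to C_\eta$, $$\mathscr{L}_{v_0,\epsilon,\zeta}\begin{pmatrix} u \\ v_F \\ v_S \end{pmatrix}(t)=\begin{pmatrix} \epsilon^{-1} \int_{-\infty}^t e^{\epsilon^{-1}(t-s)A} f(u(s),v_F(s),v_S(s))\,ds \\ \int_{-\infty}^t e^{(t-s)B} \operatorname{pr}_{Y_F^{\zeta}}g(u(s),v_F(s),v_S(s))\,ds\\ e^{tB}v_0+\int_{0}^t e^{(t-s)B} \operatorname{pr}_{Y_S^{\zeta}}g(u(s),v_F(s),v_S(s))\,ds \end{pmatrix}\qquad(t\le 0),$$ has a unique fixed point in $C_{\eta}$.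
   Context: **Setting.** $X,Y$ are Banach spaces and $\epsilon>0$ is a parameter. (i) $A\colon X\supset D(A)\to X$ is a closed linear operator generating an exponentially stable $C_0$-semigroup $(e^{tA})_{t\ge0}$ on $X$; $B\colon Y\supset D(B)\to Y$ is a closed linear operator generating a $C_0$-semigroup $(e^{tB})_{t\ge0}$ on $Y$. (ii) $(X_\alpha)_{\alpha\in[-1,\infty)}$ and $(Y_\alpha)_{\alpha\in[-1,\infty)}$ are, up to equivalence of norms for each fixed $\alpha$, the interpolation-extrapolation scales generated by $(X,A)$ and $(Y,B)$ (by $(Y,B-\lambda)$ for some $\lambda\in\rho(B)$ if $0\notin\rho(B)$). The interpolation-extrapolation scale of a densely defined closed operator $S$ on a Banach space $Z$ with $0\in\rho(S)$ is defined, after fixing for each $\theta\in(0,1)$ an exact interpolation functor $(\cdot,\cdot)_\theta$ such that $Z_1$ is dense in $(Z_0,Z_1)_\theta$ whenever $Z_1$ is densely embedded in $Z_0$, by: $Z_k=D(S^k)$ with norm $\|S^kz\|_Z$ for $k\in\mathbb N_0$; $Z_{-1}$ is the completion of $Z$ with respect to $\|S^{-1}z\|_Z$; $Z_{k+\theta}=(Z_k,Z_{k+1})_\theta$ for $k\in\mathbb N_0\cup\{-1\}$, $\theta\in(0,1)$. The operator and its semigroup are extended/restricted to the spaces of the scale and denoted by the same symbols. In particular $X_0=X$, $X_1=D(A)$, $Y_0=Y$, $Y_1=D(B)$. (iii) $\gamma_X\in(0,1]$ if $(e^{tA})_{t\ge0}$ is holomorphic and $\gamma_X=1$ otherwise;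 $\delta_X\in[1-\gamma_X,1]$; $\delta_Y\in(0,1]$ if $(e^{tB})_{t\ge0}$ is holomorphic and $\delta_Y=1$ otherwise. (iv) $f\colon X_{\delta_X}\times Y_{1-\delta_X}\to X$ and $g\colon X_1\times Y_1\to Y_{\delta_Y}$ are continuous, $f(0,0)=0$, $g(0,0)=0$; $f(x,y)\in X_{\gamma_X}$ and $g(x,y)\in Y_{\delta_Y}$ for $(x,y)\in X_1\times Y_1$; $f(u,v)\in C^1([0,t];X_{\delta_X-1})$ whenever $u\in C^1([0,t];X_{\delta_X})$ and $v\in C^1([0,t];Y)\cap C([0,t];Y_{1-\delta_X})$; and there are constants $L_f,L_g>0$ with $\|f(x_1,y_1)-f(x_2,y_2)\|_{X_{\gamma_X}}\le L_f(\|x_1-x_2\|_{X_1}+\|y_1-y_2\|_{Y_1})$, $\|f(u_1,v_1)-f(u_2,v_2)\|_{C^1([0,t];X_{\delta_X-1})}\le L_f(\|u_1-u_2\|_{C^1([0,t];X_{\delta_X})}+\|v_1-v_2\|_{C^1([0,t];Y)})$, $\|g(x_1,y_1)-g(x_2,y_2)\|_{Y_{\delta_Y}}\le L_g(\|x_1-x_2\|_{X_1}+\|y_1-y_2\|_{Y_1})$ for all $x_i\in X_1$, $y_i\in Y_1$, $u_i\in C^1([0,t];X_{\delta_X})$, $v_i\in C^1([0,t];Y)\cap C([0,t];Y_{1-\delta_X})$. (v) $M_A,M_B,C_A,C_B>0$, $\omega_A<0$, $\omega_B\in\mathbb R$ are constants with, for all $t>0$, $\|e^{tA}\|_{\mathcal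 B(X_1)}\le M_Ae^{\omega_At}$, $\|e^{tA}\|_{\mathcal B(X_{\gamma_X},X_1)}\le C_At^{\gamma_X-1}e^{\omega_At}$, $\|e^{tA}\|_{\mathcal B(X_{\delta_X},X_1)}\le C_At^{\delta_X-1}e^{\omega_At}$, $\|e^{tB}\|_{\mathcal B(Y_1)}\le M_Be^{\omega_Bt}$, $\|e^{tB}\|_{\mathcal B(Y_{\delta_Y},Y_1)}\le C_Bt^{\delta_Y-1}e^{\omega_Bt}$. (vi) $\omega_f:=\omega_A+(2C_AL_f)^{1/\gamma_X}(1/\gamma_X)^{(1-\gamma_X)/\gamma_X}$ if $\gamma_X\in(0,1)$; if $\gamma_X=1$, $\omega_f$ is a fixed number $>\omega_A+C_AL_f$. It is assumed that $\omega_f<0$ and $L_f\max\{\|A^{-1}\|_{\mathcal B(X_{\gamma_X},X_1)},\|A^{-1}\|_{\mathcal B(X_{\delta_X-1},X_{\delta_X})}\}<1$. **Splitting of the slow variable space.** For each small $\zeta>0$ there is a splitting $Y=Y_F^\zeta\oplus Y_S^\zeta$ such that: (1) $Y_F^\zeta,Y_S^\zeta$ are closed in $Y$ and the projections $\operatorname{pr}_{Y_F^\zeta},\operatorname{pr}_{Y_S^\zeta}$ commute with $B$ on $Y_1$. (2) $Y_F^\zeta\cap Y_1$ and $Y_S^\zeta\cap Y_1$ are closed subspaces of $Y_1$, endowed with $\|\cdot\|_{Y_1}$. (3) With the convention $f(x,y_F,y_S):=f(x,y_F+y_S)$, $g(x,y_F,y_S):=g(x,y_F+y_S)$: $\|\operatorname{pr}_{Y_S^\zeta}[g(x,y_F,y_S)-g(\tilde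 x,\tilde y_F,\tilde y_S)]\|_{Y_1}\le L_g\zeta^{\delta_Y-1}(\|x-\tilde x\|_{X_1}+\|y_F-\tilde y_F\|_{Y_1}+\|y_S-\tilde y_S\|_{Y_1})$ for $x,\tilde x\in X_1$, $y_F,\tilde y_F\in Y_F^\zeta\cap Y_1$, $y_S,\tilde y_S\in Y_S^\zeta\cap Y_1$. (4) The realization of $B$ in $Y_S^\zeta$, with domain $\{v\in Y_S^\zeta\cap D(B):Bv\in Y_S^\zeta\}$, generates a $C_0$-group on $(Y_S^\zeta,\|\cdot\|_Y)$ which coincides with $e^{tB}$ on $Y_S^\zeta$ for $t\ge0$ (it is also denoted $e^{tB}$ for $t<0$). (5) The realization $B_{Y_F^\zeta}$ of $B$ in $Y_F^\zeta$, with domain $\{v\in Y_F^\zeta\cap D(B):Bv\in Y_F^\zeta\}$, has $0$ in its resolvent set. (6) There are constants $C_B,M_B>0$ such that for all small enough $\zeta>0$ there are constants $0\le N_F^\zeta<N_S^\zeta$ with $\|e^{tB}y_F\|_{Y_1}\le C_Bt^{\delta_Y-1}e^{(N_F^\zeta+\zeta^{-1}\omega_A)t}\|y_F\|_{Y_{\delta_Y}}$ ($t>0$, $y_F\in Y_F^\zeta\cap Y_{\delta_Y}$) and $\|e^{-tB}y_S\|_{Y_1}\le M_Be^{-(N_S^\zeta+\zeta^{-1}\omega_A)t}\|y_S\|_{Y_1}$ ($t\ge0$, $y_S\in Y_S^\zeta\cap Y_1$). (7) (Gap condition) The pair $(\epsilon,\zeta)$ satisfies $$\frac{2^{\gamma_X}L_fC_A\Gamma(\gamma_X)}{\big(2(\epsilon\zeta^{-1}-1)\omega_A+\epsilon(N_S^\zeta+N_F^\zeta)\big)^{\gamma_X}}+\frac{2^{\delta_Y}L_gC_B\Gamma(\delta_Y)}{(N_S^\zeta-N_F^\zeta)^{\delta_Y}}+\frac{2\zeta^{\delta_Y-1}L_gM_B\Gamma(\delta_Y)}{N_S^\zeta-N_F^\zeta}<1,$$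 where $\Gamma$ is the gamma function and the base of the first denominator is understood to be positive. **The space $C_\eta$.** $\eta:=\zeta^{-1}\omega_A+\frac{N_S^\zeta+N_F^\zeta}{2}$ and $C_\eta$ is the Banach space of all $(u,v_F,v_S)\in C((-\infty,0];X_1\times(Y_F^\zeta\cap Y_1)\times(Y_S^\zeta\cap Y_1))$ with $\|(u,v_F,v_S)\|_{C_\eta}:=\sup_{t\le0}e^{-\eta t}(\|u(t)\|_{X_1}+\|v_F(t)\|_{Y_1}+\|v_S(t)\|_{Y_1})<\infty$.
   Formalization: Added hypothesis: pr_{Y_F^ζ} g is also Lipschitz into Y_{δ_Y} with the constant L_g (analogue of (3) for the fast projection); without it uniqueness can fail when pr_{Y_F^ζ} has norm greater than 1. *)

theory Defs
  imports "HOL-Analysis.Analysis"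
begin

section \<open>Normed spaces inside an ambient vector space\<close>

text \<open>
  All spaces of one interpolation-extrapolation scale are subspaces of its largest space, the
  extrapolation space of order -1, which is a type of class banach.  Each
  space is therefore a carrier set together with its own norm; only the values of the norm on the
  carrier matter.

  The scalar field is a set K of complex numbers, either the real axis or UNIV, so that real and
  complex Banach spaces are both covered; sc is the scalar multiplication, used only for scalars
  in K and extending the real scaling of the type.
\<close>

record 'a nspace =
  carr :: "'a set"
  nrm :: "'a \<Rightarrow> real"

definition scalar_mult :: "complex set \<Rightarrow> (complex \<Rightarrow> 'a::real_vector \<Rightarrow> 'a) \<Rightarrow> bool" where
  "scalar_mult K sc \<longleftrightarrow> (K = \<real> \<or> K = UNIV) \<and>
     (\<forall>r x. sc (of_real r) x = r *\<^sub>R x) \<and>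
     (\<forall>a\<in>K. \<forall>b\<in>K. \<forall>x y. sc (a + b) x = sc a x + sc b x \<and> sc a (x + y) = sc a x + sc a y \<and>
        sc (a * b) x = sc a (sc b x))"

definition subspace_in ::
  "complex set \<Rightarrow> (complex \<Rightarrow> 'a::real_vector \<Rightarrow> 'a) \<Rightarrow> 'a set \<Rightarrow> bool" where
  "subspace_in K sc V \<longleftrightarrow> 0 \<in> V \<and> (\<forall>x\<in>V. \<forall>y\<in>V. x + y \<in> V) \<and> (\<forall>a\<in>K. \<forall>x\<in>V. sc a x \<in> V)"

definition tends_in :: "'a::real_vector nspace \<Rightarrow> (nat \<Rightarrow> 'a) \<Rightarrow> 'a \<Rightarrow> bool" where
  "tends_in E \<sigma> x \<longleftrightarrow> x \<in> carr E \<and> (\<lambda>n. nrm E (\<sigma> n - x)) \<longlonglongrightarrow> 0"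

definition banach_space ::
  "complex set \<Rightarrow> (complex \<Rightarrow> 'a::real_vector \<Rightarrow> 'a) \<Rightarrow> 'a nspace \<Rightarrow> bool" where
  "banach_space K sc E \<longleftrightarrow> subspace_in K sc (carr E) \<and>
     (\<forall>x\<in>carr E. 0 \<le> nrm E x \<and> (nrm E x = 0 \<longleftrightarrow> x = 0)) \<and>
     (\<forall>x\<in>carr E. \<forall>y\<in>carr E. nrm E (x + y) \<le> nrm E x + nrm E y) \<and>
     (\<forall>a\<in>K. \<forall>x\<in>carr E. nrm E (sc a x) = cmod a * nrm E x) \<and>
     (\<forall>\<sigma>. (\<forall>n. \<sigma> n \<in> carr E) \<and> (\<forall>e>0. \<exists>N. \<forall>m\<ge>N. \<forall>n\<ge>N. nrm E (\<sigma> m - \<sigma> n) < e) \<longrightarrow>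
        (\<exists>x. tends_in E \<sigma> x))"

definition equiv_nspace :: "'a nspace \<Rightarrow> 'a nspace \<Rightarrow> bool" where
  "equiv_nspace E F \<longleftrightarrow> carr E = carr F \<and>
     (\<exists>c>0. \<forall>x\<in>carr E. nrm E x \<le> c * nrm F x \<and> nrm F x \<le> c * nrm E x)"

definition subsp :: "'a nspace \<Rightarrow> 'a set \<Rightarrow> 'a nspace" where
  "subsp E V = \<lparr>carr = V, nrm = nrm E\<rparr>"

definition closed_in :: "'a::real_vector nspace \<Rightarrow> 'a set \<Rightarrow> bool" where
  "closed_in E V \<longleftrightarrow> V \<subseteq> carr E \<and> (\<forall>\<sigma> x. (\<forall>n. \<sigma> n \<in> V) \<and> tends_in E \<sigma> x \<longrightarrow> x \<in> V)"

definition dense_in :: "'a::real_vector nspace \<Rightarrow> 'a set \<Rightarrow> bool" where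
  "dense_in E V \<longleftrightarrow> V \<subseteq> carr E \<and> (\<forall>x\<in>carr E. \<forall>e>0. \<exists>v\<in>V. nrm E (v - x) < e)"

definition cont_embedded :: "'a nspace \<Rightarrow> 'a nspace \<Rightarrow> bool" where
  "cont_embedded E F \<longleftrightarrow> carr E \<subseteq> carr F \<and> (\<exists>c. \<forall>x\<in>carr E. nrm F x \<le> c * nrm E x)"

definition continuous_in ::
  "'a::real_vector nspace \<Rightarrow> real set \<Rightarrow> (real \<Rightarrow> 'a) \<Rightarrow> bool" where
  "continuous_in E S u \<longleftrightarrow>
     (\<forall>s\<in>S. u s \<in> carr E \<and> ((\<lambda>r. nrm E (u r - u s)) \<longlongrightarrow> 0) (at s within S))"

definition continuous2_in ::
  "'a::real_vector nspace \<Rightarrow> 'b::real_vector nspace \<Rightarrow> 'c::real_vector nspace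
    \<Rightarrow> ('a \<Rightarrow> 'b \<Rightarrow> 'c) \<Rightarrow> bool" where
  "continuous2_in E F G f \<longleftrightarrow> (\<forall>x\<in>carr E. \<forall>y\<in>carr F. f x y \<in> carr G \<and>
     (\<forall>e>0. \<exists>d>0. \<forall>x'\<in>carr E. \<forall>y'\<in>carr F.
        nrm E (x' - x) < d \<and> nrm F (y' - y) < d \<longrightarrow> nrm G (f x' y' - f x y) < e))"

definition has_deriv_in ::
  "'a::real_vector nspace \<Rightarrow> real set \<Rightarrow> (real \<Rightarrow> 'a) \<Rightarrow> real \<Rightarrow> 'a \<Rightarrow> bool" where
  "has_deriv_in E S u s d \<longleftrightarrow> d \<in> carr E \<and>
     ((\<lambda>r. nrm E ((1 / (r - s)) *\<^sub>R (u r - u s) - d)) \<longlongrightarrow> 0) (at s within S)"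

definition C1_in :: "'a::real_vector nspace \<Rightarrow> real \<Rightarrow> (real \<Rightarrow> 'a) \<Rightarrow> bool" where
  "C1_in E t u \<longleftrightarrow> (\<exists>d. continuous_in E {0..t} d \<and>
     (\<forall>s\<in>{0..t}. u s \<in> carr E \<and> has_deriv_in E {0..t} u s (d s)))"

definition C1_norm :: "'a::real_vector nspace \<Rightarrow> real \<Rightarrow> (real \<Rightarrow> 'a) \<Rightarrow> real" where
  "C1_norm E t u = (SUP s\<in>{0..t}. nrm E (u s)) +
     (SUP s\<in>{0..t}. nrm E (THE d. has_deriv_in E {0..t} u s d))"

section \<open>Operators\<close>

definition linear_in ::
  "complex set \<Rightarrow> (complex \<Rightarrow> 'a::real_vector \<Rightarrow> 'a) \<Rightarrow> 'a nspace \<Rightarrow> 'a nspace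
    \<Rightarrow> ('a \<Rightarrow> 'a) \<Rightarrow> bool" where
  "linear_in K sc E F T \<longleftrightarrow> (\<forall>x\<in>carr E. T x \<in> carr F) \<and>
     (\<forall>x\<in>carr E. \<forall>y\<in>carr E. T (x + y) = T x + T y) \<and> (\<forall>a\<in>K. \<forall>x\<in>carr E. T (sc a x) = sc a (T x))"

text \<open>For linear T and nonnegative c: T is in B(E,F) with operator norm at most c.\<close>

definition op_bound :: "'a nspace \<Rightarrow> 'a nspace \<Rightarrow> ('a \<Rightarrow> 'a) \<Rightarrow> real \<Rightarrow> bool" where
  "op_bound E F T c \<longleftrightarrow> (\<forall>x\<in>carr E. T x \<in> carr F \<and> nrm F (T x) \<le> c * nrm E x)"

definition op_norm :: "'a nspace \<Rightarrow> 'a nspace \<Rightarrow> ('a \<Rightarrow> 'a) \<Rightarrow> real" where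
  "op_norm E F T = Inf {c. 0 \<le> c \<and> op_bound E F T c}"

definition bounded_linear_in ::
  "complex set \<Rightarrow> (complex \<Rightarrow> 'a::real_vector \<Rightarrow> 'a) \<Rightarrow> 'a nspace \<Rightarrow> ('a \<Rightarrow> 'a) \<Rightarrow> bool" where
  "bounded_linear_in K sc E T \<longleftrightarrow> linear_in K sc E E T \<and> (\<exists>c. op_bound E E T c)"

text \<open>Unbounded operators: odom is the domain, values of oap outside it are irrelevant.\<close>

record 'a oper =
  odom :: "'a set"
  oap :: "'a \<Rightarrow> 'a"

definition linear_oper ::
  "complex set \<Rightarrow> (complex \<Rightarrow> 'a::real_vector \<Rightarrow> 'a) \<Rightarrow> 'a nspace \<Rightarrow> 'a oper \<Rightarrow> bool" where
  "linear_oper K sc E S \<longleftrightarrow> odom S \<subseteq> carr E \<and> subspace_in K sc (odom S) \<and>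
     linear_in K sc (subsp E (odom S)) E (oap S)"

definition closed_oper :: "'a::real_vector nspace \<Rightarrow> 'a oper \<Rightarrow> bool" where
  "closed_oper E S \<longleftrightarrow> (\<forall>\<sigma> x y. (\<forall>n. \<sigma> n \<in> odom S) \<and> tends_in E \<sigma> x \<and>
     tends_in E (\<lambda>n. oap S (\<sigma> n)) y \<longrightarrow> x \<in> odom S \<and> oap S x = y)"

definition resolvent_set ::
  "complex set \<Rightarrow> (complex \<Rightarrow> 'a::real_vector \<Rightarrow> 'a) \<Rightarrow> 'a nspace \<Rightarrow> 'a oper \<Rightarrow> complex set" where
  "resolvent_set K sc E S = {l \<in> K. bij_betw (\<lambda>x. sc l x - oap S x) (odom S) (carr E) \<and>
     (\<exists>c. op_bound E E (the_inv_into (odom S) (\<lambda>x. sc l x - oap S x)) c)}"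

definition shift_oper :: "(complex \<Rightarrow> 'a::real_vector \<Rightarrow> 'a) \<Rightarrow> 'a oper \<Rightarrow> complex \<Rightarrow> 'a oper" where
  "shift_oper sc S l = \<lparr>odom = odom S, oap = (\<lambda>x. oap S x - sc l x)\<rparr>"

definition realization :: "'a oper \<Rightarrow> 'a set \<Rightarrow> 'a oper" where
  "realization S V = \<lparr>odom = {v \<in> V \<inter> odom S. oap S v \<in> V}, oap = oap S\<rparr>"

definition oinv :: "'a oper \<Rightarrow> 'a \<Rightarrow> 'a" where
  "oinv S = the_inv_into (odom S) (oap S)"

text \<open>
  Inverse of the extension of S to the extrapolation space; the graph of that extension is the
  closure of the graph of S, taken in the topology of the type.
\<close>

definition ext_inv :: "'a::topological_space oper \<Rightarrow> 'a \<Rightarrow> 'a" where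
  "ext_inv S z = (THE x. (x, z) \<in> closure {(v, oap S v) | v. v \<in> odom S})"

section \<open>Semigroups\<close>

definition c0_semigroup ::
  "complex set \<Rightarrow> (complex \<Rightarrow> 'a::real_vector \<Rightarrow> 'a) \<Rightarrow> 'a nspace \<Rightarrow> (real \<Rightarrow> 'a \<Rightarrow> 'a) \<Rightarrow> bool" where
  "c0_semigroup K sc E T \<longleftrightarrow> (\<forall>t\<ge>0. bounded_linear_in K sc E (T t)) \<and>
     (\<forall>x\<in>carr E. T 0 x = x) \<and>
     (\<forall>s\<ge>0. \<forall>t\<ge>0. \<forall>x\<in>carr E. T (s + t) x = T s (T t x)) \<and>
     (\<forall>x\<in>carr E. ((\<lambda>t. nrm E (T t x - x)) \<longlongrightarrow> 0) (at_right 0))"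

definition c0_group ::
  "complex set \<Rightarrow> (complex \<Rightarrow> 'a::real_vector \<Rightarrow> 'a) \<Rightarrow> 'a nspace \<Rightarrow> (real \<Rightarrow> 'a \<Rightarrow> 'a) \<Rightarrow> bool" where
  "c0_group K sc E T \<longleftrightarrow> (\<forall>t. bounded_linear_in K sc E (T t)) \<and>
     (\<forall>x\<in>carr E. T 0 x = x) \<and>
     (\<forall>s t. \<forall>x\<in>carr E. T (s + t) x = T s (T t x)) \<and>
     (\<forall>x\<in>carr E. ((\<lambda>t. nrm E (T t x - x)) \<longlongrightarrow> 0) (at 0))"

text \<open>S is the generator of T; the filter is at_right 0 for semigroups and at 0 for groups.\<close>

definition generates ::
  "real filter \<Rightarrow> 'a::real_vector nspace \<Rightarrow> 'a oper \<Rightarrow> (real \<Rightarrow> 'a \<Rightarrow> 'a) \<Rightarrow> bool" where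
  "generates Fl E S T \<longleftrightarrow>
     odom S = {x \<in> carr E. \<exists>y\<in>carr E. ((\<lambda>t. nrm E ((1 / t) *\<^sub>R (T t x - x) - y)) \<longlongrightarrow> 0) Fl} \<and>
     (\<forall>x\<in>odom S. oap S x \<in> carr E \<and>
        ((\<lambda>t. nrm E ((1 / t) *\<^sub>R (T t x - x) - oap S x)) \<longlongrightarrow> 0) Fl)"

definition exp_stable :: "'a nspace \<Rightarrow> (real \<Rightarrow> 'a \<Rightarrow> 'a) \<Rightarrow> bool" where
  "exp_stable E T \<longleftrightarrow> (\<exists>M>0. \<exists>w>0. \<forall>t\<ge>0. op_bound E E (T t) (M * exp (- w * t)))"

definition sector :: "real \<Rightarrow> complex set" where
  "sector \<theta> = {z. z \<noteq> 0 \<and> \<bar>Arg z\<bar> < \<theta>}"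

definition complex_holomorphic_semigroup ::
  "(complex \<Rightarrow> 'a::real_vector \<Rightarrow> 'a) \<Rightarrow> 'a nspace \<Rightarrow> (real \<Rightarrow> 'a \<Rightarrow> 'a) \<Rightarrow> bool" where
  "complex_holomorphic_semigroup sc E T \<longleftrightarrow> (\<exists>\<theta>>0. \<theta> \<le> pi / 2 \<and> (\<exists>S.
     (\<forall>t>0. \<forall>x\<in>carr E. S (of_real t) x = T t x) \<and>
     (\<forall>z\<in>sector \<theta>. bounded_linear_in UNIV sc E (S z)) \<and>
     (\<forall>z\<in>sector \<theta>. \<forall>w\<in>sector \<theta>. \<forall>x\<in>carr E. S (z + w) x = S z (S w x)) \<and>
     (\<forall>z\<in>sector \<theta>. \<exists>D. bounded_linear_in UNIV sc E D \<and>
        (\<forall>e>0. \<forall>\<^sub>F w in at z. op_bound E E (\<lambda>x. sc (1 / (w - z)) (S w x - S z x) - D x) e)) \<and>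
     (\<forall>\<phi>. 0 < \<phi> \<and> \<phi> < \<theta> \<longrightarrow>
        (\<forall>x\<in>carr E. ((\<lambda>z. nrm E (S z x - x)) \<longlongrightarrow> 0) (at 0 within sector \<phi>)))))"

text \<open>Complexification of a real space, (x, y) standing for x + iy, with the Taylor norm.\<close>

definition cplx_sc :: "complex \<Rightarrow> 'a::real_vector \<times> 'a \<Rightarrow> 'a \<times> 'a" where
  "cplx_sc c p = (Re c *\<^sub>R fst p - Im c *\<^sub>R snd p, Re c *\<^sub>R snd p + Im c *\<^sub>R fst p)"

definition cplx_nspace :: "'a::real_vector nspace \<Rightarrow> ('a \<times> 'a) nspace" where
  "cplx_nspace E = \<lparr>carr = carr E \<times> carr E,
     nrm = (\<lambda>p. SUP \<phi>::real. nrm E (cos \<phi> *\<^sub>R fst p - sin \<phi> *\<^sub>R snd p))\<rparr>"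

definition holomorphic_semigroup ::
  "complex set \<Rightarrow> (complex \<Rightarrow> 'a::real_vector \<Rightarrow> 'a) \<Rightarrow> 'a nspace \<Rightarrow> (real \<Rightarrow> 'a \<Rightarrow> 'a) \<Rightarrow> bool" where
  "holomorphic_semigroup K sc E T \<longleftrightarrow>
     (if K = UNIV then complex_holomorphic_semigroup sc E T
      else complex_holomorphic_semigroup cplx_sc (cplx_nspace E) (\<lambda>t. map_prod (T t) (T t)))"

section \<open>Interpolation-extrapolation scales\<close>

definition type_space :: "'a::real_normed_vector nspace" where
  "type_space = \<lparr>carr = UNIV, nrm = norm\<rparr>"

text \<open>
  Compatible couples of Banach spaces, continuously embedded in the ambient type.  Interpolation
  functors are only required to be functors on these couples.
\<close>

definition banach_couple ::
  "complex set \<Rightarrow> (complex \<Rightarrow> 'a::real_normed_vector \<Rightarrow> 'a) \<Rightarrow> 'a nspace \<Rightarrow> 'a nspace \<Rightarrow> bool" where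
  "banach_couple K sc E0 E1 \<longleftrightarrow> banach_space K sc E0 \<and> banach_space K sc E1 \<and>
     cont_embedded E0 type_space \<and> cont_embedded E1 type_space"

definition int_space :: "'a nspace \<Rightarrow> 'a nspace \<Rightarrow> 'a nspace" where
  "int_space E0 E1 = \<lparr>carr = carr E0 \<inter> carr E1, nrm = (\<lambda>x. max (nrm E0 x) (nrm E1 x))\<rparr>"

definition sum_space :: "'a::real_vector nspace \<Rightarrow> 'a nspace \<Rightarrow> 'a nspace" where
  "sum_space E0 E1 = \<lparr>carr = {x + y | x y. x \<in> carr E0 \<and> y \<in> carr E1},
     nrm = (\<lambda>z. Inf {nrm E0 x + nrm E1 y | x y. x \<in> carr E0 \<and> y \<in> carr E1 \<and> z = x + y})\<rparr>"

definition exact_interp_functor ::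
  "complex set \<Rightarrow> (complex \<Rightarrow> 'a::real_normed_vector \<Rightarrow> 'a)
    \<Rightarrow> ('a nspace \<Rightarrow> 'a nspace \<Rightarrow> 'a nspace) \<Rightarrow> bool" where
  "exact_interp_functor K sc Fn \<longleftrightarrow>
     (\<forall>E0 E1. banach_couple K sc E0 E1 \<longrightarrow> banach_space K sc (Fn E0 E1) \<and>
        cont_embedded (int_space E0 E1) (Fn E0 E1) \<and>
        cont_embedded (Fn E0 E1) (sum_space E0 E1)) \<and>
     (\<forall>E0 E1 G0 G1 T c0 c1. banach_couple K sc E0 E1 \<and> banach_couple K sc G0 G1 \<and>
        linear_in K sc (sum_space E0 E1) (sum_space G0 G1) T \<and>
        0 \<le> c0 \<and> op_bound E0 G0 T c0 \<and> 0 \<le> c1 \<and> op_bound E1 G1 T c1 \<longrightarrow>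
        op_bound (Fn E0 E1) (Fn G0 G1) T (max c0 c1))"

definition density_preserving ::
  "complex set \<Rightarrow> (complex \<Rightarrow> 'a::real_normed_vector \<Rightarrow> 'a)
    \<Rightarrow> ('a nspace \<Rightarrow> 'a nspace \<Rightarrow> 'a nspace) \<Rightarrow> bool" where
  "density_preserving K sc Fn \<longleftrightarrow> (\<forall>E0 E1. banach_couple K sc E0 E1 \<and> cont_embedded E1 E0 \<and>
     dense_in E0 (carr E1) \<longrightarrow> dense_in (Fn E0 E1) (carr E1))"

primrec dom_pow :: "'a nspace \<Rightarrow> 'a oper \<Rightarrow> nat \<Rightarrow> 'a set" where
  "dom_pow E S 0 = carr E"
| "dom_pow E S (Suc k) = {z \<in> odom S. oap S z \<in> dom_pow E S k}"

definition scale_int :: "'a::real_normed_vector nspace \<Rightarrow> 'a oper \<Rightarrow> int \<Rightarrow> 'a nspace" where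
  "scale_int E S k = (if k < 0 then type_space
     else \<lparr>carr = dom_pow E S (nat k), nrm = (\<lambda>z. nrm E ((oap S ^^ nat k) z))\<rparr>)"

definition scale_space ::
  "'a::real_normed_vector nspace \<Rightarrow> 'a oper \<Rightarrow> (real \<Rightarrow> 'a nspace \<Rightarrow> 'a nspace \<Rightarrow> 'a nspace)
    \<Rightarrow> real \<Rightarrow> 'a nspace" where
  "scale_space E S Fn \<alpha> = (if \<alpha> \<in> \<int> then scale_int E S \<lfloor>\<alpha>\<rfloor>
     else Fn (frac \<alpha>) (scale_int E S \<lfloor>\<alpha>\<rfloor>) (scale_int E S (\<lfloor>\<alpha>\<rfloor> + 1)))"

text \<open>
  The conditions on closure and norm say that the ambient type is the completion of E with respect to the norm of
  the inverse of S.
\<close>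

definition interp_extrap_scale ::
  "complex set \<Rightarrow> (complex \<Rightarrow> 'a::banach \<Rightarrow> 'a) \<Rightarrow> 'a nspace \<Rightarrow> 'a oper
    \<Rightarrow> (real \<Rightarrow> 'a nspace \<Rightarrow> 'a nspace \<Rightarrow> 'a nspace) \<Rightarrow> (real \<Rightarrow> 'a nspace) \<Rightarrow> bool" where
  "interp_extrap_scale K sc E S Fn Es \<longleftrightarrow>
     linear_oper K sc E S \<and> closed_oper E S \<and> dense_in E (odom S) \<and> 0 \<in> resolvent_set K sc E S \<and>
     banach_space K sc (type_space :: 'a nspace) \<and>
     closure (carr E) = UNIV \<and> (\<forall>z\<in>carr E. norm z = nrm E (oinv S z)) \<and>
     (\<forall>\<theta>\<in>{0<..<1}. exact_interp_functor K sc (Fn \<theta>) \<and> density_preserving K sc (Fn \<theta>)) \<and>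
     (\<forall>\<alpha>\<ge>-1. banach_space K sc (Es \<alpha>) \<and> equiv_nspace (Es \<alpha>) (scale_space E S Fn \<alpha>))"

section \<open>The splitting and the Lyapunov-Perron operator\<close>

definition direct_sum ::
  "complex set \<Rightarrow> (complex \<Rightarrow> 'a::real_vector \<Rightarrow> 'a) \<Rightarrow> 'a nspace \<Rightarrow> 'a set \<Rightarrow> 'a set \<Rightarrow> bool" where
  "direct_sum K sc E V W \<longleftrightarrow> V \<subseteq> carr E \<and> W \<subseteq> carr E \<and> subspace_in K sc V \<and> subspace_in K sc W \<and>
     (\<forall>y\<in>carr E. \<exists>!p. p \<in> V \<times> W \<and> y = fst p + snd p)"

text \<open>Projection onto V along W.\<close>

definition proj :: "'a::real_vector set \<Rightarrow> 'a set \<Rightarrow> 'a \<Rightarrow> 'a" where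
  "proj V W y = (THE v. v \<in> V \<and> (\<exists>w\<in>W. y = v + w))"

text \<open>
  Elements of this space are functions on the half-line t at most 0; being extensional, they are
  determined by their values there.
\<close>

definition C_eta ::
  "real \<Rightarrow> 'x::real_vector nspace \<Rightarrow> 'y::real_vector nspace \<Rightarrow> 'y nspace
    \<Rightarrow> (real \<Rightarrow> 'x \<times> 'y \<times> 'y) set" where
  "C_eta \<eta> E F G = {w \<in> extensional {..0}.
     continuous_in E {..0} (\<lambda>t. fst (w t)) \<and>
     continuous_in F {..0} (\<lambda>t. fst (snd (w t))) \<and>
     continuous_in G {..0} (\<lambda>t. snd (snd (w t))) \<and>
     bdd_above ((\<lambda>t. exp (- \<eta> * t) *
       (nrm E (fst (w t)) + nrm F (fst (snd (w t))) + nrm G (snd (snd (w t))))) ` {..0})}"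

definition abs_integrable_in ::
  "'a::banach nspace \<Rightarrow> (real \<Rightarrow> 'a) \<Rightarrow> real set \<Rightarrow> bool" where
  "abs_integrable_in E h S \<longleftrightarrow> h integrable_on S \<and> (\<lambda>s. nrm E (h s)) integrable_on S"

definition fast_integrand ::
  "real \<Rightarrow> (real \<Rightarrow> 'x \<Rightarrow> 'x) \<Rightarrow> ('x \<Rightarrow> 'y::real_vector \<Rightarrow> 'x) \<Rightarrow> (real \<Rightarrow> 'x \<times> 'y \<times> 'y)
    \<Rightarrow> real \<Rightarrow> real \<Rightarrow> 'x" where
  "fast_integrand \<epsilon> TA f w t s =
     TA ((t - s) / \<epsilon>) (case w s of (u, vF, vS) \<Rightarrow> f u (vF + vS))"

definition slow_integrand ::
  "(real \<Rightarrow> 'y \<Rightarrow> 'y) \<Rightarrow> ('y \<Rightarrow> 'y) \<Rightarrow> ('x \<Rightarrow> 'y::real_vector \<Rightarrow> 'y) \<Rightarrow> (real \<Rightarrow> 'x \<times> 'y \<times> 'y)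
    \<Rightarrow> real \<Rightarrow> real \<Rightarrow> 'y" where
  "slow_integrand T pr g w t s = T (t - s) (pr (case w s of (u, vF, vS) \<Rightarrow> g u (vF + vS)))"

text \<open>
  TS is the group extending the restriction of TB to the second summand.  For t at most 0 the
  integral from 0 to t is minus the integral over {t..0}.
\<close>

definition LP_operator ::
  "real \<Rightarrow> (real \<Rightarrow> 'x::banach \<Rightarrow> 'x) \<Rightarrow> (real \<Rightarrow> 'y::banach \<Rightarrow> 'y) \<Rightarrow> (real \<Rightarrow> 'y \<Rightarrow> 'y)
    \<Rightarrow> ('y \<Rightarrow> 'y) \<Rightarrow> ('y \<Rightarrow> 'y) \<Rightarrow> ('x \<Rightarrow> 'y \<Rightarrow> 'x) \<Rightarrow> ('x \<Rightarrow> 'y \<Rightarrow> 'y) \<Rightarrow> 'y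
    \<Rightarrow> (real \<Rightarrow> 'x \<times> 'y \<times> 'y) \<Rightarrow> real \<Rightarrow> 'x \<times> 'y \<times> 'y" where
  "LP_operator \<epsilon> TA TB TS prF prS f g v0 w = (\<lambda>t\<in>{..0}.
     ((1 / \<epsilon>) *\<^sub>R integral {..t} (fast_integrand \<epsilon> TA f w t),
      integral {..t} (slow_integrand TB prF g w t),
      TS t v0 - integral {t..0} (slow_integrand TS prS g w t)))"

end

theory Submission
  imports Defs
begin

text \<open>
  The Lyapunov-Perron operator is a contraction for the norm of \<open>C_eta\<close>, so the result is Banach's fixed
  point theorem. The first two components are convolutions over the past with the families
  \<open>TA (\<sigma> / \<epsilon>)\<close> and \<open>TB \<sigma>\<close>, which map a space of lower order into the space of order 1 with norm at most
  \<open>C * \<sigma> powr (\<theta> - 1) * exp (b * \<sigma>)\<close>; the third is a convolution with \<open>TS (- \<sigma>)\<close> over the time that remains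
  until 0, with \<open>\<theta> = 1\<close>. A path of size \<open>exp (\<eta> * t)\<close> is mapped to one of the same size, with the factor
  \<open>C * Gamma \<theta> / a powr \<theta>\<close> times the Lipschitz constant of the nonlinearity, where \<open>a > 0\<close> is the distance
  between the two exponential rates. For the first component, multiplied by \<open>1 / \<epsilon>\<close>, and for the second
  these factors are the first two terms of the gap condition; for the third component the factor is at
  most the third term, since \<open>Gamma \<ge> 1\<close> on the interval from 0 to 1 (\<open>Gamma_ge_1\<close>). Hence the
  contraction constant is less than 1 (\<open>unique_fixed_point\<close>).

  The integrals are gauge integrals in the ambient extrapolation space, whereas the estimates and the
  continuity are needed in the norm of order 1. For a path that is continuous in a continuously
  embedded Banach space E, Riemann sums converge in E, so the integral lies in E and its norm is at most
  the integral of the norms (\<open>integral_compact\<close>). Singular endpoints and the half-line are reached by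
  exhaustion (\<open>integral_half_line\<close>). Continuity of a convolution in time follows from dominated
  convergence for the real-valued norms (\<open>convolution_tendsto_zero\<close>, \<open>conv_continuous\<close>).

  The semigroups are strongly continuous in the norm of order 1, because they commute with their
  generators. The second component must also stay in the first summand of the splitting, that is, this
  summand must be invariant under the semigroup, although only the generator is assumed to commute
  with the projections. The projections are bounded, as both summands are closed
  (\<open>complement_bounded\<close>, a Baire category argument), and uniqueness of the solution of the Cauchy problem
  then gives the invariance (\<open>T_invariant\<close>).
\<close>


section \<open>Normed spaces on a carrier set\<close>

text \<open>The normed space structure of \<^const>\<open>banach_space\<close>, restricted to real scalars and without
  completeness.  Values of the norm outside the carrier are arbitrary, hence the membership
  assumptions throughout.\<close>

locale normed_carrier =
  fixes E :: "'a::real_vector nspace"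
  assumes zero_mem [simp, intro]: "0 \<in> carr E"
    and add_mem [simp, intro]: "\<And>x y. x \<in> carr E \<Longrightarrow> y \<in> carr E \<Longrightarrow> x + y \<in> carr E"
    and scale_mem [simp, intro]: "\<And>r x. x \<in> carr E \<Longrightarrow> r *\<^sub>R x \<in> carr E"
    and nrm_ge0 [simp, intro]: "\<And>x. x \<in> carr E \<Longrightarrow> 0 \<le> nrm E x"
    and nrm_eq0: "\<And>x. x \<in> carr E \<Longrightarrow> nrm E x = 0 \<longleftrightarrow> x = 0"
    and nrm_add: "\<And>x y. x \<in> carr E \<Longrightarrow> y \<in> carr E \<Longrightarrow> nrm E (x + y) \<le> nrm E x + nrm E y"
    and nrm_scale: "\<And>r x. x \<in> carr E \<Longrightarrow> nrm E (r *\<^sub>R x) = \<bar>r\<bar> * nrm E x"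
begin

lemma minus_mem [simp, intro]: "x \<in> carr E \<Longrightarrow> - x \<in> carr E"
  using scale_mem[of x "-1"] by simp

lemma diff_mem [simp, intro]: "x \<in> carr E \<Longrightarrow> y \<in> carr E \<Longrightarrow> x - y \<in> carr E"
  using add_mem[of x "- y"] by simp

lemma sum_mem [intro]: "(\<And>i. i \<in> I \<Longrightarrow> h i \<in> carr E) \<Longrightarrow> sum h I \<in> carr E"
  by (induction I rule: infinite_finite_induct) auto

lemma nrm_zero [simp]: "nrm E 0 = 0"
  by (simp add: nrm_eq0)

lemma nrm_minus [simp]: "x \<in> carr E \<Longrightarrow> nrm E (- x) = nrm E x"
  using nrm_scale[of x "-1"] by simp

lemma nrm_commute: "x \<in> carr E \<Longrightarrow> y \<in> carr E \<Longrightarrow> nrm E (x - y) = nrm E (y - x)"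
  using nrm_minus[of "x - y"] by simp

lemma nrm_diff: "x \<in> carr E \<Longrightarrow> y \<in> carr E \<Longrightarrow> nrm E (x - y) \<le> nrm E x + nrm E y"
  using nrm_add[of x "- y"] by simp

lemma nrm_triangle:
  assumes "x \<in> carr E" "y \<in> carr E" "z \<in> carr E"
  shows "nrm E (x - z) \<le> nrm E (x - y) + nrm E (y - z)"
  using nrm_add[of "x - y" "y - z"] assms by simp

lemma nrm_reverse:
  assumes "x \<in> carr E" "y \<in> carr E"
  shows "\<bar>nrm E x - nrm E y\<bar> \<le> nrm E (x - y)"
  using nrm_add[of "x - y" y] nrm_add[of "y - x" x] assms nrm_commute[of x y] by simp

lemma nrm_sum: "(\<And>i. i \<in> I \<Longrightarrow> h i \<in> carr E) \<Longrightarrow> nrm E (sum h I) \<le> (\<Sum>i\<in>I. nrm E (h i))"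
proof (induction I rule: infinite_finite_induct)
  case (insert i I)
  have "nrm E (h i + sum h I) \<le> nrm E (h i) + nrm E (sum h I)"
    using insert.prems by (intro nrm_add sum_mem) auto
  then show ?case using insert by force
qed auto

lemma nrm_tendsto:
  assumes "\<forall>\<^sub>F r in F. u r \<in> carr E" "x \<in> carr E" "((\<lambda>r. nrm E (u r - x)) \<longlongrightarrow> 0) F"
  shows "((\<lambda>r. nrm E (u r)) \<longlongrightarrow> nrm E x) F"
proof (rule LIM_zero_cancel)
  show "((\<lambda>r. nrm E (u r) - nrm E x) \<longlongrightarrow> 0) F"
  proof (rule Lim_null_comparison[OF _ assms(3)])
    show "\<forall>\<^sub>F r in F. norm (nrm E (u r) - nrm E x) \<le> nrm E (u r - x)"
      using assms(1)
    proof eventually_elim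
      case (elim r)
      then show ?case using nrm_reverse[of "u r" x] assms(2) by simp
    qed
  qed
qed

lemma limit_unique:
  assumes "F \<noteq> bot" "\<forall>\<^sub>F r in F. u r \<in> carr E" "x \<in> carr E" "y \<in> carr E"
    and "((\<lambda>r. nrm E (u r - x)) \<longlongrightarrow> 0) F" "((\<lambda>r. nrm E (u r - y)) \<longlongrightarrow> 0) F"
  shows "x = y"
proof -
  have "((\<lambda>r. nrm E (u r - x) + nrm E (u r - y)) \<longlongrightarrow> 0 + 0) F"
    by (intro tendsto_add assms)
  moreover have "\<forall>\<^sub>F r in F. nrm E (x - y) \<le> nrm E (u r - x) + nrm E (u r - y)"
    using assms(2)
  proof eventually_elim
    case (elim r)
    then show ?case using nrm_triangle[of x "u r" y] assms(3,4) nrm_commute[of x "u r"] by simp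
  qed
  ultimately have "nrm E (x - y) \<le> 0 + 0"
    using assms(1) by (intro tendsto_lowerbound) auto
  then have "nrm E (x - y) = 0"
    using assms(3,4) nrm_ge0[of "x - y"] diff_mem[of x y] by linarith
  then show ?thesis
    using assms(3,4) nrm_eq0[of "x - y"] by simp
qed

lemma continuous_in_nrm:
  assumes "continuous_in E S u"
  shows "continuous_on S (\<lambda>s. nrm E (u s))"
  unfolding continuous_on_def
proof
  fix s assume "s \<in> S"
  then show "((\<lambda>s. nrm E (u s)) \<longlongrightarrow> nrm E (u s)) (at s within S)"
    using assms unfolding continuous_in_def
    by (intro nrm_tendsto) (auto simp: eventually_at_filter)
qed

lemma continuous_in_diff:
  assumes "continuous_in E S u" "continuous_in E S v"
  shows "continuous_in E S (\<lambda>s. u s - v s)"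
  unfolding continuous_in_def
proof (intro ballI conjI)
  fix s assume s: "s \<in> S"
  then show "u s - v s \<in> carr E" using assms unfolding continuous_in_def by auto
  have "((\<lambda>r. nrm E (u r - u s) + nrm E (v r - v s)) \<longlongrightarrow> 0 + 0) (at s within S)"
    using s assms unfolding continuous_in_def by (intro tendsto_add) auto
  moreover have "\<forall>\<^sub>F r in at s within S. norm (nrm E (u r - v r - (u s - v s)))
      \<le> nrm E (u r - u s) + nrm E (v r - v s)"
    unfolding eventually_at_filter
  proof (intro always_eventually allI impI)
    fix r assume "r \<in> S"
    then have m: "u r \<in> carr E" "v r \<in> carr E" "u s \<in> carr E" "v s \<in> carr E"
      using s assms unfolding continuous_in_def by auto
    show "norm (nrm E (u r - v r - (u s - v s))) \<le> nrm E (u r - u s) + nrm E (v r - v s)"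
      using nrm_diff[of "u r - u s" "v r - v s"] m by (simp add: algebra_simps)
  qed
  ultimately show "((\<lambda>r. nrm E (u r - v r - (u s - v s))) \<longlongrightarrow> 0) (at s within S)"
    by (auto intro: Lim_null_comparison)
qed

lemma continuous_in_scale:
  assumes "continuous_in E S u"
  shows "continuous_in E S (\<lambda>s. c *\<^sub>R u s)"
  unfolding continuous_in_def
proof (intro ballI conjI)
  fix s assume s: "s \<in> S"
  then show "c *\<^sub>R u s \<in> carr E" using assms unfolding continuous_in_def by auto
  have "((\<lambda>r. \<bar>c\<bar> * nrm E (u r - u s)) \<longlongrightarrow> \<bar>c\<bar> * 0) (at s within S)"
    using s assms unfolding continuous_in_def by (intro tendsto_mult_left) auto
  moreover have "\<forall>\<^sub>F r in at s within S. norm (nrm E (c *\<^sub>R u r - c *\<^sub>R u s)) \<le> \<bar>c\<bar> * nrm E (u r - u s)"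
    unfolding eventually_at_filter
  proof (intro always_eventually allI impI)
    fix r assume "r \<in> S"
    then have "u r \<in> carr E" "u s \<in> carr E"
      using s assms unfolding continuous_in_def by auto
    then show "norm (nrm E (c *\<^sub>R u r - c *\<^sub>R u s)) \<le> \<bar>c\<bar> * nrm E (u r - u s)"
      using nrm_scale[of "u r - u s" c] by (simp add: scaleR_diff_right[symmetric] abs_mult)
  qed
  ultimately show "((\<lambda>r. nrm E (c *\<^sub>R u r - c *\<^sub>R u s)) \<longlongrightarrow> 0) (at s within S)"
    by (auto intro: Lim_null_comparison)
qed

text \<open>A path dominated by a continuous one is continuous.\<close>

lemma continuous_in_comparison:
  assumes "\<And>s. s \<in> S \<Longrightarrow> v s \<in> carr E"
    and "\<And>r s. r \<in> S \<Longrightarrow> s \<in> S \<Longrightarrow> nrm E (v r - v s) \<le> c * nrm F (u r - u s)"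
    and "continuous_in F S u"
  shows "continuous_in E S v"
  unfolding continuous_in_def
proof (intro ballI conjI)
  fix s assume s: "s \<in> S"
  then show "v s \<in> carr E" by (rule assms)
  have "((\<lambda>r. c * nrm F (u r - u s)) \<longlongrightarrow> c * 0) (at s within S)"
    using s assms(3) unfolding continuous_in_def by (intro tendsto_mult_left) auto
  moreover have "\<forall>\<^sub>F r in at s within S. norm (nrm E (v r - v s)) \<le> c * nrm F (u r - u s)"
    unfolding eventually_at_filter
    using assms(1,2) s by (intro always_eventually) auto
  ultimately show "((\<lambda>r. nrm E (v r - v s)) \<longlongrightarrow> 0) (at s within S)"
    by (auto intro: Lim_null_comparison)
qed

lemma subspace_carrier:
  assumes "V \<subseteq> carr E" "0 \<in> V" "\<And>x y. x \<in> V \<Longrightarrow> y \<in> V \<Longrightarrow> x + y \<in> V"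
    and "\<And>r x. x \<in> V \<Longrightarrow> r *\<^sub>R x \<in> V"
  shows "normed_carrier (subsp E V)"
  using assms by unfold_locales (auto simp: subsp_def subset_iff nrm_eq0 nrm_add nrm_scale)

end

lemma continuous_in_mono: "continuous_in E S u \<Longrightarrow> T \<subseteq> S \<Longrightarrow> continuous_in E T u"
  unfolding continuous_in_def by (blast intro: tendsto_within_subset)

lemma continuous_in_cong:
  assumes "\<And>s. s \<in> S \<Longrightarrow> u s = v s"
  shows "continuous_in E S u \<longleftrightarrow> continuous_in E S v"
proof -
  have "((\<lambda>r. nrm E (u r - u s)) \<longlongrightarrow> 0) (at s within S) \<longleftrightarrow> ((\<lambda>r. nrm E (v r - v s)) \<longlongrightarrow> 0) (at s within S)"
    if "s \<in> S" for s
    using assms that by (intro filterlim_cong) (auto simp: eventually_at_filter)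
  then show ?thesis using assms unfolding continuous_in_def by auto
qed

lemma carr_subsp [simp]: "carr (subsp E V) = V" and nrm_subsp [simp]: "nrm (subsp E V) = nrm E"
  by (auto simp: subsp_def)

lemma continuous_in_subsp:
  "V \<subseteq> carr E \<Longrightarrow> continuous_in (subsp E V) S u \<longleftrightarrow> continuous_in E S u \<and> (\<forall>s\<in>S. u s \<in> V)"
  unfolding continuous_in_def by auto

lemma continuous_in_type_space [simp]: "continuous_in type_space S u \<longleftrightarrow> continuous_on S u"
  unfolding continuous_in_def continuous_on_def type_space_def
  by (simp add: tendsto_norm_zero_iff LIM_zero_iff)

lemma continuous_in_compose:
  assumes "continuous_in E T u" "continuous_on S \<phi>" "\<phi> ` S \<subseteq> T" "normed_carrier E"
  shows "continuous_in E S (\<lambda>s. u (\<phi> s))"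
  unfolding continuous_in_def
proof (intro ballI conjI)
  interpret normed_carrier E by fact
  fix s assume s: "s \<in> S"
  then show "u (\<phi> s) \<in> carr E" using assms unfolding continuous_in_def by auto
  have *: "((\<lambda>r. nrm E (u r - u (\<phi> s))) \<longlongrightarrow> nrm E (u (\<phi> s) - u (\<phi> s))) (at (\<phi> s) within T)"
    using s assms(1,3) unfolding continuous_in_def by auto
  show "((\<lambda>r. nrm E (u (\<phi> r) - u (\<phi> s))) \<longlongrightarrow> 0) (at s within S)"
    using continuous_within_tendsto_compose[of "\<phi> s" T "\<lambda>r. nrm E (u r - u (\<phi> s))" \<phi> "at s within S"]
      assms(2,3) * s
    by (auto simp: continuous_within continuous_on_def eventually_at_filter image_subset_iff)
qed

text \<open>With completeness added: the real Banach spaces.\<close>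

locale complete_carrier = normed_carrier +
  assumes complete: "\<And>\<sigma>. (\<And>n. \<sigma> n \<in> carr E) \<Longrightarrow>
    (\<And>e. e > 0 \<Longrightarrow> \<exists>N. \<forall>m\<ge>N. \<forall>n\<ge>N. nrm E (\<sigma> m - \<sigma> n) < e) \<Longrightarrow> \<exists>x. tends_in E \<sigma> x"

lemma real_scalar:
  assumes "scalar_mult K sc"
  shows "complex_of_real r \<in> K" "sc (complex_of_real r) x = r *\<^sub>R x"
  using assms unfolding scalar_mult_def by auto

lemma banach_space_imp_complete_carrier:
  assumes "scalar_mult K sc" "banach_space K sc E"
  shows "complete_carrier E"
proof -
  have scale: "nrm E (r *\<^sub>R x) = \<bar>r\<bar> * nrm E x \<and> r *\<^sub>R x \<in> carr E" if "x \<in> carr E" for r x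
    using real_scalar[OF assms(1), of r] assms(2) that
    unfolding banach_space_def subspace_in_def by (metis norm_of_real real_norm_def)
  show ?thesis
    by unfold_locales (use assms(2) scale in \<open>auto simp: banach_space_def subspace_in_def\<close>)
qed

lemma (in complete_carrier) closed_subspace_complete:
  assumes "closed_in E V" "normed_carrier (subsp E V)"
  shows "complete_carrier (subsp E V)"
proof -
  interpret V: normed_carrier "subsp E V" by fact
  show ?thesis
  proof
    fix \<sigma> :: "nat \<Rightarrow> 'a"
    assume m: "\<And>n. \<sigma> n \<in> carr (subsp E V)"
      and c: "\<And>e. e > 0 \<Longrightarrow> \<exists>N. \<forall>m\<ge>N. \<forall>n\<ge>N. nrm (subsp E V) (\<sigma> m - \<sigma> n) < e"
    have mE: "\<sigma> n \<in> carr E" for n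
      using m assms(1) by (auto simp: closed_in_def)
    obtain x where x: "tends_in E \<sigma> x"
      using complete[of \<sigma>, OF mE] c by auto
    then have "x \<in> V" using assms(1) m unfolding closed_in_def by auto
    then show "\<exists>x. tends_in (subsp E V) \<sigma> x"
      using x by (auto simp: tends_in_def)
  qed
qed

lemma (in normed_carrier) dominated_Cauchy:
  assumes m: "\<And>n. \<sigma> n \<in> carr E"
    and dom: "\<And>m n. n \<le> m \<Longrightarrow> nrm E (\<sigma> m - \<sigma> n) \<le> G m - G n"
    and G: "convergent G" and e: "e > 0"
  shows "\<exists>N::nat. \<forall>m\<ge>N. \<forall>n\<ge>N. nrm E (\<sigma> m - \<sigma> n) < e"
proof -
  have "Cauchy G" using G by (rule convergent_Cauchy)
  then obtain N where N: "\<And>m n. m \<ge> N \<Longrightarrow> n \<ge> N \<Longrightarrow> dist (G m) (G n) < e"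
    using e unfolding Cauchy_def by meson
  have "nrm E (\<sigma> m - \<sigma> n) < e" if "m \<ge> N" "n \<ge> N" for m n
  proof (cases "n \<le> m")
    case True
    then show ?thesis using dom[OF True] N[OF that] by (simp add: dist_real_def)
  next
    case False
    then show ?thesis using dom[of m n] N[OF that] nrm_commute[OF m m] by (simp add: dist_real_def)
  qed
  then show ?thesis by blast
qed

text \<open>A Banach space embedded continuously in its ambient type, in which the integrals are formed.\<close>

locale embedded_carrier = complete_carrier E for E :: "'a::banach nspace" +
  assumes embedded: "cont_embedded E type_space"
begin

lemma embedding_bound: obtains c where "c > 0" "\<And>x. x \<in> carr E \<Longrightarrow> norm x \<le> c * nrm E x"
proof -
  obtain c where c: "\<And>x. x \<in> carr E \<Longrightarrow> norm x \<le> c * nrm E x"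
    using embedded unfolding cont_embedded_def type_space_def by auto
  have "norm x \<le> (\<bar>c\<bar> + 1) * nrm E x" if "x \<in> carr E" for x
  proof -
    have "c * nrm E x \<le> (\<bar>c\<bar> + 1) * nrm E x"
      using that by (intro mult_right_mono) auto
    then show ?thesis using c[OF that] by linarith
  qed
  then show thesis using that[of "\<bar>c\<bar> + 1"] by auto
qed

lemma continuous_in_imp_continuous_on:
  assumes "continuous_in E S u"
  shows "continuous_on S u"
proof -
  obtain c where c: "c > 0" "\<And>x. x \<in> carr E \<Longrightarrow> norm x \<le> c * nrm E x" by (rule embedding_bound) blast
  interpret T: normed_carrier "type_space :: 'a nspace"
    by unfold_locales (auto simp: type_space_def norm_triangle_ineq)
  have m: "u s \<in> carr E" if "s \<in> S" for s
    using assms that unfolding continuous_in_def by auto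
  have "continuous_in type_space S u"
    by (rule T.continuous_in_comparison[where F=E and u=u and c=c])
      (use assms m c(2) in \<open>auto simp: type_space_def\<close>)
  then show ?thesis by simp
qed

text \<open>A sequence that is Cauchy in E and converges in the type converges to the same limit in E.\<close>

lemma limit_mem:
  assumes m: "\<And>n. \<sigma> n \<in> carr E"
    and cauchy: "\<And>e. e > 0 \<Longrightarrow> \<exists>N. \<forall>m\<ge>N. \<forall>n\<ge>N. nrm E (\<sigma> m - \<sigma> n) < e"
    and lim: "\<sigma> \<longlonglongrightarrow> x"
  shows "x \<in> carr E" "(\<lambda>n. nrm E (\<sigma> n - x)) \<longlonglongrightarrow> 0" "(\<lambda>n. nrm E (\<sigma> n)) \<longlonglongrightarrow> nrm E x"
proof -
  obtain c where c: "c > 0" "\<And>x. x \<in> carr E \<Longrightarrow> norm x \<le> c * nrm E x" by (rule embedding_bound) blast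
  obtain y where y: "y \<in> carr E" "(\<lambda>n. nrm E (\<sigma> n - y)) \<longlonglongrightarrow> 0"
    using complete[OF m cauchy] unfolding tends_in_def by auto
  have "(\<lambda>n. c * nrm E (\<sigma> n - y)) \<longlonglongrightarrow> c * 0"
    using y(2) by (rule tendsto_mult_left)
  then have "(\<lambda>n. \<sigma> n - y) \<longlonglongrightarrow> 0"
    using c(2) m y(1) by (auto intro!: Lim_null_comparison[of "\<lambda>n. \<sigma> n - y" "\<lambda>n. c * nrm E (\<sigma> n - y)"])
  then have "\<sigma> \<longlonglongrightarrow> y" by (simp add: LIM_zero_iff)
  then have "x = y" using lim LIMSEQ_unique by blast
  with y show "x \<in> carr E" "(\<lambda>n. nrm E (\<sigma> n - x)) \<longlonglongrightarrow> 0" by auto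
  then show "(\<lambda>n. nrm E (\<sigma> n)) \<longlonglongrightarrow> nrm E x"
    by (intro nrm_tendsto) (auto simp: m)
qed

lemma limit_mem_dominated:
  assumes m: "\<And>n. \<sigma> n \<in> carr E"
    and dom: "\<And>m n. n \<le> m \<Longrightarrow> nrm E (\<sigma> m - \<sigma> n) \<le> G m - G n"
    and G: "G \<longlonglongrightarrow> l" and lim: "\<sigma> \<longlonglongrightarrow> x"
  shows "x \<in> carr E" "(\<lambda>n. nrm E (\<sigma> n)) \<longlonglongrightarrow> nrm E x"
proof -
  from limit_mem[OF m dominated_Cauchy[OF m dom convergentI[OF G]] lim]
  show "x \<in> carr E" "(\<lambda>n. nrm E (\<sigma> n)) \<longlonglongrightarrow> nrm E x" by auto
qed

end

section \<open>Integrals of continuous paths in an embedded Banach space\<close>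

lemma has_integral_affine_UNIV:
  fixes f :: "real \<Rightarrow> 'b::banach"
  assumes "(f has_integral I) UNIV" "m \<noteq> 0"
  shows "((\<lambda>x. f (m * x + c)) has_integral (1 / \<bar>m\<bar>) *\<^sub>R I) UNIV"
  unfolding has_integral'[of "\<lambda>x. f (m * x + c)"]
proof (intro allI impI)
  fix e :: real assume e: "e > 0"
  obtain B where B: "B > 0" "\<And>a b. ball 0 B \<subseteq> cbox a b \<Longrightarrow>
      \<exists>z. (f has_integral z) (cbox a b) \<and> norm (z - I) < e * \<bar>m\<bar>"
    using has_integral'[THEN iffD1, OF assms(1), rule_format, of "e * \<bar>m\<bar>"] e assms(2) by auto
  define R where "R = (B + \<bar>c\<bar>) / \<bar>m\<bar> + 1"
  have R: "R > 0" using B(1) assms(2) by (auto simp: R_def intro!: add_nonneg_pos divide_nonneg_pos)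
  show "\<exists>B>0. \<forall>a b. ball 0 B \<subseteq> cbox a b \<longrightarrow>
      (\<exists>z. ((\<lambda>x. if x \<in> UNIV then f (m * x + c) else 0) has_integral z) (cbox a b) \<and>
        norm (z - (1 / \<bar>m\<bar>) *\<^sub>R I) < e)"
  proof (intro exI[of _ R] conjI allI impI R)
    fix a b :: real assume ab: "ball 0 R \<subseteq> cbox a b"
    define a' b' where "a' = min (m * a + c) (m * b + c)" and "b' = max (m * a + c) (m * b + c)"
    have "ball 0 B \<subseteq> cbox a' b'"
    proof
      fix x :: real assume x: "x \<in> ball 0 B"
      have "\<bar>(x - c) / m\<bar> \<le> (B + \<bar>c\<bar>) / \<bar>m\<bar>"
        using x by (auto simp: abs_divide intro!: divide_right_mono)
      then have "(x - c) / m \<in> ball 0 R" by (simp add: R_def)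
      then have "(x - c) / m \<in> cbox a b" using ab by blast
      then have "a \<le> (x - c) / m" "(x - c) / m \<le> b" by auto
      then show "x \<in> cbox a' b'"
        using assms(2) by (cases "m > 0") (auto simp: a'_def b'_def field_simps)
    qed
    then obtain z where z: "(f has_integral z) (cbox a' b')" "norm (z - I) < e * \<bar>m\<bar>"
      using B(2) by blast
    have "(\<lambda>x. (1 / m) *\<^sub>R x + - ((1 / m) *\<^sub>R c)) ` cbox a' b' = cbox a b"
    proof -
      have "0 \<in> cbox a b" by (rule subsetD[OF ab]) (use R in simp)
      then have "a \<le> b" by auto
      have inj: "(1 / m) * (m * x + c) + - ((1 / m) * c) = x" for x using assms(2) by (simp add: field_simps)
      have "x \<in> cbox a b \<longleftrightarrow> m * x + c \<in> cbox a' b'" for x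
        using assms(2) \<open>a \<le> b\<close>
        by (cases "m > 0") (auto simp: a'_def b'_def min_def max_def mult_le_cancel_left)
      then have "cbox a' b' = (\<lambda>x. m * x + c) ` cbox a b"
      proof -
        have "y = m * ((y - c) / m) + c" for y using assms(2) by simp
        then show ?thesis
          using \<open>\<And>x. x \<in> cbox a b \<longleftrightarrow> m * x + c \<in> cbox a' b'\<close> by (metis (no_types, lifting) image_iff set_eqI)
      qed
      then show ?thesis by (simp only: image_image real_scaleR_def inj image_ident)
    qed
    with has_integral_affinity[OF z(1) assms(2), of c]
    have "((\<lambda>x. f (m *\<^sub>R x + c)) has_integral (1 / \<bar>m\<bar> ^ DIM(real)) *\<^sub>R z) (cbox a b)"
      by (simp only:)
    then have "((\<lambda>x. f (m * x + c)) has_integral (1 / \<bar>m\<bar>) *\<^sub>R z) (cbox a b)"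
      by (simp only: real_scaleR_def DIM_real power_one_right)
    moreover have "norm ((1 / \<bar>m\<bar>) *\<^sub>R z - (1 / \<bar>m\<bar>) *\<^sub>R I) < e"
      using z(2) assms(2)
      by (simp only: scaleR_diff_right[symmetric] norm_scaleR) (simp add: pos_divide_less_eq)
    ultimately show "\<exists>z. ((\<lambda>x. if x \<in> UNIV then f (m * x + c) else 0) has_integral z) (cbox a b) \<and>
        norm (z - (1 / \<bar>m\<bar>) *\<^sub>R I) < e" by auto
  qed
qed

text \<open>Integrability up to a singular endpoint, for functions with values in a Banach space: the
  indefinite integral is uniformly continuous, and the fundamental theorem of calculus applies to
  its continuous extension.\<close>

lemma integrable_dominated_open_interval:
  fixes h :: "real \<Rightarrow> 'b::banach"
  assumes cont: "continuous_on {a<..<b} h" and D: "D integrable_on {a..b}"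
    and le: "\<And>x. x \<in> {a<..<b} \<Longrightarrow> norm (h x) \<le> D x"
  shows "h integrable_on {a..b}"
proof (cases "a < b")
  case False
  then show ?thesis
    using integrable_on_refl[of h a] by (cases "a = b") auto
next
  case True
  define m where "m = (a + b) / 2"
  have m: "a < m" "m < b" using True by (auto simp: m_def)
  have hint: "h integrable_on {x..y}" if "a < x" "y < b" for x y
    using that by (intro integrable_continuous_real continuous_on_subset[OF cont]) auto
  define F where "F x = (if m \<le> x then integral {m..x} h else - integral {x..m} h)" for x
  have Fdiff: "F y - F x = integral {x..y} h" if "a < x" "x \<le> y" "y < b" for x y
  proof -
    consider "m \<le> x" | "x < m" "m \<le> y" | "y < m" using \<open>x \<le> y\<close> by linarith
    then show ?thesis
    proof cases
      case 1
      have "integral {m..x} h + integral {x..y} h = integral {m..y} h"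
        using 1 that m by (intro Henstock_Kurzweil_Integration.integral_combine hint) auto
      then show ?thesis using 1 that by (simp add: F_def algebra_simps)
    next
      case 2
      have "integral {x..m} h + integral {m..y} h = integral {x..y} h"
        using 2 that m by (intro Henstock_Kurzweil_Integration.integral_combine hint) auto
      then show ?thesis using 2 that by (simp add: F_def algebra_simps)
    next
      case 3
      have "integral {x..y} h + integral {y..m} h = integral {x..m} h"
        using 3 that m by (intro Henstock_Kurzweil_Integration.integral_combine hint) auto
      then show ?thesis using 3 that by (simp add: F_def algebra_simps)
    qed
  qed
  define G where "G x = integral {a..x} D" for x
  have Gdiff: "norm (F y - F x) \<le> G y - G x" if "a < x" "x \<le> y" "y < b" for x y
  proof -
    have Dint: "D integrable_on {x..y}" "D integrable_on {a..y}"
      using D that by (auto intro: integrable_subinterval_real)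
    have "norm (integral {x..y} h) \<le> integral {x..y} D"
      using that by (intro integral_norm_bound_integral hint Dint le) auto
    moreover have "integral {a..x} D + integral {x..y} D = integral {a..y} D"
      using that Dint by (intro Henstock_Kurzweil_Integration.integral_combine) auto
    ultimately show ?thesis using Fdiff[OF that] by (simp add: G_def)
  qed
  have "continuous_on {a..b} G" unfolding G_def by (rule indefinite_integral_continuous_1[OF D])
  then have Guc: "uniformly_continuous_on {a..b} G"
    by (rule compact_uniformly_continuous) simp
  have "uniformly_continuous_on {a<..<b} F"
    unfolding uniformly_continuous_on_def
  proof (intro allI impI)
    fix e :: real assume "e > 0"
    then obtain d where d: "d > 0" "\<And>x x'. x \<in> {a..b} \<Longrightarrow> x' \<in> {a..b} \<Longrightarrow> dist x' x < d \<Longrightarrow> dist (G x') (G x) < e"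
      using Guc unfolding uniformly_continuous_on_def by meson
    show "\<exists>d>0. \<forall>x\<in>{a<..<b}. \<forall>x'\<in>{a<..<b}. dist x' x < d \<longrightarrow> dist (F x') (F x) < e"
    proof (intro exI[of _ d] conjI ballI impI d(1))
      fix x x' assume x: "x \<in> {a<..<b}" "x' \<in> {a<..<b}" "dist x' x < d"
      have "dist (G x') (G x) < e" using d(2)[of x x'] x by auto
      moreover have "dist (F x') (F x) \<le> dist (G x') (G x)"
        using Gdiff[of x x'] Gdiff[of x' x] x
        by (cases "x \<le> x'") (auto simp: dist_norm norm_minus_commute)
      ultimately show "dist (F x') (F x) < e" by linarith
    qed
  qed
  then obtain g where g: "uniformly_continuous_on (closure {a<..<b}) g" "\<And>x. x \<in> {a<..<b} \<Longrightarrow> F x = g x"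
    by (rule uniformly_continuous_on_extension_on_closure) auto
  have gc: "continuous_on {a..b} g"
    using uniformly_continuous_imp_continuous[OF g(1)] True by simp
  have "(g has_vector_derivative h x) (at x)" if x: "x \<in> {a<..<b}" for x
  proof -
    define c d where "c = (a + x) / 2" and "d = (x + b) / 2"
    have cd: "a < c" "c < x" "x < d" "d < b" using x by (auto simp: c_def d_def)
    have "((\<lambda>u. integral {c..u} h) has_vector_derivative h x) (at x within {c..d})"
      by (rule integral_has_vector_derivative) (use cd in \<open>auto intro: continuous_on_subset[OF cont]\<close>)
    then have "((\<lambda>u. integral {c..u} h) has_vector_derivative h x) (at x)"
      using cd at_within_Icc_at[of c x d] by auto
    then have "((\<lambda>u. F c + integral {c..u} h) has_vector_derivative h x) (at x)"
      by (auto intro: derivative_eq_intros)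
    then show ?thesis
    proof (rule has_vector_derivative_transform_within_open)
      show "open {c<..<d}" "x \<in> {c<..<d}" using cd by auto
      fix y assume "y \<in> {c<..<d}"
      then show "F c + integral {c..y} h = g y" using Fdiff[of c y] g(2)[of y] cd by (auto simp: algebra_simps)
    qed
  qed
  then have "(h has_integral g b - g a) {a..b}"
    using True gc by (intro fundamental_theorem_of_calculus_interior) auto
  then show ?thesis by blast
qed

text \<open>Interior exceptional points are removed one at a time by splitting the interval there.\<close>

lemma integrable_dominated_interval:
  fixes h :: "real \<Rightarrow> 'b::banach"
  assumes "finite K" "continuous_on ({a<..<b} - K) h" "D integrable_on {a..b}"
    and "\<And>x. x \<in> {a<..<b} - K \<Longrightarrow> norm (h x) \<le> D x"
  shows "h integrable_on {a..b}"
  using assms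
proof (induction K arbitrary: a b rule: finite_induct)
  case empty
  then show ?case using integrable_dominated_open_interval[where h=h and D=D] by simp
next
  case (insert c K)
  show ?case
  proof (cases "c \<in> {a<..<b}")
    case False
    then have "{a<..<b} - insert c K = {a<..<b} - K" by auto
    then show ?thesis using insert.IH insert.prems by simp
  next
    case True
    have "h integrable_on {a..c}"
      by (rule insert.IH) (use True insert.prems in
        \<open>auto intro: continuous_on_subset integrable_subinterval_real\<close>)
    moreover have "h integrable_on {c..b}"
      by (rule insert.IH) (use True insert.prems in
        \<open>auto intro: continuous_on_subset integrable_subinterval_real\<close>)
    ultimately show ?thesis using True by (intro Henstock_Kurzweil_Integration.integrable_combine[of a c b]) auto
  qed
qed

lemma integrable_dominated_half_line:
  fixes h :: "real \<Rightarrow> 'b::banach"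
  assumes "finite K" "continuous_on ({0<..} - K) h" "D integrable_on {0<..}"
    and le: "\<And>x. x > 0 \<Longrightarrow> norm (h x) \<le> D x"
  shows "h integrable_on {0<..}"
proof (rule integrable_on_all_intervals_integrable_bound[OF _ _ assms(3)])
  show "norm (h x) \<le> D x" if "x \<in> {0<..}" for x using le that by simp
  fix a b :: real
  have D: "(\<lambda>x. if x \<in> {0<..} then D x else 0) integrable_on {a..b}"
    using assms(3) integrable_altD(1)[of D "{0<..}" a b] by simp
  have "continuous_on ({a<..<b} - insert 0 K) (\<lambda>x. if x \<in> {0<..} then h x else 0)"
  proof -
    have "continuous_on ({0<..} - K \<union> {..<0}) (\<lambda>x. if x \<in> {0<..} then h x else 0)"
    proof (rule continuous_on_cases_local)
      have "{0<..} - K = ({0<..} - K \<union> {..<0}) \<inter> {0..}" by auto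
      then show "closedin (top_of_set ({0<..} - K \<union> {..<0})) ({0<..} - K)"
        by (metis closedin_closed_Int closed_atLeast)
      have "{..<0} = ({0<..} - K \<union> {..<0}) \<inter> {..0}" by auto
      then show "closedin (top_of_set ({0<..} - K \<union> {..<0})) {..<0}"
        by (metis closedin_closed_Int closed_atMost)
    qed (use assms(2) in auto)
    then show ?thesis by (rule continuous_on_subset) auto
  qed
  then show "(\<lambda>x. if x \<in> {0<..} then h x else 0) integrable_on cbox a b"
    unfolding box_real
    by (intro integrable_dominated_interval[where K="insert 0 K", OF _ _ D]) (use assms(1) le in auto)
qed

lemma integral_half_line_limit:
  fixes h :: "real \<Rightarrow> 'b::banach"
  assumes "h integrable_on {0<..}"
  shows "(\<lambda>n. integral {0..real n} h) \<longlonglongrightarrow> integral {0<..} h"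
proof (rule LIMSEQ_I)
  fix e :: real assume e: "e > 0"
  have "(h has_integral integral {0<..} h) {0<..}" using assms by (rule integrable_integral)
  then obtain B where B: "B > 0" "\<And>a b. ball 0 B \<subseteq> cbox a b \<Longrightarrow>
      norm (integral (cbox a b) (\<lambda>x. if x \<in> {0<..} then h x else 0) - integral {0<..} h) < e"
    using e unfolding has_integral_alt'[of h] by meson
  show "\<exists>N. \<forall>n\<ge>N. norm (integral {0..real n} h - integral {0<..} h) < e"
  proof (intro exI[of _ "nat \<lceil>B\<rceil>"] allI impI)
    fix n assume "nat \<lceil>B\<rceil> \<le> n"
    then have n: "B \<le> real n" by linarith
    then have "ball 0 B \<subseteq> cbox (- real n) (real n)" by (auto simp: dist_real_def)
    from B(2)[OF this]
    have *: "norm (integral {- real n..real n} (\<lambda>x. if x \<in> {0<..} then h x else 0) - integral {0<..} h) < e"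
      by simp
    have "integral {- real n..real n} (\<lambda>x. if x \<in> {0<..} then h x else 0)
        = integral ({0<..} \<inter> {- real n..real n}) h"
      by (rule integral_restrict_Int)
    also have "\<dots> = integral {0..real n} h"
      by (rule integral_spike_set) (auto intro: negligible_subset[of "{0}"])
    finally show "norm (integral {0..real n} h - integral {0<..} h) < e" using * by simp
  qed
qed

lemma integral_sum_equal_pieces:
  fixes f :: "real \<Rightarrow> 'b::banach" and n :: nat
  assumes "f integrable_on {a..a + real n * d}" "d \<ge> 0"
  shows "integral {a..a + real n * d} f = (\<Sum>i<(n::nat). integral {a + real i * d..a + real (Suc i) * d} f)"
  using assms
proof (induction n)
  case (Suc n)
  have le: "a + real n * d \<le> a + real (Suc n) * d"
    using Suc.prems by (intro add_left_mono mult_right_mono) auto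
  have "f integrable_on {a..a + real n * d}"
    using Suc.prems(1) le by (rule_tac integrable_subinterval_real) auto
  moreover have "integral {a..a + real n * d} f + integral {a + real n * d..a + real (Suc n) * d} f
      = integral {a..a + real (Suc n) * d} f"
    using Suc.prems le by (intro Henstock_Kurzweil_Integration.integral_combine) auto
  ultimately show ?case using Suc by simp
qed auto

text \<open>Left Riemann sums over n equal pieces.\<close>

definition riemann_sum :: "(real \<Rightarrow> 'b::real_vector) \<Rightarrow> real \<Rightarrow> real \<Rightarrow> nat \<Rightarrow> 'b" where
  "riemann_sum f a b n = (\<Sum>i<n. ((b - a) / n) *\<^sub>R f (a + real i * ((b - a) / n)))"

lemma riemann_sum_point:
  fixes n :: nat
  assumes "a \<le> b" "i \<le> n"
  shows "a + real i * ((b - a) / n) \<in> {a..b}"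
proof (cases "n = 0")
  case False
  have "real i * ((b - a) / n) \<le> real n * ((b - a) / n)"
    using assms by (intro mult_right_mono) auto
  then show ?thesis using assms False by simp
qed (use assms in auto)

lemma riemann_sum_tendsto:
  fixes f :: "real \<Rightarrow> 'b::banach"
  assumes "a \<le> b" "continuous_on {a..b} f"
  shows "riemann_sum f a b \<longlonglongrightarrow> integral {a..b} f"
proof (rule LIMSEQ_I)
  fix e :: real assume e: "e > 0"
  (* the summand 1 keeps the denominator positive when a = b *)
  define e' where "e' = e / (2 * (b - a + 1))"
  have e': "e' > 0" using e assms by (simp add: e'_def)
  have "uniformly_continuous_on {a..b} f"
    using assms by (intro compact_uniformly_continuous) auto
  then obtain d where d: "d > 0" "\<And>x x'. x \<in> {a..b} \<Longrightarrow> x' \<in> {a..b} \<Longrightarrow> dist x' x < d \<Longrightarrow> dist (f x') (f x) < e'"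
    using e' unfolding uniformly_continuous_on_def by meson
  obtain N where N: "(b - a) / d < real N" using reals_Archimedean2 by blast
  show "\<exists>N. \<forall>n\<ge>N. norm (riemann_sum f a b n - integral {a..b} f) < e"
  proof (intro exI[of _ N] allI impI)
    fix n assume "N \<le> n"
    have "0 \<le> (b - a) / d" using d(1) assms by simp
    then have n: "n > 0" using N \<open>N \<le> n\<close> by (cases n) auto
    define \<delta> where "\<delta> = (b - a) / n"
    have \<delta>0: "\<delta> \<ge> 0" using assms by (simp add: \<delta>_def)
    have "(b - a) / d < real n" using N \<open>N \<le> n\<close> by linarith
    then have \<delta>: "\<delta> < d" using d(1) n by (simp add: \<delta>_def field_simps)
    have b: "a + real n * \<delta> = b" using n by (simp add: \<delta>_def)
    have fint: "f integrable_on {a..b}" using assms by (intro integrable_continuous_real)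
    have piece: "norm (\<delta> *\<^sub>R f (a + real i * \<delta>) - integral {a + real i * \<delta>..a + real (Suc i) * \<delta>} f) \<le> e' * \<delta>"
      if "i < n" for i
    proof -
      define x y where "x = a + real i * \<delta>" and "y = a + real (Suc i) * \<delta>"
      have x: "x \<in> {a..b}" "y \<in> {a..b}"
        using riemann_sum_point[OF assms(1), of i n] riemann_sum_point[OF assms(1), of "Suc i" n] that
        unfolding x_def y_def \<delta>_def by auto
      have y: "y = x + \<delta>" by (simp add: x_def y_def algebra_simps)
      have fi: "f integrable_on {x..y}"
        using x by (intro integrable_subinterval_real[OF fint]) auto
      have "norm (integral {x..y} (\<lambda>s. f x - f s)) \<le> integral {x..y} (\<lambda>s. e')"
      proof (rule integral_norm_bound_integral)
        show "(\<lambda>s. f x - f s) integrable_on {x..y}" using fi by (intro integrable_diff) auto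
        fix s assume s: "s \<in> {x..y}"
        then have "dist (f x) (f s) < e'"
          using x y \<delta> by (intro d(2)) (auto simp: dist_real_def)
        then show "norm (f x - f s) \<le> e'" by (simp add: dist_norm)
      qed auto
      moreover have "integral {x..y} (\<lambda>s. f x - f s) = \<delta> *\<^sub>R f x - integral {x..y} f"
        using fi y \<delta>0 by (subst integral_diff) auto
      ultimately show ?thesis using y \<delta>0 by (simp add: x_def y_def mult.commute)
    qed
    have "norm (riemann_sum f a b n - integral {a..b} f)
        = norm (\<Sum>i<n. \<delta> *\<^sub>R f (a + real i * \<delta>) - integral {a + real i * \<delta>..a + real (Suc i) * \<delta>} f)"
      using integral_sum_equal_pieces[of f a n \<delta>] fint \<delta>0 b
      by (simp only: riemann_sum_def \<delta>_def[symmetric] sum_subtractf)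
    also have "\<dots> \<le> (\<Sum>i<n. e' * \<delta>)"
      by (intro sum_norm_le piece) auto
    also have "\<dots> = e' * (b - a)" using n by (simp add: \<delta>_def)
    also have "\<dots> \<le> e / 2"
      using assms e unfolding e'_def by (simp add: field_simps)
    finally show "norm (riemann_sum f a b n - integral {a..b} f) < e" using e by linarith
  qed
qed

lemma riemann_sum_refine:
  assumes "q > 0"
  shows "riemann_sum h a b n = (\<Sum>j<n * q. ((b - a) / (n * q)) *\<^sub>R h (a + real (j div q) * ((b - a) / n)))"
proof -
  let ?c = "\<lambda>i. ((b - a) / (n * q)) *\<^sub>R h (a + real i * ((b - a) / n))"
  have "(\<Sum>j<n * q. ?c (j div q)) = (\<Sum>m<n. \<Sum>j\<in>{m * q..<m * q + q}. ?c (j div q))"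
    by (rule sum.nat_group[symmetric])
  also have "\<dots> = (\<Sum>m<n. \<Sum>j\<in>{m * q..<m * q + q}. ?c m)"
    using assms by (intro sum.cong refl arg_cong[of _ _ ?c]) (auto intro!: div_nat_eqI simp: algebra_simps)
  also have "\<dots> = (\<Sum>m<n. ((b - a) / n) *\<^sub>R h (a + real m * ((b - a) / n)))"
  proof -
    have "real q * ((b - a) / (n * q)) = (b - a) / n"
      using assms by simp
    then show ?thesis by (simp add: sum_constant_scaleR)
  qed
  finally show ?thesis by (simp add: riemann_sum_def)
qed

context embedded_carrier
begin

lemma uniformly_continuous_in:
  assumes cont: "continuous_in E {a..b} h" and e: "e > 0"
  obtains d where "d > 0" "\<And>r s. r \<in> {a..b} \<Longrightarrow> s \<in> {a..b} \<Longrightarrow> \<bar>r - s\<bar> < d \<Longrightarrow> nrm E (h r - h s) < e"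
proof -
  have m: "h s \<in> carr E" if "s \<in> {a..b}" for s using cont that unfolding continuous_in_def by auto
  have "\<exists>d>0. \<forall>r\<in>{a..b}. \<bar>r - s\<bar> < d \<longrightarrow> nrm E (h r - h s) < e / 2" if s: "s \<in> {a..b}" for s
  proof -
    have "((\<lambda>r. nrm E (h r - h s)) \<longlongrightarrow> 0) (at s within {a..b})"
      using cont s unfolding continuous_in_def by auto
    then have "\<forall>\<^sub>F r in at s within {a..b}. nrm E (h r - h s) < e / 2"
      using e by (intro order_tendstoD(2)) auto
    then obtain d where "d > 0" "\<And>r. r \<in> {a..b} \<Longrightarrow> r \<noteq> s \<Longrightarrow> dist r s < d \<Longrightarrow> nrm E (h r - h s) < e / 2"
      unfolding eventually_at by auto
    moreover have "nrm E (h s - h s) < e / 2" using e by simp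
    ultimately show ?thesis by (metis dist_real_def)
  qed
  then obtain \<rho> where \<rho>: "\<And>s. s \<in> {a..b} \<Longrightarrow> \<rho> s > 0"
    "\<And>s r. s \<in> {a..b} \<Longrightarrow> r \<in> {a..b} \<Longrightarrow> \<bar>r - s\<bar> < \<rho> s \<Longrightarrow> nrm E (h r - h s) < e / 2" by metis
  have "{a..b} \<subseteq> \<Union>((\<lambda>s. ball s (\<rho> s)) ` {a..b})" using \<rho>(1) by force
  then obtain d where d: "d > 0" "\<And>x. x \<in> {a..b} \<Longrightarrow> \<exists>G\<in>(\<lambda>s. ball s (\<rho> s)) ` {a..b}. ball x d \<subseteq> G"
    by (rule Heine_Borel_lemma[OF compact_Icc]) auto
  show thesis
  proof (rule that[OF d(1)])
    fix r s assume rs: "r \<in> {a..b}" "s \<in> {a..b}" "\<bar>r - s\<bar> < d"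
    obtain z where z: "z \<in> {a..b}" "ball r d \<subseteq> ball z (\<rho> z)" using d(2)[OF rs(1)] by auto
    have "r \<in> ball z (\<rho> z)" by (rule subsetD[OF z(2)]) (use d(1) in auto)
    moreover have "s \<in> ball z (\<rho> z)" by (rule subsetD[OF z(2)]) (use rs in \<open>auto simp: dist_real_def\<close>)
    ultimately have "nrm E (h r - h z) < e / 2" "nrm E (h s - h z) < e / 2"
      using \<rho>(2)[OF z(1)] rs by (auto simp: dist_real_def abs_minus_commute)
    moreover have "nrm E (h r - h s) \<le> nrm E (h r - h z) + nrm E (h z - h s)"
      using m rs z by (intro nrm_triangle) auto
    moreover have "nrm E (h z - h s) = nrm E (h s - h z)" using m rs z by (intro nrm_commute) auto
    ultimately show "nrm E (h r - h s) < e" by linarith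
  qed
qed

text \<open>Riemann sums of a continuous path converge in the norm of E: two of them are compared through
  the sum over their common refinement.\<close>

lemma integral_compact:
  assumes ab: "a \<le> b" and cont: "continuous_in E {a..b} h"
  shows "integral {a..b} h \<in> carr E" "nrm E (integral {a..b} h) \<le> integral {a..b} (\<lambda>s. nrm E (h s))"
proof -
  have m: "h s \<in> carr E" if "s \<in> {a..b}" for s using cont that unfolding continuous_in_def by auto
  have sm: "riemann_sum h a b n \<in> carr E" for n
    unfolding riemann_sum_def using riemann_sum_point[OF ab] by (intro sum_mem scale_mem m) auto
  (* each point of the finer sum lies within one step of a point of the coarser one *)
  have osc: "nrm E (riemann_sum h a b k - riemann_sum h a b (k * l)) \<le> e * (b - a)"
    if d: "\<And>r s. r \<in> {a..b} \<Longrightarrow> s \<in> {a..b} \<Longrightarrow> \<bar>r - s\<bar> < d \<Longrightarrow> nrm E (h r - h s) < e"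
      and k: "(b - a) / k < d" and kl: "k > 0" "l > 0" for k l :: nat and e d
  proof -
    define n where "n = k * l"
    have n: "n > 0" using kl by (auto simp: n_def)
    let ?x = "\<lambda>j. a + real (j div l) * ((b - a) / k)" and ?y = "\<lambda>j. a + real j * ((b - a) / n)"
    have pts: "?x j \<in> {a..b}" "?y j \<in> {a..b}" "\<bar>?x j - ?y j\<bar> < d" if "j < n" for j
    proof -
      have "j div l < k" using that unfolding n_def by (simp add: less_mult_imp_div_less)
      then show "?x j \<in> {a..b}" by (intro riemann_sum_point ab) auto
      show "?y j \<in> {a..b}" using that by (intro riemann_sum_point ab) auto
      have j: "real j = real (j div l) * real l + real (j mod l)"
        by (metis div_mult_mod_eq of_nat_add of_nat_mult)
      have eq: "\<bar>?x j - ?y j\<bar> = real (j mod l) / real l * ((b - a) / k)"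
      proof -
        have "?y j - ?x j = real (j mod l) / real l * ((b - a) / k)"
          unfolding j using kl by (simp add: n_def field_simps)
        moreover have "0 \<le> real (j mod l) / real l * ((b - a) / k)" using ab by simp
        ultimately show ?thesis by (simp only: abs_minus_commute[of "?x j"] abs_of_nonneg)
      qed
      have "real (j mod l) / real l \<le> 1"
        using kl by (auto simp: field_simps less_imp_le)
      then have "real (j mod l) / real l * ((b - a) / k) \<le> (b - a) / k"
        using ab by (intro mult_left_le_one_le) auto
      then show "\<bar>?x j - ?y j\<bar> < d" unfolding eq using k by (rule order.strict_trans1)
    qed
    define z where "z j = h (?x j) - h (?y j)" for j
    have zm: "z j \<in> carr E" "nrm E (z j) < e" if "j < n" for j
      unfolding z_def using pts[OF that] by (blast intro: diff_mem m d)+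
    have "riemann_sum h a b k - riemann_sum h a b n = (\<Sum>j<n. ((b - a) / n) *\<^sub>R z j)"
      unfolding riemann_sum_refine[OF kl(2), of h a b k] unfolding riemann_sum_def
      by (simp only: n_def z_def sum_subtractf scaleR_diff_right of_nat_mult)
    also have "nrm E \<dots> \<le> (\<Sum>j<n. nrm E (((b - a) / n) *\<^sub>R z j))"
      using zm by (intro nrm_sum scale_mem) auto
    also have "\<dots> \<le> (\<Sum>j<n. ((b - a) / n) * e)"
    proof (rule sum_mono)
      fix j assume j: "j \<in> {..<n}"
      have "nrm E (((b - a) / n) *\<^sub>R z j) = ((b - a) / n) * nrm E (z j)"
        using zm[of j] j ab by (subst nrm_scale) auto
      also have "\<dots> \<le> ((b - a) / n) * e"
        using zm(2)[of j] j ab by (intro mult_left_mono) auto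
      finally show "nrm E (((b - a) / n) *\<^sub>R z j) \<le> ((b - a) / n) * e" .
    qed
    also have "\<dots> = e * (b - a)" using n by simp
    finally show ?thesis by (simp only: n_def)
  qed
  have "\<exists>N. \<forall>k\<ge>N. \<forall>l\<ge>N. nrm E (riemann_sum h a b k - riemann_sum h a b l) < e" if e: "e > 0" for e
  proof -
    define e' where "e' = e / (2 * (b - a + 1))"
    have e': "e' > 0" using e ab by (simp add: e'_def)
    have "e * (b - a) < e * (b - a + 1)" using e by simp
    then have e'2: "2 * (e' * (b - a)) < e" using ab by (simp add: e'_def pos_divide_less_eq algebra_simps)
    obtain d where d: "d > 0" "\<And>r s. r \<in> {a..b} \<Longrightarrow> s \<in> {a..b} \<Longrightarrow> \<bar>r - s\<bar> < d \<Longrightarrow> nrm E (h r - h s) < e'"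
      by (rule uniformly_continuous_in[OF cont e']) blast
    obtain N where N: "(b - a) / d < real N" using reals_Archimedean2 by blast
    have "0 \<le> (b - a) / d" using d(1) ab by simp
    then have N0: "N > 0" using N by (cases N) auto
    have small: "(b - a) / k < d" if "N \<le> k" for k :: nat
    proof -
      have "(b - a) / d < real k" using N that by linarith
      then show ?thesis using d(1) N0 that by (simp add: field_simps)
    qed
    have "nrm E (riemann_sum h a b k - riemann_sum h a b l) < e" if "k \<ge> N" "l \<ge> N" for k l
    proof -
      have kl: "k > 0" "l > 0" using that N0 by auto
      have "nrm E (riemann_sum h a b k - riemann_sum h a b (k * l)) \<le> e' * (b - a)"
        by (rule osc[OF d(2) small[OF that(1)] kl])
      moreover have "nrm E (riemann_sum h a b l - riemann_sum h a b (l * k)) \<le> e' * (b - a)"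
        by (rule osc[OF d(2) small[OF that(2)] kl(2,1)])
      ultimately show ?thesis
        using nrm_triangle[OF sm sm sm, of k l "k * l"] nrm_commute[OF sm sm, of l "k * l"] e'2
        by (simp add: mult.commute)
    qed
    then show ?thesis by blast
  qed
  note lim = limit_mem[OF sm this riemann_sum_tendsto[OF ab continuous_in_imp_continuous_on[OF cont]]]
  show "integral {a..b} h \<in> carr E" by (rule lim)
  have "riemann_sum (\<lambda>s. nrm E (h s)) a b \<longlonglongrightarrow> integral {a..b} (\<lambda>s. nrm E (h s))"
    using ab cont by (intro riemann_sum_tendsto continuous_in_nrm)
  moreover have "nrm E (riemann_sum h a b n) \<le> riemann_sum (\<lambda>s. nrm E (h s)) a b n" for n
  proof -
    have pt: "h (a + real i * ((b - a) / n)) \<in> carr E" if "i < n" for i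
      using that by (intro m riemann_sum_point ab) auto
    have "nrm E (riemann_sum h a b n) \<le> (\<Sum>i<n. nrm E (((b - a) / n) *\<^sub>R h (a + real i * ((b - a) / n))))"
      unfolding riemann_sum_def using pt by (intro nrm_sum scale_mem) auto
    also have "\<dots> = riemann_sum (\<lambda>s. nrm E (h s)) a b n"
      unfolding riemann_sum_def using pt ab by (intro sum.cong refl) (auto simp: nrm_scale)
    finally show ?thesis .
  qed
  ultimately show "nrm E (integral {a..b} h) \<le> integral {a..b} (\<lambda>s. nrm E (h s))"
    by (intro LIMSEQ_le[OF lim(3)]) auto
qed

end

lemma integral_exhaustion:
  fixes f :: "real \<Rightarrow> 'b::banach"
  assumes "a < b" "f integrable_on {a..b}"
  shows "(\<lambda>n. integral {a + (b - a) / real (n + 2)..b - (b - a) / real (n + 2)} f) \<longlonglongrightarrow> integral {a..b} f"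
proof -
  define I where "I x = integral {a..x} f" for x
  have I: "continuous_on {a..b} I"
    unfolding I_def by (rule indefinite_integral_continuous_1[OF assms(2)])
  have d: "0 \<le> (b - a) / real (n + 2)" "(b - a) / real (n + 2) \<le> (b - a) / 2" for n
    using assms(1) by simp (use assms(1) in \<open>intro divide_left_mono, auto\<close>)
  have "(\<lambda>n. (b - a) / real (n + 2)) \<longlonglongrightarrow> 0"
    by (rule LIMSEQ_ignore_initial_segment[OF lim_const_over_n])
  then have lim: "(\<lambda>n. a + (b - a) / real (n + 2)) \<longlonglongrightarrow> a" "(\<lambda>n. b - (b - a) / real (n + 2)) \<longlonglongrightarrow> b"
    by (auto intro: tendsto_eq_intros)
  have mem: "a + (b - a) / real (n + 2) \<in> {a..b}" "b - (b - a) / real (n + 2) \<in> {a..b}"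
    "a + (b - a) / real (n + 2) \<le> b - (b - a) / real (n + 2)" for n
    using d[of n] assms(1) unfolding atLeastAtMost_iff by argo+
  have "(\<lambda>n. I (b - (b - a) / real (n + 2)) - I (a + (b - a) / real (n + 2))) \<longlonglongrightarrow> I b - I a"
    using assms(1) mem lim
    by (intro tendsto_diff continuous_on_tendsto_compose[OF I]) auto
  moreover have "I (b - (b - a) / real (n + 2)) - I (a + (b - a) / real (n + 2))
      = integral {a + (b - a) / real (n + 2)..b - (b - a) / real (n + 2)} f" for n
  proof -
    have "f integrable_on {a..b - (b - a) / real (n + 2)}"
      using mem(2)[of n] by (intro integrable_subinterval_real[OF assms(2)]) auto
    from Henstock_Kurzweil_Integration.integral_combine[OF _ mem(3) this] mem(1)[of n]
    show ?thesis by (simp add: I_def algebra_simps)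
  qed
  ultimately show ?thesis by (simp add: I_def)
qed

lemma integrable_half_line_imp_interval:
  fixes f :: "real \<Rightarrow> 'b::banach"
  assumes "f integrable_on {0<..}" "0 \<le> x"
  shows "f integrable_on {x..y}"
proof -
  have "(\<lambda>x. if x \<in> {0<..} then f x else 0) integrable_on {x..y}"
    using assms(1) integrable_altD(1)[of f "{0<..}" x y] by simp
  then show ?thesis
    by (rule integrable_spike[of _ _ "{0}"]) (use assms(2) in auto)
qed

context embedded_carrier
begin

lemma integral_dominated_open_interval:
  assumes ab: "a \<le> b" and cont: "continuous_in E {a<..<b} h" and D: "D integrable_on {a..b}"
    and le: "\<And>x. x \<in> {a<..<b} \<Longrightarrow> nrm E (h x) \<le> D x"
  shows "h integrable_on {a..b} \<and> integral {a..b} h \<in> carr E \<and> nrm E (integral {a..b} h) \<le> integral {a..b} D"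
proof (cases "a = b")
  case True
  then show ?thesis using integrable_on_refl[of h a] by simp
next
  case False
  with ab have ab: "a < b" by simp
  obtain c where c: "c > 0" "\<And>x. x \<in> carr E \<Longrightarrow> norm x \<le> c * nrm E x" by (rule embedding_bound) blast
  have m: "h x \<in> carr E" if "x \<in> {a<..<b}" for x using cont that unfolding continuous_in_def by auto
  have hint: "h integrable_on {a..b}"
  proof (rule integrable_dominated_open_interval)
    show "continuous_on {a<..<b} h" by (rule continuous_in_imp_continuous_on[OF cont])
    show "(\<lambda>x. c * D x) integrable_on {a..b}" using D by (rule integrable_on_mult_right)
    fix x assume x: "x \<in> {a<..<b}"
    have "c * nrm E (h x) \<le> c * D x" using le[OF x] c(1) by simp
    then show "norm (h x) \<le> c * D x" using c(2)[OF m[OF x]] by linarith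
  qed
  have inner: "integral {x..y} h \<in> carr E \<and> nrm E (integral {x..y} h) \<le> integral {x..y} D"
    if "a < x" "x \<le> y" "y < b" for x y
  proof -
    have ch: "continuous_in E {x..y} h" using that by (intro continuous_in_mono[OF cont]) auto
    have "integral {x..y} (\<lambda>s. nrm E (h s)) \<le> integral {x..y} D"
      using that le
      by (intro integral_le integrable_continuous_real continuous_in_nrm ch integrable_subinterval_real[OF D]) auto
    then show ?thesis using integral_compact[OF that(2) ch] by linarith
  qed
  define p q where "p n = a + (b - a) / real (n + 2)" and "q n = b - (b - a) / real (n + 2)" for n
  have pq: "a < p n" "p n \<le> q n" "q n < b" for n
  proof -
    have "(b - a) / real (n + 2) \<le> (b - a) / 2"
      using ab by (intro divide_left_mono) auto
    moreover have "0 < (b - a) / real (n + 2)" using ab by simp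
    ultimately show "a < p n" "p n \<le> q n" "q n < b" unfolding p_def q_def by argo+
  qed
  have pq_mono: "p m \<le> p n" "q n \<le> q m" if "n \<le> m" for m n
  proof -
    have "(b - a) / real (m + 2) \<le> (b - a) / real (n + 2)"
      using ab that by (intro divide_left_mono) auto
    then show "p m \<le> p n" "q n \<le> q m" by (auto simp: p_def q_def)
  qed
  have three: "integral {p m..q m} f = integral {p m..p n} f + integral {p n..q n} f + integral {q n..q m} f"
    if "n \<le> m" "f integrable_on {a..b}" for m n and f :: "real \<Rightarrow> 'z::banach"
  proof -
    have i: "f integrable_on {p m..q m}" "f integrable_on {p m..q n}"
      using pq[of m] pq[of n] pq_mono[OF that(1)]
      by (auto intro!: integrable_subinterval_real[OF that(2)])
    show ?thesis
      using Henstock_Kurzweil_Integration.integral_combine[OF _ _ i(1), of "q n"]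
        Henstock_Kurzweil_Integration.integral_combine[OF _ _ i(2), of "p n"]
        pq[of m] pq[of n] pq_mono[OF that(1)] by auto
  qed
  have \<sigma>m: "integral {p n..q n} h \<in> carr E" for n using inner pq by blast
  have dom: "nrm E (integral {p m..q m} h - integral {p n..q n} h) \<le> integral {p m..q m} D - integral {p n..q n} D"
    if "n \<le> m" for m n
  proof -
    have i1: "integral {p m..p n} h \<in> carr E \<and> nrm E (integral {p m..p n} h) \<le> integral {p m..p n} D"
      using pq[of m] pq[of n] pq_mono[OF that] by (intro inner) auto
    have i2: "integral {q n..q m} h \<in> carr E \<and> nrm E (integral {q n..q m} h) \<le> integral {q n..q m} D"
      using pq[of m] pq[of n] pq_mono[OF that] by (intro inner) auto
    have "integral {p m..q m} h - integral {p n..q n} h = integral {p m..p n} h + integral {q n..q m} h"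
      using three[OF that hint] by simp
    then show ?thesis
      using nrm_add[of "integral {p m..p n} h" "integral {q n..q m} h"] i1 i2 three[OF that D] by simp
  qed
  have limh: "(\<lambda>n. integral {p n..q n} h) \<longlonglongrightarrow> integral {a..b} h"
    and limD: "(\<lambda>n. integral {p n..q n} D) \<longlonglongrightarrow> integral {a..b} D"
    unfolding p_def q_def using integral_exhaustion[OF ab hint] integral_exhaustion[OF ab D] by auto
  note lim = limit_mem_dominated[OF \<sigma>m dom limD limh]
  have "nrm E (integral {a..b} h) \<le> integral {a..b} D"
    using inner pq by (intro LIMSEQ_le[OF lim(2) limD]) auto
  then show ?thesis using hint lim(1) by simp
qed

lemma integral_dominated_interval:
  assumes "finite K" "a \<le> b" "continuous_in E ({a<..<b} - K) h" "D integrable_on {a..b}"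
    and "\<And>x. x \<in> {a<..<b} - K \<Longrightarrow> nrm E (h x) \<le> D x"
  shows "h integrable_on {a..b} \<and> integral {a..b} h \<in> carr E \<and> nrm E (integral {a..b} h) \<le> integral {a..b} D"
  using assms
proof (induction K arbitrary: a b rule: finite_induct)
  case empty
  then show ?case using integral_dominated_open_interval[where h=h and D=D] by simp
next
  case (insert c K)
  show ?case
  proof (cases "c \<in> {a<..<b}")
    case False
    then have "{a<..<b} - insert c K = {a<..<b} - K" by auto
    then show ?thesis using insert.IH insert.prems by simp
  next
    case True
    have D: "D integrable_on {a..c}" "D integrable_on {c..b}"
      using True insert.prems(3) by (auto intro: integrable_subinterval_real)
    have l: "h integrable_on {a..c} \<and> integral {a..c} h \<in> carr E \<and> nrm E (integral {a..c} h) \<le> integral {a..c} D"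
      using True insert.prems D
      by (intro insert.IH) (auto intro: continuous_in_mono)
    have r: "h integrable_on {c..b} \<and> integral {c..b} h \<in> carr E \<and> nrm E (integral {c..b} h) \<le> integral {c..b} D"
      using True insert.prems D
      by (intro insert.IH) (auto intro: continuous_in_mono)
    have hint: "h integrable_on {a..b}"
      using True l r by (intro Henstock_Kurzweil_Integration.integrable_combine[of a c b]) auto
    have "integral {a..c} h + integral {c..b} h = integral {a..b} h"
      "integral {a..c} D + integral {c..b} D = integral {a..b} D"
      using True hint insert.prems(3) by (auto intro!: Henstock_Kurzweil_Integration.integral_combine)
    then show ?thesis
      using l r hint nrm_add[of "integral {a..c} h" "integral {c..b} h"] add_mem[of "integral {a..c} h" "integral {c..b} h"]
      by simp
  qed
qed

text \<open>Improper integrals on the half-line, as limits in E of the integrals over \<open>{0..n}\<close>.  The finite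
  exceptional set K admits paths with jumps; the bound by D is assumed there as well.\<close>

lemma integral_half_line:
  assumes K: "finite K" and cont: "continuous_in E ({0<..} - K) h" and D: "D integrable_on {0<..}"
    and m: "\<And>x. x > 0 \<Longrightarrow> h x \<in> carr E" and le: "\<And>x. x > 0 \<Longrightarrow> nrm E (h x) \<le> D x"
  shows "h integrable_on {0<..}" "(\<lambda>x. nrm E (h x)) integrable_on {0<..}"
    "integral {0<..} h \<in> carr E" "nrm E (integral {0<..} h) \<le> integral {0<..} D"
proof -
  obtain c where c: "c > 0" "\<And>x. x \<in> carr E \<Longrightarrow> norm x \<le> c * nrm E x" by (rule embedding_bound) blast
  show hint: "h integrable_on {0<..}"
  proof (rule integrable_dominated_half_line[OF K])
    show "continuous_on ({0<..} - K) h" by (rule continuous_in_imp_continuous_on[OF cont])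
    show "(\<lambda>x. c * D x) integrable_on {0<..}" using D by (rule integrable_on_mult_right)
    fix x :: real assume x: "x > 0"
    have "c * nrm E (h x) \<le> c * D x" using le[OF x] c(1) by simp
    then show "norm (h x) \<le> c * D x" using c(2)[OF m[OF x]] by linarith
  qed
  show "(\<lambda>x. nrm E (h x)) integrable_on {0<..}"
    by (rule integrable_dominated_half_line[OF K _ D])
      (use continuous_in_nrm[OF cont] m le in auto)
  have piece: "integral {x..y} h \<in> carr E \<and> nrm E (integral {x..y} h) \<le> integral {x..y} D"
    if "0 \<le> x" "x \<le> y" for x y
  proof -
    have "continuous_in E ({x<..<y} - K) h"
      using that by (intro continuous_in_mono[OF cont]) auto
    then show ?thesis
      using integral_dominated_interval[OF K that(2) _ integrable_half_line_imp_interval[OF D that(1)], of h] le that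
      by auto
  qed
  have \<sigma>m: "integral {0..real n} h \<in> carr E" for n using piece by simp
  have dom: "nrm E (integral {0..real m} h - integral {0..real n} h) \<le> integral {0..real m} D - integral {0..real n} D"
    if "n \<le> m" for m n
  proof -
    have "integral {0..real n} h + integral {real n..real m} h = integral {0..real m} h"
      "integral {0..real n} D + integral {real n..real m} D = integral {0..real m} D"
      using that hint D
      by (auto intro!: Henstock_Kurzweil_Integration.integral_combine integrable_half_line_imp_interval)
    then have "integral {0..real m} h - integral {0..real n} h = integral {real n..real m} h"
      "integral {0..real m} D - integral {0..real n} D = integral {real n..real m} D"
      by (auto simp: algebra_simps)
    then show ?thesis using piece[of "real n" "real m"] that by simp
  qed
  note lim = limit_mem_dominated[OF \<sigma>m dom integral_half_line_limit[OF D] integral_half_line_limit[OF hint]]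
  show "integral {0<..} h \<in> carr E" by (rule lim)
  show "nrm E (integral {0<..} h) \<le> integral {0<..} D"
    using piece by (intro LIMSEQ_le[OF lim(2) integral_half_line_limit[OF D]]) auto
qed

end

section \<open>Convolution with a weakly singular operator family\<close>

lemma gamma_integral_scaled:
  assumes "\<theta> > 0" "a > (0::real)"
  shows "((\<lambda>s. s powr (\<theta> - 1) * exp (- a * s)) has_integral Gamma \<theta> / a powr \<theta>) {0<..}"
proof -
  define f where "f t = (if t \<in> {0..} then t powr (\<theta> - 1) / exp t else 0)" for t :: real
  have "(f has_integral Gamma \<theta>) UNIV"
    using Gamma_integral_real[OF assms(1)] unfolding f_def by (simp only: has_integral_restrict_UNIV)
  from has_integral_affine_UNIV[OF this, of a 0]
  have "((\<lambda>x. f (a * x)) has_integral Gamma \<theta> / a) UNIV" using assms(2) by simp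
  then have "((\<lambda>x. a powr (1 - \<theta>) * f (a * x)) has_integral a powr (1 - \<theta>) * (Gamma \<theta> / a)) UNIV"
    by (rule has_integral_mult_right)
  moreover have "a powr (1 - \<theta>) * f (a * x) = (if x \<in> {0<..} then x powr (\<theta> - 1) * exp (- a * x) else 0)" for x
  proof -
    have "a powr (1 - \<theta>) * a powr (\<theta> - 1) = 1" using assms(2) by (simp flip: powr_add)
    then show ?thesis
      using assms(2) by (auto simp: f_def powr_mult exp_minus zero_le_mult_iff divide_inverse)
  qed
  moreover have "a powr (1 - \<theta>) * (Gamma \<theta> / a) = Gamma \<theta> / a powr \<theta>"
    using assms(2) by (simp add: powr_diff)
  ultimately show ?thesis by (simp only: has_integral_restrict_UNIV)
qed

lemma has_integral_reflected_shift:
  fixes f :: "real \<Rightarrow> 'b::banach"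
  assumes "(f has_integral I) {0<..}"
  shows "((\<lambda>s. f (t - s)) has_integral I) {..t}"
proof -
  have "((\<lambda>x. if x \<in> {0<..} then f x else 0) has_integral I) UNIV"
    using assms by (simp only: has_integral_restrict_UNIV)
  from has_integral_affine_UNIV[OF this, of "-1" t]
  have "((\<lambda>x. if x \<in> {..<t} then f (t - x) else 0) has_integral I) UNIV"
    by (simp cong: if_cong)
  then have "((\<lambda>s. f (t - s)) has_integral I) {..<t}" by (simp only: has_integral_restrict_UNIV)
  then show ?thesis
    by (rule has_integral_spike_set_eq[THEN iffD1, rotated 2])
      (auto intro: negligible_subset[of "{t}"])
qed

lemma has_integral_shift_truncated:
  fixes f :: "real \<Rightarrow> 'b::banach"
  assumes "(f has_integral I) {0<..}" "\<And>\<sigma>. \<sigma> > - t \<Longrightarrow> f \<sigma> = 0" "t \<le> 0"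
  shows "((\<lambda>s. f (s - t)) has_integral I) {t..0}"
proof -
  have "((\<lambda>x. if x \<in> {0<..} then f x else 0) has_integral I) UNIV"
    using assms(1) by (simp only: has_integral_restrict_UNIV)
  from has_integral_affine_UNIV[OF this, of 1 "-t"]
  have "((\<lambda>x. if x \<in> {t<..} then f (x - t) else 0) has_integral I) UNIV"
    by (simp cong: if_cong)
  moreover have "(if x \<in> {t<..} then f (x - t) else 0) = (if x \<in> {t<..0} then f (x - t) else 0)" for x
    using assms(2)[of "x - t"] by auto
  ultimately have "((\<lambda>s. f (s - t)) has_integral I) {t<..0}" by (simp only: has_integral_restrict_UNIV)
  then show ?thesis
    by (rule has_integral_spike_set_eq[THEN iffD1, rotated 2])
      (auto intro: negligible_subset[of "{t}"])
qed

text \<open>Operators U of a positive parameter, mapping a space D into a Banach space E, with norm at most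
  \<open>C * \<sigma> powr (\<theta> - 1) * exp (b * \<sigma>)\<close>.  No continuity at 0 and no semigroup law is
  required, so that one notion covers semigroups at forward times and groups at backward times.\<close>

locale smoothing_family = E: embedded_carrier E + D: normed_carrier D
  for E D :: "'a::banach nspace" +
  fixes U :: "real \<Rightarrow> 'a \<Rightarrow> 'a" and C \<theta> b :: real
  assumes \<theta>_pos: "\<theta> > 0" and C_nonneg: "C \<ge> 0"
    and U_mem: "\<And>\<sigma> p. \<sigma> > 0 \<Longrightarrow> p \<in> carr D \<Longrightarrow> U \<sigma> p \<in> carr E"
    and U_bound: "\<And>\<sigma> p. \<sigma> > 0 \<Longrightarrow> p \<in> carr D \<Longrightarrow>
      nrm E (U \<sigma> p) \<le> C * \<sigma> powr (\<theta> - 1) * exp (b * \<sigma>) * nrm D p"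
    and U_diff: "\<And>\<sigma> p q. \<sigma> > 0 \<Longrightarrow> p \<in> carr D \<Longrightarrow> q \<in> carr D \<Longrightarrow> U \<sigma> (p - q) = U \<sigma> p - U \<sigma> q"
    and U_cont: "\<And>p. p \<in> carr D \<Longrightarrow> continuous_in E {0<..} (\<lambda>\<sigma>. U \<sigma> p)"
begin

lemma U_zero: "\<sigma> > 0 \<Longrightarrow> U \<sigma> 0 = 0"
  using U_diff[of \<sigma> 0 0] by simp

lemma continuous_apply:
  assumes q: "continuous_in D S q" and S: "S \<subseteq> {0<..}"
  shows "continuous_in E S (\<lambda>\<sigma>. U \<sigma> (q \<sigma>))"
  unfolding continuous_in_def
proof (intro ballI conjI)
  fix s assume s: "s \<in> S"
  have m: "q r \<in> carr D" "r > 0" if "r \<in> S" for r using q that S unfolding continuous_in_def by auto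
  then show "U s (q s) \<in> carr E" using U_mem s by blast
  define k where "k r = C * r powr (\<theta> - 1) * exp (b * r)" for r
  have "(k \<longlongrightarrow> k s) (at s within S)"
    unfolding k_def using m(2)[OF s] by (auto intro!: tendsto_intros)
  moreover have "((\<lambda>r. nrm D (q r - q s)) \<longlongrightarrow> 0) (at s within S)"
    using q s unfolding continuous_in_def by auto
  moreover have "((\<lambda>r. nrm E (U r (q s) - U s (q s))) \<longlongrightarrow> 0) (at s within S)"
    using continuous_in_mono[OF U_cont[OF m(1)[OF s]] S] s unfolding continuous_in_def by auto
  ultimately have "((\<lambda>r. k r * nrm D (q r - q s) + nrm E (U r (q s) - U s (q s))) \<longlongrightarrow> k s * 0 + 0) (at s within S)"
    by (intro tendsto_add tendsto_mult)
  then have lim: "((\<lambda>r. k r * nrm D (q r - q s) + nrm E (U r (q s) - U s (q s))) \<longlongrightarrow> 0) (at s within S)" by simp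
  show "((\<lambda>r. nrm E (U r (q r) - U s (q s))) \<longlongrightarrow> 0) (at s within S)"
  proof (rule Lim_null_comparison[OF _ lim])
    show "\<forall>\<^sub>F r in at s within S. norm (nrm E (U r (q r) - U s (q s)))
        \<le> k r * nrm D (q r - q s) + nrm E (U r (q s) - U s (q s))"
      unfolding eventually_at_filter
    proof (intro always_eventually allI impI)
      fix r assume "r \<in> S"
      then have r: "q r \<in> carr D" "r > 0" "q s \<in> carr D" "s > 0" using m s by auto
      have "nrm E (U r (q r) - U s (q s)) \<le> nrm E (U r (q r) - U r (q s)) + nrm E (U r (q s) - U s (q s))"
        using r by (intro E.nrm_triangle U_mem)
      moreover have "nrm E (U r (q r) - U r (q s)) \<le> k r * nrm D (q r - q s)"
        using U_bound[of r "q r - q s"] r U_diff[of r "q r" "q s"] by (simp add: k_def)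
      moreover have "0 \<le> nrm E (U r (q r) - U s (q s))"
        using r by (intro E.nrm_ge0 E.diff_mem U_mem)
      ultimately show "norm (nrm E (U r (q r) - U s (q s)))
          \<le> k r * nrm D (q r - q s) + nrm E (U r (q s) - U s (q s))" by simp
    qed
  qed
qed

text \<open>The Gamma integral that produces the terms of the gap condition.\<close>

lemma exponential_majorant:
  assumes "b + c < 0"
  shows "((\<lambda>\<sigma>. C * \<sigma> powr (\<theta> - 1) * exp (b * \<sigma>) * (M * exp (c * \<sigma>))) has_integral
    C * M * Gamma \<theta> / (- (b + c)) powr \<theta>) {0<..}"
proof -
  have "((\<lambda>\<sigma>. (C * M) * (\<sigma> powr (\<theta> - 1) * exp (- (- (b + c)) * \<sigma>))) has_integral
      (C * M) * (Gamma \<theta> / (- (b + c)) powr \<theta>)) {0<..}"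
    using assms \<theta>_pos by (intro has_integral_mult_right gamma_integral_scaled) auto
  then show ?thesis by (simp add: algebra_simps exp_add)
qed

lemma convolution:
  assumes K: "finite K" and q: "continuous_in D ({0<..} - K) q" and m: "\<And>\<sigma>. \<sigma> > 0 \<Longrightarrow> q \<sigma> \<in> carr D"
    and le: "\<And>\<sigma>. \<sigma> > 0 \<Longrightarrow> nrm D (q \<sigma>) \<le> M * exp (c * \<sigma>)" and bc: "b + c < 0"
  shows "(\<lambda>\<sigma>. U \<sigma> (q \<sigma>)) integrable_on {0<..}" "(\<lambda>\<sigma>. nrm E (U \<sigma> (q \<sigma>))) integrable_on {0<..}"
    "integral {0<..} (\<lambda>\<sigma>. U \<sigma> (q \<sigma>)) \<in> carr E"
    "nrm E (integral {0<..} (\<lambda>\<sigma>. U \<sigma> (q \<sigma>))) \<le> integral {0<..} (\<lambda>\<sigma>. nrm E (U \<sigma> (q \<sigma>)))"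
    "nrm E (integral {0<..} (\<lambda>\<sigma>. U \<sigma> (q \<sigma>))) \<le> C * M * Gamma \<theta> / (- (b + c)) powr \<theta>"
proof -
  let ?D = "\<lambda>\<sigma>. C * \<sigma> powr (\<theta> - 1) * exp (b * \<sigma>) * (M * exp (c * \<sigma>))"
  have cont: "continuous_in E ({0<..} - K) (\<lambda>\<sigma>. U \<sigma> (q \<sigma>))" by (rule continuous_apply[OF q]) auto
  have mU: "U \<sigma> (q \<sigma>) \<in> carr E" if "\<sigma> > 0" for \<sigma> using that by (intro U_mem m)
  have leU: "nrm E (U \<sigma> (q \<sigma>)) \<le> ?D \<sigma>" if "\<sigma> > 0" for \<sigma>
    using U_bound[OF that m[OF that]] mult_left_mono[OF le[OF that], of "C * \<sigma> powr (\<theta> - 1) * exp (b * \<sigma>)"] C_nonneg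
    by fastforce
  have D: "?D integrable_on {0<..}" using exponential_majorant[OF bc] by blast
  note * = E.integral_half_line[OF K cont D mU leU]
  show "(\<lambda>\<sigma>. U \<sigma> (q \<sigma>)) integrable_on {0<..}" "integral {0<..} (\<lambda>\<sigma>. U \<sigma> (q \<sigma>)) \<in> carr E"
    using * by auto
  show n: "(\<lambda>\<sigma>. nrm E (U \<sigma> (q \<sigma>))) integrable_on {0<..}" using * by auto
  show "nrm E (integral {0<..} (\<lambda>\<sigma>. U \<sigma> (q \<sigma>))) \<le> integral {0<..} (\<lambda>\<sigma>. nrm E (U \<sigma> (q \<sigma>)))"
    by (rule E.integral_half_line(4)[OF K cont n mU]) auto
  show "nrm E (integral {0<..} (\<lambda>\<sigma>. U \<sigma> (q \<sigma>))) \<le> C * M * Gamma \<theta> / (- (b + c)) powr \<theta>"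
    using *(4) exponential_majorant[OF bc, of M] by (simp add: integral_unique)
qed

text \<open>Dominated convergence for the real functions \<open>nrm E (U \<sigma> (q n \<sigma>))\<close>.  Pointwise convergence may
  fail on the finite set J.\<close>

lemma convolution_tendsto_zero:
  fixes q :: "nat \<Rightarrow> real \<Rightarrow> 'a"
  assumes K: "\<And>n. finite (K n)" and q: "\<And>n. continuous_in D ({0<..} - K n) (q n)"
    and m: "\<And>n \<sigma>. \<sigma> > 0 \<Longrightarrow> q n \<sigma> \<in> carr D"
    and le: "\<And>n \<sigma>. \<sigma> > 0 \<Longrightarrow> nrm D (q n \<sigma>) \<le> M * exp (c * \<sigma>)" and bc: "b + c < 0"
    and J: "finite J" and lim: "\<And>\<sigma>. \<sigma> > 0 \<Longrightarrow> \<sigma> \<notin> J \<Longrightarrow> (\<lambda>n. nrm D (q n \<sigma>)) \<longlonglongrightarrow> 0"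
  shows "(\<lambda>n. nrm E (integral {0<..} (\<lambda>\<sigma>. U \<sigma> (q n \<sigma>)))) \<longlonglongrightarrow> 0"
proof -
  let ?D = "\<lambda>\<sigma>. C * \<sigma> powr (\<theta> - 1) * exp (b * \<sigma>) * (M * exp (c * \<sigma>))"
  note * = convolution[OF K q m le bc]
  have spike: "f integrable_on {0<..} - J" "integral ({0<..} - J) f = integral {0<..} f"
    if "f integrable_on {0<..}" for f :: "real \<Rightarrow> real"
  proof -
    have "(f has_integral integral {0<..} f) {0<..}" using that by (rule integrable_integral)
    then have "(f has_integral integral {0<..} f) ({0<..} - J)"
      by (rule has_integral_spike_set_eq[THEN iffD1, rotated 2])
        (auto intro: negligible_subset[OF negligible_finite[OF J]])
    then show "f integrable_on {0<..} - J" "integral ({0<..} - J) f = integral {0<..} f"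
      by (auto simp: integral_unique)
  qed
  have kb: "nrm E (U \<sigma> (q n \<sigma>)) \<le> C * \<sigma> powr (\<theta> - 1) * exp (b * \<sigma>) * nrm D (q n \<sigma>)" if "\<sigma> > 0" for n \<sigma>
    using U_bound[OF that m[OF that]] .
  have "(\<lambda>n. integral ({0<..} - J) (\<lambda>\<sigma>. nrm E (U \<sigma> (q n \<sigma>)))) \<longlonglongrightarrow> integral ({0<..} - J) (\<lambda>\<sigma>. 0)"
  proof (rule dominated_convergence(2))
    show "(\<lambda>\<sigma>. nrm E (U \<sigma> (q n \<sigma>))) integrable_on {0<..} - J" for n by (rule spike(1)[OF *(2)])
    show "?D integrable_on {0<..} - J"
      by (rule spike(1)) (use exponential_majorant[OF bc] in blast)
    show "norm (nrm E (U \<sigma> (q n \<sigma>))) \<le> ?D \<sigma>" if "\<sigma> \<in> {0<..} - J" for n \<sigma>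
    proof -
      have "\<sigma> > 0" using that by simp
      have "C * \<sigma> powr (\<theta> - 1) * exp (b * \<sigma>) * nrm D (q n \<sigma>) \<le> ?D \<sigma>"
        using C_nonneg le[OF \<open>\<sigma> > 0\<close>] by (intro mult_left_mono) auto
      then show ?thesis using kb[OF \<open>\<sigma> > 0\<close>, of n] E.nrm_ge0[OF U_mem[OF \<open>\<sigma> > 0\<close> m[OF \<open>\<sigma> > 0\<close>]], of n] by simp
    qed
    show "(\<lambda>n. nrm E (U \<sigma> (q n \<sigma>))) \<longlonglongrightarrow> 0" if "\<sigma> \<in> {0<..} - J" for \<sigma>
    proof -
      have "\<sigma> > 0" "\<sigma> \<notin> J" using that by auto
      have "(\<lambda>n. C * \<sigma> powr (\<theta> - 1) * exp (b * \<sigma>) * nrm D (q n \<sigma>)) \<longlonglongrightarrow> C * \<sigma> powr (\<theta> - 1) * exp (b * \<sigma>) * 0"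
        by (intro tendsto_mult_left lim \<open>\<sigma> > 0\<close> \<open>\<sigma> \<notin> J\<close>)
      then have z: "(\<lambda>n. C * \<sigma> powr (\<theta> - 1) * exp (b * \<sigma>) * nrm D (q n \<sigma>)) \<longlonglongrightarrow> 0" by simp
      show ?thesis
      proof (rule Lim_null_comparison[OF _ z], intro always_eventually allI)
        fix n
        show "norm (nrm E (U \<sigma> (q n \<sigma>))) \<le> C * \<sigma> powr (\<theta> - 1) * exp (b * \<sigma>) * nrm D (q n \<sigma>)"
          using kb[OF \<open>\<sigma> > 0\<close>, of n] E.nrm_ge0[OF U_mem[OF \<open>\<sigma> > 0\<close> m[OF \<open>\<sigma> > 0\<close>]], of n] by simp
      qed
    qed
  qed
  then have z: "(\<lambda>n. integral {0<..} (\<lambda>\<sigma>. nrm E (U \<sigma> (q n \<sigma>)))) \<longlonglongrightarrow> 0"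
    by (simp add: spike(2)[OF *(2)])
  show ?thesis
  proof (rule Lim_null_comparison[OF _ z], intro always_eventually allI)
    show "norm (nrm E (integral {0<..} (\<lambda>\<sigma>. U \<sigma> (q n \<sigma>)))) \<le> integral {0<..} (\<lambda>\<sigma>. nrm E (U \<sigma> (q n \<sigma>)))" for n
      using *(4)[of n] E.nrm_ge0[OF *(3)[of n]] by simp
  qed
qed

end

section \<open>Components of the Lyapunov-Perron operator\<close>

text \<open>One component: paths with values in P are mapped into the space D by N, which is Lipschitz
  continuous with constant l, and the result is convolved with the family U over the past
  (\<open>\<kappa> = -1\<close>) or over the time that remains until 0 (\<open>\<kappa> = 1\<close>).  On paths of size
  \<open>exp (\<eta> * t)\<close> the integrand at distance \<open>\<sigma>\<close> from t has exponential rate \<open>b + \<kappa> * \<eta>\<close> in \<open>\<sigma>\<close>.\<close>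

locale lp_component = smoothing_family E D U C \<theta> b + P: normed_carrier P
  for E D :: "'a::banach nspace" and U :: "real \<Rightarrow> 'a \<Rightarrow> 'a" and C \<theta> b :: real
    and P :: "'p::real_vector nspace" +
  fixes N :: "'p \<Rightarrow> 'a" and l \<eta> \<kappa> :: real
  assumes N_mem: "\<And>x. x \<in> carr P \<Longrightarrow> N x \<in> carr D"
    and N_Lip: "\<And>x y. x \<in> carr P \<Longrightarrow> y \<in> carr P \<Longrightarrow> nrm D (N x - N y) \<le> l * nrm P (x - y)"
    and N_zero: "N 0 = 0" and l_nonneg: "l \<ge> 0"
    and \<kappa>: "\<kappa> = -1 \<or> \<kappa> = 1" and decay: "b + \<kappa> * \<eta> < 0"
begin

text \<open>The path \<open>N (w s)\<close>, extended by 0 to positive times.  The extension turns both kinds of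
  convolution into integrals over the whole half-line, at the price of a jump at time 0.\<close>

definition cut :: "(real \<Rightarrow> 'p) \<Rightarrow> real \<Rightarrow> 'a" where
  "cut w s = (if s \<le> 0 then N (w s) else 0)"

text \<open>The convolution, in the variable \<open>\<sigma> = \<bar>t - s\<bar>\<close> instead of s; \<open>conv_past\<close> and \<open>conv_future\<close> below
  undo this substitution.\<close>

definition conv :: "(real \<Rightarrow> 'p) \<Rightarrow> real \<Rightarrow> 'a" where
  "conv w t = integral {0<..} (\<lambda>\<sigma>. U \<sigma> (cut w (t + \<kappa> * \<sigma>)))"

text \<open>Continuous paths on the negative half-line whose weighted supremum norm is at most M.\<close>

definition bounded_path :: "(real \<Rightarrow> 'p) \<Rightarrow> real \<Rightarrow> bool" where
  "bounded_path w M \<longleftrightarrow> continuous_in P {..0} w \<and> (\<forall>s\<le>0. nrm P (w s) \<le> M * exp (\<eta> * s))"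

lemma path_mem: "bounded_path w M \<Longrightarrow> s \<le> 0 \<Longrightarrow> w s \<in> carr P"
  unfolding bounded_path_def continuous_in_def by auto

lemma path_bound_nonneg:
  assumes "bounded_path w M" shows "0 \<le> M"
  using assms P.nrm_ge0[OF path_mem[OF assms, of 0]] unfolding bounded_path_def
  by (auto dest: spec[of _ 0])

lemma cut_mem: "bounded_path w M \<Longrightarrow> cut w s \<in> carr D"
  by (auto simp: cut_def N_mem path_mem)

lemma cut_diff_le:
  assumes "bounded_path w M" "bounded_path w' M'" "0 \<le> R"
    and "\<And>s. s \<le> 0 \<Longrightarrow> nrm P (w s - w' s) \<le> R * exp (\<eta> * s)"
  shows "nrm D (cut w s - cut w' s) \<le> l * R * exp (\<eta> * s)"
proof (cases "s \<le> 0")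
  case True
  have "nrm D (N (w s) - N (w' s)) \<le> l * nrm P (w s - w' s)"
    using True assms by (intro N_Lip path_mem)
  also have "\<dots> \<le> l * (R * exp (\<eta> * s))"
    using True assms l_nonneg by (intro mult_left_mono) auto
  finally show ?thesis using True by (simp add: cut_def mult.assoc)
qed (use assms l_nonneg in \<open>simp add: cut_def\<close>)

lemma zero_path: "bounded_path (\<lambda>_. 0) 0"
  by (auto simp: bounded_path_def continuous_in_def)

lemma cut_zero_path: "cut (\<lambda>_. 0) s = 0"
  by (simp add: cut_def N_zero)

lemma cut_le:
  assumes "bounded_path w M"
  shows "nrm D (cut w s) \<le> l * M * exp (\<eta> * s)"
  using cut_diff_le[OF assms zero_path path_bound_nonneg[OF assms], of s] assms
  by (simp add: cut_zero_path bounded_path_def)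

lemma cut_continuous:
  assumes w: "bounded_path w M"
  shows "continuous_in D (- {0}) (cut w)"
  unfolding continuous_in_def
proof (intro ballI conjI)
  fix s :: real assume s: "s \<in> - {0}"
  show "cut w s \<in> carr D" by (rule cut_mem[OF w])
  have "((\<lambda>r. nrm D (cut w r - cut w s)) \<longlongrightarrow> 0) (at s)"
  proof (cases "s < 0")
    case True
    have "continuous_in D {..<0} (\<lambda>r. N (w r))"
    proof (rule D.continuous_in_comparison)
      show "continuous_in P {..<0} w"
        using w unfolding bounded_path_def by (auto intro: continuous_in_mono)
    qed (use w in \<open>auto intro!: N_mem N_Lip path_mem\<close>)
    then have "((\<lambda>r. nrm D (N (w r) - N (w s))) \<longlongrightarrow> 0) (at s)"
      using True at_within_open[of s "{..<0}"] unfolding continuous_in_def by (metis lessThan_iff open_lessThan)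
    moreover have "\<forall>\<^sub>F r in at s. nrm D (cut w r - cut w s) = nrm D (N (w r) - N (w s))"
      using eventually_at_in_open'[of "{..<0}" s] True
      by (auto elim!: eventually_mono simp: cut_def)
    ultimately show ?thesis by (simp add: tendsto_cong)
  next
    case False
    then have "\<forall>\<^sub>F r in at s. nrm D (cut w r - cut w s) = 0"
      using eventually_at_in_open'[of "{0<..}" s] s
      by (auto elim!: eventually_mono simp: cut_def)
    then show ?thesis by (rule tendsto_eventually)
  qed
  then show "((\<lambda>r. nrm D (cut w r - cut w s)) \<longlongrightarrow> 0) (at s within - {0})"
    by (rule tendsto_within_subset) auto
qed

lemma shifted_cut_continuous:
  assumes "bounded_path w M"
  shows "continuous_in D ({0<..} - {- \<kappa> * t}) (\<lambda>\<sigma>. cut w (t + \<kappa> * \<sigma>))"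
proof (rule continuous_in_compose[OF cut_continuous[OF assms] _ _ D.normed_carrier_axioms])
  show "continuous_on ({0<..} - {- \<kappa> * t}) (\<lambda>\<sigma>. t + \<kappa> * \<sigma>)" by (intro continuous_intros)
  show "(\<lambda>\<sigma>. t + \<kappa> * \<sigma>) ` ({0<..} - {- \<kappa> * t}) \<subseteq> - {0}" using \<kappa> by auto
qed

lemma shifted_cut_le:
  assumes "bounded_path w M"
  shows "nrm D (cut w (t + \<kappa> * \<sigma>)) \<le> l * M * exp (\<eta> * t) * exp (\<kappa> * \<eta> * \<sigma>)"
  using cut_le[OF assms, of "t + \<kappa> * \<sigma>"] by (simp add: algebra_simps exp_add)

lemma conv_props:
  assumes w: "bounded_path w M"
  shows "(\<lambda>\<sigma>. U \<sigma> (cut w (t + \<kappa> * \<sigma>))) integrable_on {0<..}"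
    "(\<lambda>\<sigma>. nrm E (U \<sigma> (cut w (t + \<kappa> * \<sigma>)))) integrable_on {0<..}"
    "conv w t \<in> carr E"
  unfolding conv_def
  using convolution[OF _ shifted_cut_continuous[OF w] cut_mem[OF w] shifted_cut_le[OF w] decay]
  by auto

lemma conv_diff:
  assumes w: "bounded_path w M" "bounded_path w' M'"
  shows "conv w t - conv w' t' = integral {0<..} (\<lambda>\<sigma>. U \<sigma> (cut w (t + \<kappa> * \<sigma>) - cut w' (t' + \<kappa> * \<sigma>)))"
proof -
  have "conv w t - conv w' t' = integral {0<..} (\<lambda>\<sigma>. U \<sigma> (cut w (t + \<kappa> * \<sigma>)) - U \<sigma> (cut w' (t' + \<kappa> * \<sigma>)))"
    unfolding conv_def by (intro integral_diff[symmetric] conv_props[OF w(1)] conv_props[OF w(2)])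
  also have "\<dots> = integral {0<..} (\<lambda>\<sigma>. U \<sigma> (cut w (t + \<kappa> * \<sigma>) - cut w' (t' + \<kappa> * \<sigma>)))"
    by (intro Henstock_Kurzweil_Integration.integral_cong) (simp add: U_diff cut_mem[OF w(1)] cut_mem[OF w(2)])
  finally show ?thesis .
qed

lemma diff_cut_continuous:
  assumes "bounded_path w M" "bounded_path w' M'"
  shows "continuous_in D ({0<..} - {- \<kappa> * t, - \<kappa> * t'})
    (\<lambda>\<sigma>. cut w (t + \<kappa> * \<sigma>) - cut w' (t' + \<kappa> * \<sigma>))"
  by (intro D.continuous_in_diff continuous_in_mono[OF shifted_cut_continuous[OF assms(1), of t]]
      continuous_in_mono[OF shifted_cut_continuous[OF assms(2), of t']]) auto

lemma conv_Lipschitz: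
  assumes w: "bounded_path w M" "bounded_path w' M'" and R: "0 \<le> R"
    and le: "\<And>s. s \<le> 0 \<Longrightarrow> nrm P (w s - w' s) \<le> R * exp (\<eta> * s)"
  shows "nrm E (conv w t - conv w' t)
    \<le> C * Gamma \<theta> / (- (b + \<kappa> * \<eta>)) powr \<theta> * l * R * exp (\<eta> * t)"
proof -
  have "nrm D (cut w (t + \<kappa> * \<sigma>) - cut w' (t + \<kappa> * \<sigma>)) \<le> l * R * exp (\<eta> * t) * exp (\<kappa> * \<eta> * \<sigma>)" for \<sigma>
    using cut_diff_le[OF w R le, of "t + \<kappa> * \<sigma>"] by (simp add: algebra_simps exp_add)
  from convolution(5)[OF _ diff_cut_continuous[OF w] _ this decay]
  have "nrm E (conv w t - conv w' t) \<le> C * (l * R * exp (\<eta> * t)) * Gamma \<theta> / (- (b + \<kappa> * \<eta>)) powr \<theta>"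
    unfolding conv_diff[OF w] by (simp add: cut_mem[OF w(1)] cut_mem[OF w(2)])
  then show ?thesis by (simp add: mult_ac)
qed

lemma conv_bound:
  assumes w: "bounded_path w M"
  shows "nrm E (conv w t) \<le> C * Gamma \<theta> / (- (b + \<kappa> * \<eta>)) powr \<theta> * l * M * exp (\<eta> * t)"
proof -
  have "conv (\<lambda>_. 0) t = integral {0<..} (\<lambda>\<sigma>::real. 0)"
    unfolding conv_def by (intro Henstock_Kurzweil_Integration.integral_cong) (simp add: cut_zero_path U_zero)
  then show ?thesis
    using conv_Lipschitz[OF w zero_path path_bound_nonneg[OF w], of t] w by (simp add: bounded_path_def)
qed

text \<open>In the variable \<open>\<sigma>\<close> only the path depends on time, so that the difference of two values is again a
  convolution with U.  Where
  \<open>t + \<kappa> * \<sigma> = 0\<close> the shifted paths need not converge, because of the jump.\<close>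

lemma conv_continuous:
  assumes w: "bounded_path w M"
  shows "continuous_in E {..0} (conv w)"
  unfolding continuous_in_def
proof (intro ballI conjI)
  fix t :: real assume t: "t \<in> {..0}"
  show "conv w t \<in> carr E" by (rule conv_props[OF w])
  show "((\<lambda>r. nrm E (conv w r - conv w t)) \<longlongrightarrow> 0) (at t within {..0})"
    unfolding tendsto_at_iff_sequentially comp_def
  proof (intro allI impI)
    fix r :: "nat \<Rightarrow> real" assume "\<forall>n. r n \<in> {..0} - {t}" and r: "r \<longlonglongrightarrow> t"
    have "(\<lambda>n. exp (\<eta> * r n)) \<longlonglongrightarrow> exp (\<eta> * t)" by (intro tendsto_intros r)
    then have "Bseq (\<lambda>n. exp (\<eta> * r n))" by (rule convergent_imp_Bseq[OF convergentI])
    then obtain B where B: "\<And>n. exp (\<eta> * r n) \<le> B" unfolding Bseq_def by auto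
    have M: "0 \<le> l * M" using path_bound_nonneg[OF w] l_nonneg by simp
    show "(\<lambda>n. nrm E (conv w (r n) - conv w t)) \<longlonglongrightarrow> 0"
      unfolding conv_diff[OF w w]
    proof (rule convolution_tendsto_zero[where K="\<lambda>n. {- \<kappa> * r n, - \<kappa> * t}" and J="{- \<kappa> * t}"
          and M="l * M * (B + exp (\<eta> * t))" and c="\<kappa> * \<eta>"])
      show "continuous_in D ({0<..} - {- \<kappa> * r n, - \<kappa> * t})
          (\<lambda>\<sigma>. cut w (r n + \<kappa> * \<sigma>) - cut w (t + \<kappa> * \<sigma>))" for n
        by (rule diff_cut_continuous[OF w w])
      show "cut w (r n + \<kappa> * \<sigma>) - cut w (t + \<kappa> * \<sigma>) \<in> carr D" for n \<sigma>
        by (intro D.diff_mem cut_mem[OF w])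
      show "nrm D (cut w (r n + \<kappa> * \<sigma>) - cut w (t + \<kappa> * \<sigma>)) \<le> l * M * (B + exp (\<eta> * t)) * exp (\<kappa> * \<eta> * \<sigma>)" for n \<sigma>
      proof -
        have "nrm D (cut w (r n + \<kappa> * \<sigma>) - cut w (t + \<kappa> * \<sigma>))
            \<le> l * M * exp (\<eta> * r n) * exp (\<kappa> * \<eta> * \<sigma>) + l * M * exp (\<eta> * t) * exp (\<kappa> * \<eta> * \<sigma>)"
          using D.nrm_diff[OF cut_mem[OF w] cut_mem[OF w], of "r n + \<kappa> * \<sigma>" "t + \<kappa> * \<sigma>"]
            shifted_cut_le[OF w, of "r n" \<sigma>] shifted_cut_le[OF w, of t \<sigma>] by linarith
        also have "\<dots> \<le> l * M * B * exp (\<kappa> * \<eta> * \<sigma>) + l * M * exp (\<eta> * t) * exp (\<kappa> * \<eta> * \<sigma>)"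
          using B M by (intro add_right_mono mult_right_mono mult_left_mono) auto
        finally show ?thesis by (simp add: algebra_simps)
      qed
      fix \<sigma> :: real assume \<sigma>: "\<sigma> > 0" "\<sigma> \<notin> {- \<kappa> * t}"
      have nz: "t + \<kappa> * \<sigma> \<noteq> 0" using \<sigma>(2) \<kappa> by auto
      have "((\<lambda>s. nrm D (cut w s - cut w (t + \<kappa> * \<sigma>))) \<longlongrightarrow> 0) (at (t + \<kappa> * \<sigma>))"
        using cut_continuous[OF w] nz at_within_open[of "t + \<kappa> * \<sigma>" "- {0}"]
        unfolding continuous_in_def by (metis ComplI open_Compl closed_singleton singletonD)
      then have "isCont (\<lambda>s. nrm D (cut w s - cut w (t + \<kappa> * \<sigma>))) (t + \<kappa> * \<sigma>)"
        by (simp add: isCont_def)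
      moreover have "(\<lambda>n. r n + \<kappa> * \<sigma>) \<longlonglongrightarrow> t + \<kappa> * \<sigma>" by (intro tendsto_intros r)
      ultimately have "(\<lambda>n. nrm D (cut w (r n + \<kappa> * \<sigma>) - cut w (t + \<kappa> * \<sigma>)))
          \<longlonglongrightarrow> nrm D (cut w (t + \<kappa> * \<sigma>) - cut w (t + \<kappa> * \<sigma>))"
        by (rule isCont_tendsto_compose)
      then show "(\<lambda>n. nrm D (cut w (r n + \<kappa> * \<sigma>) - cut w (t + \<kappa> * \<sigma>))) \<longlonglongrightarrow> 0" by simp
    qed (use decay in auto)
  qed
qed

lemma conv_past:
  assumes w: "bounded_path w M" and \<kappa>: "\<kappa> = -1" and t: "t \<le> 0"
  shows "((\<lambda>s. U (t - s) (N (w s))) has_integral conv w t) {..t}"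
    "(\<lambda>s. nrm E (U (t - s) (N (w s)))) integrable_on {..t}"
proof -
  have eq: "U (t - s) (cut w (t + \<kappa> * (t - s))) = U (t - s) (N (w s))" if "s \<in> {..t}" for s
    using that t by (simp add: cut_def \<kappa>)
  have "((\<lambda>s. U (t - s) (cut w (t + \<kappa> * (t - s)))) has_integral conv w t) {..t}"
    unfolding conv_def by (rule has_integral_reflected_shift) (rule integrable_integral[OF conv_props(1)[OF w]])
  then show "((\<lambda>s. U (t - s) (N (w s))) has_integral conv w t) {..t}"
    by (rule has_integral_eq[rotated]) (rule eq)
  have "((\<lambda>s. nrm E (U (t - s) (cut w (t + \<kappa> * (t - s))))) has_integral
      integral {0<..} (\<lambda>\<sigma>. nrm E (U \<sigma> (cut w (t + \<kappa> * \<sigma>))))) {..t}"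
    by (rule has_integral_reflected_shift) (rule integrable_integral[OF conv_props(2)[OF w]])
  then have "((\<lambda>s. nrm E (U (t - s) (N (w s)))) has_integral
      integral {0<..} (\<lambda>\<sigma>. nrm E (U \<sigma> (cut w (t + \<kappa> * \<sigma>))))) {..t}"
    by (rule has_integral_eq[rotated]) (simp add: eq)
  then show "(\<lambda>s. nrm E (U (t - s) (N (w s)))) integrable_on {..t}" by blast
qed

lemma conv_future:
  assumes w: "bounded_path w M" and \<kappa>: "\<kappa> = 1" and t: "t \<le> 0"
  shows "((\<lambda>s. U (s - t) (N (w s))) has_integral conv w t) {t..0}"
    "(\<lambda>s. nrm E (U (s - t) (N (w s)))) integrable_on {t..0}"
proof -
  have eq: "U (s - t) (cut w (t + \<kappa> * (s - t))) = U (s - t) (N (w s))" if "s \<in> {t..0}" for s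
    using that t by (simp add: cut_def \<kappa>)
  have z: "U \<sigma> (cut w (t + \<kappa> * \<sigma>)) = 0" if "\<sigma> > - t" for \<sigma>
    using that t U_zero by (simp add: cut_def \<kappa>)
  have "((\<lambda>s. U (s - t) (cut w (t + \<kappa> * (s - t)))) has_integral conv w t) {t..0}"
    unfolding conv_def
    by (rule has_integral_shift_truncated[OF _ _ t]) (auto simp: z intro: integrable_integral[OF conv_props(1)[OF w]])
  then show "((\<lambda>s. U (s - t) (N (w s))) has_integral conv w t) {t..0}"
    by (rule has_integral_eq[rotated]) (rule eq)
  have "((\<lambda>s. nrm E (U (s - t) (cut w (t + \<kappa> * (s - t))))) has_integral
      integral {0<..} (\<lambda>\<sigma>. nrm E (U \<sigma> (cut w (t + \<kappa> * \<sigma>))))) {t..0}"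
    by (rule has_integral_shift_truncated[OF _ _ t]) (auto simp: z intro: integrable_integral[OF conv_props(2)[OF w]])
  then have "((\<lambda>s. nrm E (U (s - t) (N (w s)))) has_integral
      integral {0<..} (\<lambda>\<sigma>. nrm E (U \<sigma> (cut w (t + \<kappa> * \<sigma>))))) {t..0}"
    by (rule has_integral_eq[rotated]) (simp add: eq)
  then show "(\<lambda>s. nrm E (U (s - t) (N (w s)))) integrable_on {t..0}" by blast
qed

end

section \<open>Semigroups on an interpolation-extrapolation scale\<close>

lemma scalar_zero:
  assumes "scalar_mult K sc"
  shows "sc 0 x = 0"
  using real_scalar(2)[OF assms, of 0 x] by simp

lemma shift_oper_zero:
  fixes S :: "'a::real_vector oper"
  assumes "scalar_mult K sc"
  shows "shift_oper sc S 0 = S"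
  using assms by (simp add: shift_oper_def scalar_zero)

text \<open>A semigroup T on E with generator G, and the scale \<open>Es\<close> generated by G minus lam, together with an
  exponential bound for T on the space of order 1.\<close>

locale scale_semigroup =
  fixes K :: "complex set" and sc :: "complex \<Rightarrow> 'a::banach \<Rightarrow> 'a" and E :: "'a nspace"
    and G :: "'a oper" and T :: "real \<Rightarrow> 'a \<Rightarrow> 'a" and lam :: complex
    and Fn :: "real \<Rightarrow> 'a nspace \<Rightarrow> 'a nspace \<Rightarrow> 'a nspace" and Es :: "real \<Rightarrow> 'a nspace"
    and M \<omega> :: real
  assumes scalar: "scalar_mult K sc" and banach: "banach_space K sc E"
    and G: "linear_oper K sc E G" and lam: "lam \<in> K"
    and T: "c0_semigroup K sc E T" and gen: "generates (at_right 0) E G T"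
    and scale: "interp_extrap_scale K sc E (shift_oper sc G lam) Fn Es"
    and M: "M > 0" and T_1: "\<And>t. t > 0 \<Longrightarrow> op_bound (Es 1) (Es 1) (T t) (M * exp (\<omega> * t))"
begin

text \<open>The operator that generates the scale, as a function.  It maps the domain of G, which is the
  carrier of \<open>Es 1\<close>, bijectively onto E.\<close>

definition S :: "'a \<Rightarrow> 'a" where "S = oap (shift_oper sc G lam)"

sublocale E: complete_carrier E
  by (rule banach_space_imp_complete_carrier[OF scalar banach])

lemma odom_shift [simp]: "odom (shift_oper sc G lam) = odom G"
  by (simp add: shift_oper_def)

lemma S_eq: "S x = oap G x - sc lam x"
  by (simp add: S_def shift_oper_def)

lemma sc_add: "a \<in> K \<Longrightarrow> sc a (x + y) = sc a x + sc a y"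
  using scalar unfolding scalar_mult_def by blast

lemma sc_mult: "a \<in> K \<Longrightarrow> b \<in> K \<Longrightarrow> sc (a * b) x = sc a (sc b x)"
  using scalar unfolding scalar_mult_def by blast

lemma dom_subset: "odom G \<subseteq> carr E"
  using G unfolding linear_oper_def by auto

lemma dom_add: "x \<in> odom G \<Longrightarrow> y \<in> odom G \<Longrightarrow> x + y \<in> odom G"
  and dom_sc: "a \<in> K \<Longrightarrow> x \<in> odom G \<Longrightarrow> sc a x \<in> odom G"
  and dom_zero: "0 \<in> odom G"
  using G unfolding linear_oper_def subspace_in_def by auto

lemma dom_scaleR: "x \<in> odom G \<Longrightarrow> r *\<^sub>R x \<in> odom G"
  using dom_sc[of "complex_of_real r" x] real_scalar[OF scalar, of r] by simp

lemma dom_diff: "x \<in> odom G \<Longrightarrow> y \<in> odom G \<Longrightarrow> x - y \<in> odom G"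
  using dom_add[of x "- y"] dom_scaleR[of y "-1"] by simp

lemma G_mem: "x \<in> odom G \<Longrightarrow> oap G x \<in> carr E"
  and G_add: "x \<in> odom G \<Longrightarrow> y \<in> odom G \<Longrightarrow> oap G (x + y) = oap G x + oap G y"
  and G_sc: "a \<in> K \<Longrightarrow> x \<in> odom G \<Longrightarrow> oap G (sc a x) = sc a (oap G x)"
  using G unfolding linear_oper_def linear_in_def by auto

lemma sc_mem: "a \<in> K \<Longrightarrow> x \<in> carr E \<Longrightarrow> sc a x \<in> carr E"
  using banach unfolding banach_space_def subspace_in_def by auto

lemma S_mem: "x \<in> odom G \<Longrightarrow> S x \<in> carr E"
  unfolding S_eq using G_mem sc_mem lam dom_subset by blast

lemma S_add: "x \<in> odom G \<Longrightarrow> y \<in> odom G \<Longrightarrow> S (x + y) = S x + S y"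
  by (simp add: S_eq G_add sc_add lam)

lemma S_sc: "a \<in> K \<Longrightarrow> x \<in> odom G \<Longrightarrow> S (sc a x) = sc a (S x)"
proof -
  assume a: "a \<in> K" "x \<in> odom G"
  have neg: "sc a (- y) = - sc a y" for y
    using sc_add[OF a(1), of y "- y"] sc_add[OF a(1), of 0 0] by (simp add: eq_neg_iff_add_eq_0 add.commute)
  have "sc lam (sc a x) = sc a (sc lam x)"
    using sc_mult[OF a(1) lam] sc_mult[OF lam a(1)] by (simp add: mult.commute)
  then show ?thesis
    using a sc_add[OF a(1), of "oap G x" "- sc lam x"] neg by (simp add: S_eq G_sc)
qed

lemma S_scaleR: "x \<in> odom G \<Longrightarrow> S (r *\<^sub>R x) = r *\<^sub>R S x"
  using S_sc[of "complex_of_real r" x] real_scalar[OF scalar, of r] by simp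

lemma S_diff: "x \<in> odom G \<Longrightarrow> y \<in> odom G \<Longrightarrow> S (x - y) = S x - S y"
  using S_add[of x "- y"] S_scaleR[of y "-1"] dom_scaleR[of y "-1"] by simp

lemma S_bij: "bij_betw S (odom G) (carr E)"
  and S_inverse_bound: "\<exists>c>0. \<forall>x\<in>odom G. nrm E x \<le> c * nrm E (S x)"
proof -
  have "0 \<in> resolvent_set K sc E (shift_oper sc G lam)"
    using scale unfolding interp_extrap_scale_def by auto
  then have bij: "bij_betw (\<lambda>x. - S x) (odom G) (carr E)"
    and "\<exists>c. op_bound E E (the_inv_into (odom G) (\<lambda>x. - S x)) c"
    unfolding resolvent_set_def by (auto simp: scalar_zero[OF scalar] S_def)
  then obtain c where c: "op_bound E E (the_inv_into (odom G) (\<lambda>x. - S x)) c" by blast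
  have inj: "inj_on S (odom G)"
    using bij unfolding bij_betw_def inj_on_def by auto
  have "S ` odom G = carr E"
  proof
    show "carr E \<subseteq> S ` odom G"
    proof
      fix y assume "y \<in> carr E"
      then have "- y \<in> (\<lambda>x. - S x) ` odom G" using bij E.minus_mem unfolding bij_betw_def by blast
      then show "y \<in> S ` odom G" by auto
    qed
  qed (use S_mem in auto)
  with inj show "bij_betw S (odom G) (carr E)" unfolding bij_betw_def by simp
  have "nrm E x \<le> (\<bar>c\<bar> + 1) * nrm E (S x)" if x: "x \<in> odom G" for x
  proof -
    have "the_inv_into (odom G) (\<lambda>x. - S x) (- S x) = x"
      using the_inv_into_f_f[of "\<lambda>x. - S x" "odom G" x] bij x unfolding bij_betw_def by auto
    then have "nrm E x \<le> c * nrm E (- S x)"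
      using c S_mem[OF x] unfolding op_bound_def by (metis E.minus_mem)
    also have "\<dots> = c * nrm E (S x)" using S_mem[OF x] by simp
    also have "\<dots> \<le> (\<bar>c\<bar> + 1) * nrm E (S x)"
      using S_mem[OF x] by (intro mult_right_mono) auto
    finally show ?thesis .
  qed
  then show "\<exists>c>0. \<forall>x\<in>odom G. nrm E x \<le> c * nrm E (S x)" by (intro exI[of _ "\<bar>c\<bar> + 1"]) auto
qed

lemma scale_int_0: "scale_int E (shift_oper sc G lam) 0 = E"
  by (simp add: scale_int_def)

lemma scale_int_1: "scale_int E (shift_oper sc G lam) 1 = \<lparr>carr = odom G, nrm = (\<lambda>z. nrm E (S z))\<rparr>"
proof -
  have "dom_pow E (shift_oper sc G lam) (Suc 0) = odom G" using S_mem by (auto simp: S_def)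
  then show ?thesis by (simp add: scale_int_def S_def)
qed

lemma scale_space_1: "scale_space E (shift_oper sc G lam) Fn 1 = \<lparr>carr = odom G, nrm = (\<lambda>z. nrm E (S z))\<rparr>"
  by (simp add: scale_space_def scale_int_1)

lemma Es_banach: "\<alpha> \<ge> -1 \<Longrightarrow> banach_space K sc (Es \<alpha>)"
  and Es_equiv: "\<alpha> \<ge> -1 \<Longrightarrow> equiv_nspace (Es \<alpha>) (scale_space E (shift_oper sc G lam) Fn \<alpha>)"
  using scale unfolding interp_extrap_scale_def by auto

lemma Es_complete: "\<alpha> \<ge> -1 \<Longrightarrow> complete_carrier (Es \<alpha>)"
  by (rule banach_space_imp_complete_carrier[OF scalar Es_banach])

lemma carr_1: "carr (Es 1) = odom G"
  using Es_equiv[of 1] by (simp add: equiv_nspace_def scale_space_1)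

lemma nrm_1_equiv:
  obtains c where "c > 0" "\<And>x. x \<in> odom G \<Longrightarrow> nrm (Es 1) x \<le> c * nrm E (S x)"
    "\<And>x. x \<in> odom G \<Longrightarrow> nrm E (S x) \<le> c * nrm (Es 1) x"
  using Es_equiv[of 1] by (auto simp: equiv_nspace_def scale_space_1 carr_1)

lemma E_embedded: "embedded_carrier E"
proof
  obtain c where c: "c > 0" "\<And>x. x \<in> odom G \<Longrightarrow> nrm E x \<le> c * nrm E (S x)"
    using S_inverse_bound by blast
  have "norm z \<le> c * nrm E z" if "z \<in> carr E" for z
  proof -
    have z: "the_inv_into (odom G) S z \<in> odom G" "S (the_inv_into (odom G) S z) = z"
      using S_bij that by (auto simp: bij_betw_def f_the_inv_into_f intro: the_inv_into_into)
    have "norm z = nrm E (oinv (shift_oper sc G lam) z)"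
      using scale that unfolding interp_extrap_scale_def by auto
    also have "\<dots> = nrm E (the_inv_into (odom G) S z)" by (simp add: oinv_def S_def)
    also have "\<dots> \<le> c * nrm E z" using c(2)[OF z(1)] z(2) by simp
    finally show ?thesis .
  qed
  then show "cont_embedded E type_space"
    by (auto simp: cont_embedded_def type_space_def)
qed

lemma E1_into_E: "\<exists>c>0. \<forall>x\<in>odom G. nrm E x \<le> c * nrm (Es 1) x"
proof -
  obtain c where c: "c > 0" "\<And>x. x \<in> odom G \<Longrightarrow> nrm E x \<le> c * nrm E (S x)"
    using S_inverse_bound by blast
  obtain d where d: "d > 0" "\<And>x. x \<in> odom G \<Longrightarrow> nrm (Es 1) x \<le> d * nrm E (S x)"
    "\<And>x. x \<in> odom G \<Longrightarrow> nrm E (S x) \<le> d * nrm (Es 1) x" by (rule nrm_1_equiv) blast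
  have "nrm E x \<le> (c * d) * nrm (Es 1) x" if "x \<in> odom G" for x
    using order.trans[OF c(2)[OF that] mult_left_mono[OF d(3)[OF that], of c]] c(1) by (simp add: mult.assoc)
  then show ?thesis using c(1) d(1) by (intro exI[of _ "c * d"]) auto
qed

lemma E1_embedded: "embedded_carrier (Es 1)"
proof -
  interpret EE: embedded_carrier E by (rule E_embedded)
  interpret E1: complete_carrier "Es 1" by (rule Es_complete) simp
  obtain c where c: "c > 0" "\<And>x. x \<in> odom G \<Longrightarrow> nrm E x \<le> c * nrm (Es 1) x"
    using E1_into_E by blast
  obtain d where d: "d > 0" "\<And>x. x \<in> carr E \<Longrightarrow> norm x \<le> d * nrm E x" by (rule EE.embedding_bound) blast
  have "norm x \<le> (d * c) * nrm (Es 1) x" if "x \<in> odom G" for x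
  proof -
    have "norm x \<le> d * nrm E x" using d(2) that dom_subset by blast
    also have "\<dots> \<le> d * (c * nrm (Es 1) x)" using c(2)[OF that] d(1) by (intro mult_left_mono) auto
    finally show ?thesis by (simp add: mult.assoc)
  qed
  then show ?thesis
    by unfold_locales (auto simp: cont_embedded_def type_space_def carr_1)
qed

text \<open>For orders strictly between 0 and 1 this uses that interpolation spaces lie in the sum of the
  couple, which here is E.\<close>

lemma Es_subset:
  assumes "\<alpha> \<in> {0<..1}"
  shows "carr (Es \<alpha>) \<subseteq> carr E"
proof (cases "\<alpha> = 1")
  case True
  then show ?thesis using dom_subset by (simp add: carr_1)
next
  case False
  with assms have \<alpha>: "0 < \<alpha>" "\<alpha> < 1" by auto
  then have fl: "\<lfloor>\<alpha>\<rfloor> = 0" "frac \<alpha> = \<alpha>" by (auto simp: frac_eq floor_eq_iff)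
  have nint: "\<alpha> \<notin> \<int>" using \<alpha> fl by (auto elim!: Ints_cases)
  let ?F = "\<lparr>carr = odom G, nrm = (\<lambda>z. nrm E (S z))\<rparr> :: 'a nspace"
  have sp: "scale_space E (shift_oper sc G lam) Fn \<alpha> = Fn \<alpha> E ?F"
    using nint fl by (simp add: scale_space_def scale_int_0 scale_int_1)
  have "banach_space K sc ?F"
    unfolding banach_space_def
  proof (intro conjI allI impI ballI)
    show "subspace_in K sc (carr ?F)" using G unfolding linear_oper_def by simp
    fix x assume x: "x \<in> carr ?F"
    then show "0 \<le> nrm ?F x" using S_mem by simp
    have "S 0 = 0" using S_scaleR[OF dom_zero, of 0] by simp
    then have "S x = 0 \<longleftrightarrow> x = 0"
      using inj_on_eq_iff[OF bij_betw_imp_inj_on[OF S_bij], of x 0] x dom_zero by simp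
    then show "nrm ?F x = 0 \<longleftrightarrow> x = 0" using x S_mem[of x] E.nrm_eq0[of "S x"] by simp
    show "nrm ?F (x + y) \<le> nrm ?F x + nrm ?F y" if "y \<in> carr ?F" for y
      using x that S_mem by (simp add: S_add E.nrm_add)
    show "nrm ?F (sc a x) = cmod a * nrm ?F x" if "a \<in> K" for a
      using x that S_mem banach by (simp add: S_sc banach_space_def)
  next
    fix \<sigma> :: "nat \<Rightarrow> 'a"
    assume \<sigma>: "(\<forall>n. \<sigma> n \<in> carr ?F) \<and> (\<forall>e>0. \<exists>N. \<forall>m\<ge>N. \<forall>n\<ge>N. nrm ?F (\<sigma> m - \<sigma> n) < e)"
    interpret E1: complete_carrier "Es 1" by (rule Es_complete) simp
    obtain d where d: "d > 0" "\<And>x. x \<in> odom G \<Longrightarrow> nrm (Es 1) x \<le> d * nrm E (S x)"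
      "\<And>x. x \<in> odom G \<Longrightarrow> nrm E (S x) \<le> d * nrm (Es 1) x" by (rule nrm_1_equiv) blast
    have dm: "\<sigma> m - \<sigma> n \<in> odom G" for m n using \<sigma> dom_diff by simp
    have "\<exists>N. \<forall>m\<ge>N. \<forall>n\<ge>N. nrm (Es 1) (\<sigma> m - \<sigma> n) < e" if "e > 0" for e
    proof -
      have "e / d > 0" using that d(1) by simp
      then obtain N where N: "\<And>m n. m \<ge> N \<Longrightarrow> n \<ge> N \<Longrightarrow> nrm ?F (\<sigma> m - \<sigma> n) < e / d" using \<sigma> by meson
      have "nrm (Es 1) (\<sigma> m - \<sigma> n) < e" if "m \<ge> N" "n \<ge> N" for m n
        using d(2)[OF dm, of m n] N[OF that] d(1) by (simp add: field_simps)
      then show ?thesis by blast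
    qed
    then obtain x where x: "x \<in> odom G" "(\<lambda>n. nrm (Es 1) (\<sigma> n - x)) \<longlonglongrightarrow> 0"
      using E1.complete[of \<sigma>] \<sigma> unfolding tends_in_def by (auto simp: carr_1)
    have "(\<lambda>n. d * nrm (Es 1) (\<sigma> n - x)) \<longlonglongrightarrow> d * 0" using x(2) by (rule tendsto_mult_left)
    then have lim0: "(\<lambda>n. d * nrm (Es 1) (\<sigma> n - x)) \<longlonglongrightarrow> 0" by simp
    have "(\<lambda>n. nrm E (S (\<sigma> n - x))) \<longlonglongrightarrow> 0"
    proof (rule Lim_null_comparison[OF _ lim0], intro always_eventually allI)
      fix n
      have "\<sigma> n - x \<in> odom G" using \<sigma> x(1) dom_diff by simp
      then show "norm (nrm E (S (\<sigma> n - x))) \<le> d * nrm (Es 1) (\<sigma> n - x)"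
        using d(3) S_mem by simp
    qed
    then show "\<exists>x. tends_in ?F \<sigma> x" using x(1) by (auto simp: tends_in_def)
  qed
  moreover have "cont_embedded E type_space"
    using E_embedded by (simp add: embedded_carrier_def embedded_carrier_axioms_def)
  moreover have "cont_embedded ?F type_space"
  proof -
    interpret E1: embedded_carrier "Es 1" by (rule E1_embedded)
    obtain c where c: "c > 0" "\<And>x. x \<in> odom G \<Longrightarrow> norm x \<le> c * nrm (Es 1) x"
      by (rule E1.embedding_bound) (simp add: carr_1)
    obtain d where d: "d > 0" "\<And>x. x \<in> odom G \<Longrightarrow> nrm (Es 1) x \<le> d * nrm E (S x)" by (rule nrm_1_equiv) blast
    have "norm x \<le> (c * d) * nrm E (S x)" if "x \<in> odom G" for x
      using order.trans[OF c(2)[OF that] mult_left_mono[OF d(2)[OF that], of c]] c(1) by (simp add: mult.assoc)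
    then show ?thesis by (auto simp: cont_embedded_def type_space_def)
  qed
  ultimately have "banach_couple K sc E ?F" using banach unfolding banach_couple_def by simp
  moreover have "exact_interp_functor K sc (Fn \<alpha>)"
    using scale \<alpha> unfolding interp_extrap_scale_def by auto
  ultimately have "cont_embedded (Fn \<alpha> E ?F) (sum_space E ?F)"
    unfolding exact_interp_functor_def by blast
  then have "carr (Fn \<alpha> E ?F) \<subseteq> carr (sum_space E ?F)" by (simp add: cont_embedded_def)
  also have "\<dots> \<subseteq> carr E" using dom_subset by (auto simp: sum_space_def)
  finally show ?thesis using Es_equiv[of \<alpha>] \<alpha> by (simp add: equiv_nspace_def sp)
qed

lemma T_mem: "t \<ge> 0 \<Longrightarrow> x \<in> carr E \<Longrightarrow> T t x \<in> carr E"
  and T_add: "t \<ge> 0 \<Longrightarrow> x \<in> carr E \<Longrightarrow> y \<in> carr E \<Longrightarrow> T t (x + y) = T t x + T t y"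
  and T_sc: "t \<ge> 0 \<Longrightarrow> a \<in> K \<Longrightarrow> x \<in> carr E \<Longrightarrow> T t (sc a x) = sc a (T t x)"
  and T_zero: "x \<in> carr E \<Longrightarrow> T 0 x = x"
  and T_plus: "s \<ge> 0 \<Longrightarrow> t \<ge> 0 \<Longrightarrow> x \<in> carr E \<Longrightarrow> T (s + t) x = T s (T t x)"
  and T_lim: "x \<in> carr E \<Longrightarrow> ((\<lambda>t. nrm E (T t x - x)) \<longlongrightarrow> 0) (at_right 0)"
  using T unfolding c0_semigroup_def bounded_linear_in_def linear_in_def by auto

lemma T_scaleR: "t \<ge> 0 \<Longrightarrow> x \<in> carr E \<Longrightarrow> T t (r *\<^sub>R x) = r *\<^sub>R T t x"
  using T_sc[of t "complex_of_real r" x] real_scalar[OF scalar, of r] by simp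

lemma T_diff: "t \<ge> 0 \<Longrightarrow> x \<in> carr E \<Longrightarrow> y \<in> carr E \<Longrightarrow> T t (x - y) = T t x - T t y"
  using T_add[of t x "- y"] T_scaleR[of t y "-1"] by simp

lemma T_bounded: "t \<ge> 0 \<Longrightarrow> \<exists>c\<ge>0. \<forall>x\<in>carr E. nrm E (T t x) \<le> c * nrm E x"
proof -
  assume t: "t \<ge> 0"
  then have "bounded_linear_in K sc E (T t)"
    using T unfolding c0_semigroup_def by auto
  then obtain c where c: "\<And>x. x \<in> carr E \<Longrightarrow> nrm E (T t x) \<le> c * nrm E x"
    unfolding bounded_linear_in_def op_bound_def by auto
  have "nrm E (T t x) \<le> \<bar>c\<bar> * nrm E x" if "x \<in> carr E" for x
    using c[OF that] mult_right_mono[of c "\<bar>c\<bar>" "nrm E x"] E.nrm_ge0[OF that] by linarith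
  then show ?thesis by (intro exI[of _ "\<bar>c\<bar>"]) auto
qed

lemma gen_lim: "x \<in> odom G \<Longrightarrow> ((\<lambda>t. nrm E ((1 / t) *\<^sub>R (T t x - x) - oap G x)) \<longlongrightarrow> 0) (at_right 0)"
  using gen unfolding generates_def by auto

lemma T_dom:
  assumes t: "t \<ge> 0" and z: "z \<in> odom G"
  shows "T t z \<in> odom G" "oap G (T t z) = T t (oap G z)"
proof -
  have zE: "z \<in> carr E" using z dom_subset by blast
  obtain c where c: "c \<ge> 0" "\<And>x. x \<in> carr E \<Longrightarrow> nrm E (T t x) \<le> c * nrm E x" using T_bounded[OF t] by blast
  have "((\<lambda>h. c * nrm E ((1 / h) *\<^sub>R (T h z - z) - oap G z)) \<longlongrightarrow> c * 0) (at_right 0)"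
    by (intro tendsto_mult_left gen_lim z)
  then have lim0: "((\<lambda>h. c * nrm E ((1 / h) *\<^sub>R (T h z - z) - oap G z)) \<longlongrightarrow> 0) (at_right 0)" by simp
  have lim: "((\<lambda>h. nrm E ((1 / h) *\<^sub>R (T h (T t z) - T t z) - T t (oap G z))) \<longlongrightarrow> 0) (at_right 0)"
  proof (rule Lim_null_comparison[OF _ lim0])
    have "\<forall>\<^sub>F h in at_right (0::real). h > 0" by (simp add: eventually_at_filter)
    then show "\<forall>\<^sub>F h in at_right 0. norm (nrm E ((1 / h) *\<^sub>R (T h (T t z) - T t z) - T t (oap G z)))
        \<le> c * nrm E ((1 / h) *\<^sub>R (T h z - z) - oap G z)"
    proof eventually_elim
      case (elim h)
      have m: "T h z \<in> carr E" "oap G z \<in> carr E" using elim zE z by (auto intro: T_mem G_mem)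
      have "T h (T t z) = T t (T h z)"
        using T_plus[of h t z] T_plus[of t h z] elim t zE by (simp add: add.commute)
      then have "(1 / h) *\<^sub>R (T h (T t z) - T t z) - T t (oap G z) = T t ((1 / h) *\<^sub>R (T h z - z) - oap G z)"
        using t m zE by (simp add: T_diff T_scaleR)
      then show ?case using c(2)[of "(1 / h) *\<^sub>R (T h z - z) - oap G z"] m zE t
        by (simp add: E.nrm_ge0 T_mem)
    qed
  qed
  have m: "T t z \<in> carr E" "T t (oap G z) \<in> carr E" using t z zE by (auto intro: T_mem G_mem)
  have "odom G = {x \<in> carr E. \<exists>y\<in>carr E. ((\<lambda>t. nrm E ((1 / t) *\<^sub>R (T t x - x) - y)) \<longlongrightarrow> 0) (at_right 0)}"
    using gen unfolding generates_def by blast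
  then show d: "T t z \<in> odom G" using m lim by blast
  show "oap G (T t z) = T t (oap G z)"
  proof (rule E.limit_unique[OF _ _ G_mem[OF d] m(2) gen_lim[OF d] lim])
    have "\<forall>\<^sub>F h in at_right (0::real). h > 0" by (simp add: eventually_at_filter)
    then show "\<forall>\<^sub>F h in at_right 0. (1 / h) *\<^sub>R (T h (T t z) - T t z) \<in> carr E"
    proof eventually_elim
      case (elim h)
      then have "T h (T t z) \<in> carr E" by (intro T_mem[of h "T t z"] m(1)) auto
      then show ?case using m(1) by blast
    qed
  qed simp
qed

lemma T_S: "t \<ge> 0 \<Longrightarrow> z \<in> odom G \<Longrightarrow> S (T t z) = T t (S z)"
  using dom_subset G_mem sc_mem lam by (simp add: S_eq T_dom T_sc T_diff subset_iff)

text \<open>The bound on E over compact time intervals is transported from the one on \<open>Es 1\<close> by the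
  isomorphism S, without the uniform boundedness principle.\<close>

lemma T_locally_bounded:
  obtains c where "c > 0" "\<And>t x. 0 \<le> t \<Longrightarrow> t \<le> t0 \<Longrightarrow> x \<in> carr E \<Longrightarrow> nrm E (T t x) \<le> c * nrm E x"
proof -
  obtain d where d: "d > 0" "\<And>x. x \<in> odom G \<Longrightarrow> nrm (Es 1) x \<le> d * nrm E (S x)"
    "\<And>x. x \<in> odom G \<Longrightarrow> nrm E (S x) \<le> d * nrm (Es 1) x" by (rule nrm_1_equiv) blast
  define c where "c = d * (M * exp (\<bar>\<omega>\<bar> * \<bar>t0\<bar>)) * d + 1"
  have c: "c > 0" "c \<ge> 1" using d(1) M by (auto simp: c_def intro!: add_nonneg_pos)
  show thesis
  proof (rule that[OF c(1)])
    fix t x assume t: "0 \<le> t" "t \<le> t0" and x: "x \<in> carr E"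
    show "nrm E (T t x) \<le> c * nrm E x"
    proof (cases "t = 0")
      case True
      then show ?thesis using x mult_right_mono[OF c(2) E.nrm_ge0[OF x]] by (simp add: T_zero)
    next
      case False
      with t have tp: "t > 0" by simp
      have "x \<in> S ` odom G" using x bij_betw_imp_surj_on[OF S_bij] by simp
      then obtain z where z: "z \<in> odom G" "S z = x" by auto
      interpret E1: complete_carrier "Es 1" by (rule Es_complete) simp
      have "nrm E (T t x) = nrm E (S (T t z))" using T_S[OF t(1) z(1)] z(2) by simp
      also have "\<dots> \<le> d * nrm (Es 1) (T t z)" by (intro d(3) T_dom t z)
      also have "\<dots> \<le> d * (M * exp (\<omega> * t) * nrm (Es 1) z)"
        using T_1[OF tp] z(1) d(1) unfolding op_bound_def carr_1 by (intro mult_left_mono) auto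
      also have "\<dots> \<le> d * (M * exp (\<bar>\<omega>\<bar> * \<bar>t0\<bar>) * (d * nrm E x))"
      proof (intro mult_left_mono mult_mono)
        have "\<omega> * t \<le> \<bar>\<omega>\<bar> * \<bar>t\<bar>" by (metis abs_ge_self abs_mult)
        also have "\<dots> \<le> \<bar>\<omega>\<bar> * \<bar>t0\<bar>" using t by (intro mult_left_mono) auto
        finally show "exp (\<omega> * t) \<le> exp (\<bar>\<omega>\<bar> * \<bar>t0\<bar>)" by simp
        show "nrm (Es 1) z \<le> d * nrm E x" using d(2)[OF z(1)] z(2) by simp
        show "0 \<le> nrm (Es 1) z" using z(1) by (intro E1.nrm_ge0) (simp add: carr_1)
      qed (use d(1) M in auto)
      also have "\<dots> \<le> c * nrm E x"
        using E.nrm_ge0[OF x] by (simp add: c_def algebra_simps)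
      finally show ?thesis .
    qed
  qed
qed

lemma T_continuous:
  assumes y: "y \<in> carr E"
  shows "continuous_in E {0..} (\<lambda>t. T t y)"
  unfolding continuous_in_def
proof (intro ballI conjI)
  fix s :: real assume s: "s \<in> {0..}"
  then show "T s y \<in> carr E" using y by (simp add: T_mem)
  obtain c where c: "c > 0" "\<And>t x. 0 \<le> t \<Longrightarrow> t \<le> s + 1 \<Longrightarrow> x \<in> carr E \<Longrightarrow> nrm E (T t x) \<le> c * nrm E x"
    by (rule T_locally_bounded[of "s + 1"]) blast
  have ab: "filterlim (\<lambda>r. \<bar>r - s\<bar>) (at_right 0) (at s within {0..})"
    unfolding filterlim_at
    by (auto intro!: tendsto_eq_intros simp: eventually_at_filter)
  have "((\<lambda>r. c * nrm E (T \<bar>r - s\<bar> y - y)) \<longlongrightarrow> c * 0) (at s within {0..})"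
    by (intro tendsto_mult_left filterlim_compose[OF T_lim[OF y] ab])
  then have lim0: "((\<lambda>r. c * nrm E (T \<bar>r - s\<bar> y - y)) \<longlongrightarrow> 0) (at s within {0..})" by simp
  show "((\<lambda>r. nrm E (T r y - T s y)) \<longlongrightarrow> 0) (at s within {0..})"
  proof (rule Lim_null_comparison[OF _ lim0])
    have "\<forall>\<^sub>F r in at s within {0..}. r \<in> {0..} \<and> r < s + 1"
      by (intro eventually_conj order_tendstoD[OF tendsto_ident_at]) (auto simp: eventually_at_filter)
    then show "\<forall>\<^sub>F r in at s within {0..}. norm (nrm E (T r y - T s y)) \<le> c * nrm E (T \<bar>r - s\<bar> y - y)"
    proof eventually_elim
      case (elim r)
      have m: "T r y \<in> carr E" "T s y \<in> carr E" "T \<bar>r - s\<bar> y \<in> carr E" using elim s y by (auto intro: T_mem)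
      have "nrm E (T r y - T s y) \<le> c * nrm E (T \<bar>r - s\<bar> y - y)"
      proof (cases "s \<le> r")
        case True
        then have "T r y - T s y = T s (T \<bar>r - s\<bar> y - y)"
          using T_plus[of s "r - s" y] s y m by (simp add: T_diff)
        then show ?thesis using c(2)[of s "T \<bar>r - s\<bar> y - y"] s y m by simp
      next
        case False
        then have "T r y - T s y = - T r (T \<bar>r - s\<bar> y - y)"
          using T_plus[of r "s - r" y] elim y m by (simp add: T_diff)
        moreover have "T r (T \<bar>r - s\<bar> y - y) \<in> carr E" using elim y m by (intro T_mem) auto
        ultimately show ?thesis using c(2)[of r "T \<bar>r - s\<bar> y - y"] elim y m by simp
      qed
      moreover have "0 \<le> nrm E (T r y - T s y)" using m by simp
      ultimately show ?case by simp
    qed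
  qed
qed

lemma T_continuous_1:
  assumes z: "z \<in> carr (Es 1)"
  shows "continuous_in (Es 1) {0..} (\<lambda>t. T t z)"
proof -
  interpret E1: complete_carrier "Es 1" by (rule Es_complete) simp
  obtain d where d: "d > 0" "\<And>x. x \<in> odom G \<Longrightarrow> nrm (Es 1) x \<le> d * nrm E (S x)" by (rule nrm_1_equiv) blast
  have z: "z \<in> odom G" using z by (simp add: carr_1)
  show ?thesis
  proof (rule E1.continuous_in_comparison[OF _ _ T_continuous[OF S_mem[OF z]]])
    show "T s z \<in> carr (Es 1)" if "s \<in> {0..}" for s using that z by (simp add: carr_1 T_dom)
    fix r s :: real assume rs: "r \<in> {0..}" "s \<in> {0..}"
    have m: "T r z \<in> odom G" "T s z \<in> odom G" using rs z by (auto intro: T_dom)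
    have "nrm (Es 1) (T r z - T s z) \<le> d * nrm E (S (T r z - T s z))" by (intro d(2) dom_diff m)
    then show "nrm (Es 1) (T r z - T s z) \<le> d * nrm E (T r (S z) - T s (S z))"
      using rs z m by (simp add: S_diff T_S)
  qed
qed

text \<open>After an arbitrarily short time the orbit is an orbit in \<open>Es 1\<close>.\<close>

lemma T_continuous_smoothing:
  assumes p: "p \<in> carr E" and m: "\<And>\<sigma>. \<sigma> > 0 \<Longrightarrow> T \<sigma> p \<in> carr (Es 1)"
  shows "continuous_in (Es 1) {0<..} (\<lambda>\<sigma>. T \<sigma> p)"
  unfolding continuous_in_def
proof (intro ballI conjI)
  interpret E1: complete_carrier "Es 1" by (rule Es_complete) simp
  fix s :: real assume s: "s \<in> {0<..}"
  then show "T s p \<in> carr (Es 1)" using m by simp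
  define s0 where "s0 = s / 2"
  have s0: "0 < s0" "s0 < s" using s by (auto simp: s0_def)
  have "continuous_in (Es 1) {s0<..} (\<lambda>r. T (r - s0) (T s0 p))"
    by (rule continuous_in_compose[OF T_continuous_1[OF m[OF s0(1)]] _ _ E1.normed_carrier_axioms])
      (auto intro!: continuous_intros)
  moreover have "T (r - s0) (T s0 p) = T r p" if "r \<in> {s0<..}" for r
    using T_plus[of "r - s0" s0 p] that s0 p by simp
  ultimately have "continuous_in (Es 1) {s0<..} (\<lambda>r. T r p)"
    using continuous_in_cong[of "{s0<..}" "\<lambda>r. T (r - s0) (T s0 p)" "\<lambda>r. T r p" "Es 1"] by blast
  then have "((\<lambda>r. nrm (Es 1) (T r p - T s p)) \<longlongrightarrow> 0) (at s)"
    using s0 at_within_open[of s "{s0<..}"] unfolding continuous_in_def by (metis greaterThan_iff open_greaterThan)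
  then show "((\<lambda>r. nrm (Es 1) (T r p - T s p)) \<longlongrightarrow> 0) (at s within {0<..})"
    by (rule tendsto_within_subset) auto
qed

text \<open>Orbits in the domain are differentiable in the norm of E, also from the left.\<close>

lemma T_derivative:
  assumes z: "z \<in> odom G" and s: "s \<ge> 0" and e: "e > 0"
  obtains d where "d > 0"
    "\<And>r. r \<ge> 0 \<Longrightarrow> \<bar>r - s\<bar> < d \<Longrightarrow> nrm E (T r z - T s z - (r - s) *\<^sub>R T s (oap G z)) \<le> e * \<bar>r - s\<bar>"
proof -
  have zE: "z \<in> carr E" "oap G z \<in> carr E" using z dom_subset G_mem by auto
  obtain c where c: "c > 0" "\<And>t x. 0 \<le> t \<Longrightarrow> t \<le> s + 1 \<Longrightarrow> x \<in> carr E \<Longrightarrow> nrm E (T t x) \<le> c * nrm E x"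
    by (rule T_locally_bounded[of "s + 1"]) blast
  have "\<forall>\<^sub>F h in at_right 0. nrm E ((1 / h) *\<^sub>R (T h z - z) - oap G z) < e / (2 * c)"
    using gen_lim[OF z] e c(1) by (intro order_tendstoD) auto
  then obtain d1 where d1: "d1 > 0" "\<And>h. h > 0 \<Longrightarrow> h < d1 \<Longrightarrow> nrm E ((1 / h) *\<^sub>R (T h z - z) - oap G z) < e / (2 * c)"
    unfolding eventually_at_right_field by blast
  have "((\<lambda>r. nrm E (T r (oap G z) - T s (oap G z))) \<longlongrightarrow> 0) (at s within {0..})"
    using T_continuous[OF zE(2)] s unfolding continuous_in_def by auto
  then have "\<forall>\<^sub>F r in at s within {0..}. nrm E (T r (oap G z) - T s (oap G z)) < e / 2"
    using e by (intro order_tendstoD) auto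
  then obtain d2 where d2: "d2 > 0" "\<And>r. r \<ge> 0 \<Longrightarrow> r \<noteq> s \<Longrightarrow> \<bar>r - s\<bar> < d2 \<Longrightarrow> nrm E (T r (oap G z) - T s (oap G z)) < e / 2"
    unfolding eventually_at by (auto simp: dist_real_def)
  have step: "nrm E (T h z - z - h *\<^sub>R oap G z) \<le> e / (2 * c) * h" if h: "h > 0" "h < d1" for h
  proof -
    have m: "T h z \<in> carr E" using h zE by (simp add: T_mem)
    have "T h z - z - h *\<^sub>R oap G z = h *\<^sub>R ((1 / h) *\<^sub>R (T h z - z) - oap G z)"
      using h by (simp add: scaleR_diff_right)
    then have "nrm E (T h z - z - h *\<^sub>R oap G z) = h * nrm E ((1 / h) *\<^sub>R (T h z - z) - oap G z)"
      using h m zE by (simp add: E.nrm_scale)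
    also have "\<dots> \<le> h * (e / (2 * c))"
      using d1(2)[OF h] h by (intro mult_left_mono) auto
    finally show ?thesis by (simp add: mult.commute)
  qed
  show thesis
  proof (rule that[of "min (min d1 d2) 1"])
    fix r assume r: "r \<ge> 0" "\<bar>r - s\<bar> < min (min d1 d2) 1"
    show "nrm E (T r z - T s z - (r - s) *\<^sub>R T s (oap G z)) \<le> e * \<bar>r - s\<bar>"
    proof -
      consider "r = s" | "s < r" | "r < s" by linarith
      then show ?thesis
      proof cases
        case 1
        then show ?thesis by simp
      next
        case 2
        define h where "h = r - s"
        have h: "h > 0" "h < d1" "r = s + h" using 2 r by (auto simp: h_def)
        have m: "T h z \<in> carr E" using h zE by (simp add: T_mem)
        have "T r z - T s z - (r - s) *\<^sub>R T s (oap G z) = T s (T h z - z - h *\<^sub>R oap G z)"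
          using T_plus[of s h z] h s zE m by (simp add: T_diff T_scaleR)
        then have "nrm E (T r z - T s z - (r - s) *\<^sub>R T s (oap G z)) \<le> c * nrm E (T h z - z - h *\<^sub>R oap G z)"
          using c(2)[of s "T h z - z - h *\<^sub>R oap G z"] s zE m by simp
        also have "\<dots> \<le> c * (e / (2 * c) * h)"
          using step[OF h(1,2)] c(1) by (intro mult_left_mono) auto
        also have "\<dots> = e / 2 * h" using c(1) by simp
        also have "\<dots> \<le> e * h" using e h(1) by simp
        finally show ?thesis using h by simp
      next
        case 3
        define h where "h = s - r"
        have h: "h > 0" "h < d1" "s = r + h" "\<bar>r - s\<bar> = h" using 3 r by (auto simp: h_def)
        have m: "T h z \<in> carr E" "T r (oap G z) \<in> carr E" "T s (oap G z) \<in> carr E"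
          "T r (T h z - z - h *\<^sub>R oap G z) \<in> carr E"
          using h zE r s by (auto intro!: T_mem E.diff_mem)
        have "T s z = T r (T h z)" using T_plus[of r h z] h r zE by simp
        moreover have "T r (T h z - z - h *\<^sub>R oap G z) = T r (T h z) - T r z - h *\<^sub>R T r (oap G z)"
          using r zE m h(1) by (simp add: T_diff T_scaleR)
        moreover have "r - s = - h" by (simp add: h_def)
        ultimately have "T r z - T s z - (r - s) *\<^sub>R T s (oap G z)
            = h *\<^sub>R (T s (oap G z) - T r (oap G z)) - T r (T h z - z - h *\<^sub>R oap G z)"
          by (simp add: scaleR_diff_right)
        then have "nrm E (T r z - T s z - (r - s) *\<^sub>R T s (oap G z))
            \<le> nrm E (h *\<^sub>R (T s (oap G z) - T r (oap G z))) + nrm E (T r (T h z - z - h *\<^sub>R oap G z))"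
          using m by (simp add: E.nrm_diff)
        moreover have "nrm E (h *\<^sub>R (T s (oap G z) - T r (oap G z))) \<le> h * (e / 2)"
          using d2(2)[of r] r 3 m h(1) E.nrm_commute[of "T s (oap G z)" "T r (oap G z)"]
          by (simp add: E.nrm_scale)
        moreover have "nrm E (T r (T h z - z - h *\<^sub>R oap G z)) \<le> c * nrm E (T h z - z - h *\<^sub>R oap G z)"
          using c(2)[of r "T h z - z - h *\<^sub>R oap G z"] r 3 zE m by simp
        moreover have "c * nrm E (T h z - z - h *\<^sub>R oap G z) \<le> c * (e / (2 * c) * h)"
          using step[OF h(1,2)] c(1) by (intro mult_left_mono) auto
        moreover have "c * (e / (2 * c) * h) = e / 2 * h" using c(1) by simp
        moreover have "h * (e / 2) + e / 2 * h = e * h" by (simp add: algebra_simps)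
        ultimately show ?thesis unfolding h(4) by linarith
      qed
    qed
  qed (use d1(1) d2(1) in auto)
qed

end

section \<open>Closed complements and invariance under the semigroup\<close>

lemma closed_in_limit:
  assumes "closed_in E V" "\<And>n. \<sigma> n \<in> V" "tends_in E \<sigma> x"
  shows "x \<in> V"
  using assms unfolding closed_in_def by auto

text \<open>The Baire category step of the closed graph theorem: a ball is contained in the closure of the
  sums of bounded elements of V and W, and a geometric series removes the closure.\<close>

lemma (in complete_carrier) complement_bounded:
  assumes V: "closed_in E V" "subspace_in K sc V" and W: "closed_in E W" "subspace_in K sc W"
    and sc: "scalar_mult K sc"
    and sum: "\<And>y. y \<in> carr E \<Longrightarrow> \<exists>v\<in>V. \<exists>w\<in>W. y = v + w"
  obtains c where "c > 0"
    "\<And>y. y \<in> carr E \<Longrightarrow> \<exists>v\<in>V. \<exists>w\<in>W. y = v + w \<and> nrm E v \<le> c * nrm E y"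
proof -
  have sub: "V \<subseteq> carr E" "W \<subseteq> carr E" using V(1) W(1) by (auto simp: closed_in_def)
  have real: "r *\<^sub>R x \<in> Z" if "subspace_in K sc Z" "x \<in> Z" for r x Z
    using that real_scalar[OF sc, of r] unfolding subspace_in_def by metis
  have diff: "x - y \<in> Z" if "subspace_in K sc Z" "x \<in> Z" "y \<in> Z" for x y Z
    using real[OF that(1,3), of "-1"] that unfolding subspace_in_def
    by (metis diff_conv_add_uminus scaleR_minus1_left)
  have zero: "0 \<in> V" "0 \<in> W" using V(2) W(2) unfolding subspace_in_def by auto
  have sums: "(\<Sum>k<n. h k) \<in> Z" if "subspace_in K sc Z" "\<And>k. h k \<in> Z" for h Z and n :: nat
    using that unfolding subspace_in_def by (induction n) auto
  define d where "d x y = (if x \<in> carr E \<and> y \<in> carr E then nrm E (x - y) else 0)" for x y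
  interpret M: Metric_space "carr E" d
  proof
    show "0 \<le> d x y" "d x y = d y x" for x y by (auto simp: d_def nrm_commute)
    show "d x y = 0 \<longleftrightarrow> x = y" if "x \<in> carr E" "y \<in> carr E" for x y
      using that nrm_eq0[of "x - y"] by (simp add: d_def)
    show "d x z \<le> d x y + d y z" if "x \<in> carr E" "y \<in> carr E" "z \<in> carr E" for x y z
      using that nrm_triangle by (simp add: d_def)
  qed
  have "M.mcomplete"
    unfolding M.mcomplete_def
  proof (intro allI impI)
    fix \<sigma> assume \<sigma>: "M.MCauchy \<sigma>"
    then have m: "\<sigma> n \<in> carr E" for n by (auto simp: M.MCauchy_def)
    have "\<exists>N. \<forall>m\<ge>N. \<forall>n\<ge>N. nrm E (\<sigma> m - \<sigma> n) < e" if "e > 0" for e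
      using \<sigma> that m unfolding M.MCauchy_def d_def by simp
    then obtain x where x: "x \<in> carr E" "(\<lambda>n. nrm E (\<sigma> n - x)) \<longlonglongrightarrow> 0"
      using complete[of \<sigma>] m unfolding tends_in_def by blast
    then have "limitin M.mtopology \<sigma> x sequentially"
      using m by (simp add: M.limitin_metric_dist_null d_def)
    then show "\<exists>x. limitin M.mtopology \<sigma> x sequentially" by blast
  qed
  define A where "A n = {v + w | v w. v \<in> V \<and> w \<in> W \<and> nrm E v \<le> real n \<and> nrm E w \<le> real n}" for n :: nat
  have Asub: "A n \<subseteq> carr E" for n using sub by (auto simp: A_def)
  have "\<exists>n. M.mtopology interior_of (M.mtopology closure_of A n) \<noteq> {}"
  proof (rule ccontr)
    assume "\<not> ?thesis"
    then have "M.mtopology interior_of \<Union>(range (\<lambda>n. M.mtopology closure_of A n)) = {}"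
      by (intro M.metric_Baire_category_alt[OF \<open>M.mcomplete\<close>]) auto
    moreover have "\<Union>(range (\<lambda>n. M.mtopology closure_of A n)) = carr E"
    proof
      show "\<Union>(range (\<lambda>n. M.mtopology closure_of A n)) \<subseteq> carr E"
        using closure_of_subset_topspace[of M.mtopology] by auto
      show "carr E \<subseteq> \<Union>(range (\<lambda>n. M.mtopology closure_of A n))"
      proof
        fix y assume "y \<in> carr E"
        then obtain v w where vw: "v \<in> V" "w \<in> W" "y = v + w" using sum by blast
        obtain n :: nat where "max (nrm E v) (nrm E w) \<le> real n" using real_arch_simple by blast
        then have "y \<in> A n" using vw by (auto simp: A_def)
        then show "y \<in> \<Union>(range (\<lambda>n. M.mtopology closure_of A n))"
          using closure_of_subset[of "A n" M.mtopology] Asub by auto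
      qed
    qed
    moreover have "M.mtopology interior_of carr E = carr E"
      using interior_of_topspace[of M.mtopology] by simp
    ultimately show False using zero_mem by auto
  qed
  then obtain n y0 where n: "y0 \<in> M.mtopology interior_of (M.mtopology closure_of A n)" by blast
  then obtain r where r: "r > 0" "M.mball y0 r \<subseteq> M.mtopology closure_of A n"
    using interior_of_subset[of M.mtopology "M.mtopology closure_of A n"]
      openin_interior_of[of M.mtopology "M.mtopology closure_of A n"]
    unfolding M.openin_mtopology by (meson order.trans)
  have y0: "y0 \<in> carr E"
    using n interior_of_subset_topspace[of M.mtopology] by auto
  have near: "\<exists>a\<in>A n. nrm E (y - a) < e" if "y \<in> carr E" "nrm E (y - y0) < r" "e > 0" for y e
  proof -
    have "y \<in> M.mball y0 r" using that y0 nrm_commute[of y y0] by (simp add: d_def)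
    then have "y \<in> M.mtopology closure_of A n" using r(2) by blast
    then obtain a where "a \<in> A n" "a \<in> M.mball y e"
      using \<open>e > 0\<close> unfolding M.metric_closure_of by blast
    then show ?thesis using that(1) by (auto simp: d_def)
  qed
  have approx0: "\<exists>v\<in>V. \<exists>w\<in>W. nrm E v \<le> 2 * real n \<and> nrm E w \<le> 2 * real n \<and> nrm E (y - (v + w)) < e"
    if y: "y \<in> carr E" "nrm E y < r" and e: "e > 0" for y e
  proof -
    obtain a where a: "a \<in> A n" "nrm E (y0 + y - a) < e / 2"
      using near[of "y0 + y" "e / 2"] y y0 e by auto
    obtain a' where a': "a' \<in> A n" "nrm E (y0 - a') < e / 2"
      using near[of y0 "e / 2"] y0 e r(1) by auto
    obtain v w where vw: "v \<in> V" "w \<in> W" "nrm E v \<le> real n" "nrm E w \<le> real n" "a = v + w"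
      using a(1) by (auto simp: A_def)
    obtain v' w' where vw': "v' \<in> V" "w' \<in> W" "nrm E v' \<le> real n" "nrm E w' \<le> real n" "a' = v' + w'"
      using a'(1) by (auto simp: A_def)
    have m: "v \<in> carr E" "w \<in> carr E" "v' \<in> carr E" "w' \<in> carr E" using vw vw' sub by auto
    have "nrm E (y - ((v - v') + (w - w'))) = nrm E ((y0 + y - a) - (y0 - a'))"
      by (simp add: vw(5) vw'(5) algebra_simps)
    also have "\<dots> \<le> nrm E (y0 + y - a) + nrm E (y0 - a')"
      using y0 y m by (intro nrm_diff) (auto simp: vw(5) vw'(5))
    finally have "nrm E (y - ((v - v') + (w - w'))) < e" using a(2) a'(2) by linarith
    moreover have "nrm E (v - v') \<le> 2 * real n" "nrm E (w - w') \<le> 2 * real n"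
      using nrm_diff[of v v'] nrm_diff[of w w'] m vw vw' by auto
    ultimately show ?thesis
      using diff[OF V(2) vw(1) vw'(1)] diff[OF W(2) vw(2) vw'(2)] by blast
  qed
  define C where "C = 4 * real n / r"
  have C: "C \<ge> 0" using r(1) by (simp add: C_def)
  have approx: "\<exists>v w. v \<in> V \<and> w \<in> W \<and> nrm E v \<le> C * nrm E y \<and> nrm E w \<le> C * nrm E y \<and> nrm E (y - (v + w)) < e"
    if y: "y \<in> carr E" and e: "e > 0" for y e
  proof (cases "y = 0")
    case True
    then show ?thesis using zero e by (intro exI[of _ 0]) auto
  next
    case False
    then have ny: "nrm E y > 0" using nrm_eq0[OF y] nrm_ge0[OF y] by linarith
    define \<mu> where "\<mu> = r / (2 * nrm E y)"
    have \<mu>: "\<mu> > 0" using ny r(1) by (simp add: \<mu>_def)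
    have "nrm E (\<mu> *\<^sub>R y) < r" using ny r(1) y by (simp add: nrm_scale \<mu>_def)
    then obtain v w where vw: "v \<in> V" "w \<in> W" "nrm E v \<le> 2 * real n" "nrm E w \<le> 2 * real n"
      "nrm E (\<mu> *\<^sub>R y - (v + w)) < \<mu> * e"
      using approx0[of "\<mu> *\<^sub>R y" "\<mu> * e"] y \<mu> e by auto
    have m: "v \<in> carr E" "w \<in> carr E" using vw sub by auto
    have bd: "nrm E ((1 / \<mu>) *\<^sub>R x) \<le> C * nrm E y" if "x \<in> carr E" "nrm E x \<le> 2 * real n" for x
      using that \<mu> ny r(1) by (simp add: nrm_scale C_def \<mu>_def field_simps)
    have "y - ((1 / \<mu>) *\<^sub>R v + (1 / \<mu>) *\<^sub>R w) = (1 / \<mu>) *\<^sub>R (\<mu> *\<^sub>R y - (v + w))"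
      using \<mu> by (simp add: algebra_simps)
    then have "nrm E (y - ((1 / \<mu>) *\<^sub>R v + (1 / \<mu>) *\<^sub>R w)) = (1 / \<mu>) * nrm E (\<mu> *\<^sub>R y - (v + w))"
      using \<mu> y m by (simp add: nrm_scale)
    also have "\<dots> < e" using vw(5) \<mu> by (simp add: field_simps)
    finally show ?thesis
      using real[OF V(2) vw(1), of "1 / \<mu>"] real[OF W(2) vw(2), of "1 / \<mu>"] bd[OF m(1) vw(3)] bd[OF m(2) vw(4)] by blast
  qed
  then obtain a b where ab: "\<And>y e. y \<in> carr E \<Longrightarrow> e > 0 \<Longrightarrow> a y e \<in> V \<and> b y e \<in> W \<and>
      nrm E (a y e) \<le> C * nrm E y \<and> nrm E (b y e) \<le> C * nrm E y \<and> nrm E (y - (a y e + b y e)) < e" by metis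
  show thesis
  proof (rule that[of "2 * C + 1"])
    show "2 * C + 1 > 0" using C by simp
    fix y assume y: "y \<in> carr E"
    show "\<exists>v\<in>V. \<exists>w\<in>W. y = v + w \<and> nrm E v \<le> (2 * C + 1) * nrm E y"
    proof (cases "y = 0")
      case True
      then show ?thesis using zero by (intro bexI[of _ 0]) auto
    next
      case False
      define \<delta> where "\<delta> = nrm E y"
      have \<delta>: "\<delta> > 0" using False nrm_eq0[OF y] nrm_ge0[OF y] by (simp add: \<delta>_def)
      define Y where "Y = rec_nat y (\<lambda>k z. z - (a z (\<delta> / 2 ^ Suc k) + b z (\<delta> / 2 ^ Suc k)))"
      define v where "v k = a (Y k) (\<delta> / 2 ^ Suc k)" for k
      define w where "w k = b (Y k) (\<delta> / 2 ^ Suc k)" for k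
      have Y: "Y 0 = y" "Y (Suc k) = Y k - (v k + w k)" for k by (simp_all add: Y_def v_def w_def)
      have Ym: "Y k \<in> carr E \<and> nrm E (Y k) \<le> \<delta> / 2 ^ k" for k
      proof (induction k)
        case (Suc k)
        then have "a (Y k) (\<delta> / 2 ^ Suc k) \<in> carr E" "b (Y k) (\<delta> / 2 ^ Suc k) \<in> carr E"
          "nrm E (Y (Suc k)) < \<delta> / 2 ^ Suc k"
          using ab[of "Y k" "\<delta> / 2 ^ Suc k"] \<delta> sub unfolding Y(2) v_def w_def by auto
        then show ?case using Suc unfolding Y(2) v_def w_def by auto
      qed (use y in \<open>simp add: Y \<delta>_def\<close>)
      have vw: "v k \<in> V" "w k \<in> W" "nrm E (v k) \<le> C * (\<delta> / 2 ^ k)" "nrm E (w k) \<le> C * (\<delta> / 2 ^ k)" for k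
        using ab[of "Y k" "\<delta> / 2 ^ Suc k"] \<delta> Ym[of k] mult_left_mono[of "nrm E (Y k)" "\<delta> / 2 ^ k" C] C
        unfolding v_def w_def by force+
      have geo: "(\<Sum>k<n. C * (\<delta> / 2 ^ k)) \<le> 2 * C * \<delta>" for n
      proof -
        have "(\<Sum>k<n. C * (\<delta> / 2 ^ k)) = 2 * C * \<delta> - 2 * C * \<delta> / 2 ^ n"
          by (induction n) (auto simp: field_simps)
        then show ?thesis using C \<delta> by simp
      qed
      have geolim: "convergent (\<lambda>n. \<Sum>k<n. C * (\<delta> / 2 ^ k))"
      proof (rule Bseq_mono_convergent)
        show "Bseq (\<lambda>n. \<Sum>k<n. C * (\<delta> / 2 ^ k))"
          using geo C \<delta> by (intro BseqI'[of _ "2 * C * \<delta>"]) (simp add: sum_nonneg)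
        show "\<forall>m n. m \<le> n \<longrightarrow> (\<Sum>k<m. C * (\<delta> / 2 ^ k)) \<le> (\<Sum>k<n. C * (\<delta> / 2 ^ k))"
          using C \<delta> by (auto intro!: sum_mono2)
      qed
      have series: "\<exists>x\<in>Z. (\<lambda>n. nrm E ((\<Sum>k<n. h k) - x)) \<longlonglongrightarrow> 0 \<and> nrm E x \<le> 2 * C * \<delta>"
        if Z: "closed_in E Z" "subspace_in K sc Z" and h: "\<And>k. h k \<in> Z" "\<And>k. nrm E (h k) \<le> C * (\<delta> / 2 ^ k)" for Z h
      proof -
        have hE: "h k \<in> carr E" for k using h(1) Z(1) by (auto simp: closed_in_def)
        have sZ: "(\<Sum>k<n. h k) \<in> Z" for n by (rule sums[OF Z(2) h(1)])
        have sE: "(\<Sum>k<n. h k) \<in> carr E" for n using hE by (intro sum_mem)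
        have dom: "nrm E ((\<Sum>k<m. h k) - (\<Sum>k<n. h k)) \<le> (\<Sum>k<m. C * (\<delta> / 2 ^ k)) - (\<Sum>k<n. C * (\<delta> / 2 ^ k))"
          if "n \<le> m" for m n
        proof -
          have eq: "(\<Sum>k<m. f k) - (\<Sum>k<n. f k) = (\<Sum>k\<in>{n..<m}. f k)" for f :: "nat \<Rightarrow> 'z::ab_group_add"
            using sum_diff_nat_ivl[of 0 n m f] that by (simp add: atLeast0LessThan)
          have "nrm E (\<Sum>k\<in>{n..<m}. h k) \<le> (\<Sum>k\<in>{n..<m}. nrm E (h k))" by (rule nrm_sum) (rule hE)
          also have "\<dots> \<le> (\<Sum>k\<in>{n..<m}. C * (\<delta> / 2 ^ k))" by (intro sum_mono h(2))
          finally show ?thesis by (simp only: eq)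
        qed
        obtain x where x: "tends_in E (\<lambda>n. \<Sum>k<n. h k) x"
          using complete[OF sE dominated_Cauchy[OF sE dom geolim]] by auto
        then have "x \<in> Z" by (rule closed_in_limit[OF Z(1) sZ])
        moreover have xl: "x \<in> carr E" "(\<lambda>n. nrm E ((\<Sum>k<n. h k) - x)) \<longlonglongrightarrow> 0" using x by (auto simp: tends_in_def)
        moreover have "nrm E x \<le> 2 * C * \<delta>"
        proof (rule LIMSEQ_le_const2)
          show "(\<lambda>n. nrm E (\<Sum>k<n. h k)) \<longlonglongrightarrow> nrm E x"
            using xl sE by (intro nrm_tendsto) auto
          have "nrm E (\<Sum>k<n. h k) \<le> 2 * C * \<delta>" for n
          proof -
            have "nrm E (\<Sum>k<n. h k) \<le> (\<Sum>k<n. nrm E (h k))" by (rule nrm_sum) (rule hE)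
            also have "\<dots> \<le> (\<Sum>k<n. C * (\<delta> / 2 ^ k))" by (intro sum_mono h(2))
            finally show ?thesis using geo[of n] by linarith
          qed
          then show "\<exists>N. \<forall>n\<ge>N. nrm E (\<Sum>k<n. h k) \<le> 2 * C * \<delta>" by blast
        qed
        ultimately show ?thesis by blast
      qed
      obtain x where x: "x \<in> V" "(\<lambda>n. nrm E ((\<Sum>k<n. v k) - x)) \<longlonglongrightarrow> 0" "nrm E x \<le> 2 * C * \<delta>"
        using series[OF V vw(1,3)] by blast
      obtain z where z: "z \<in> W" "(\<lambda>n. nrm E ((\<Sum>k<n. w k) - z)) \<longlonglongrightarrow> 0"
        using series[OF W vw(2,4)] by blast
      have vwE: "v k \<in> carr E" "w k \<in> carr E" for k using vw sub by auto
      have Yn: "Y n = y - ((\<Sum>k<n. v k) + (\<Sum>k<n. w k))" for n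
        by (induction n) (auto simp: Y algebra_simps)
      have xz: "x \<in> carr E" "z \<in> carr E" using x z sub by auto
      have Y0: "(\<lambda>n. nrm E (Y n)) \<longlonglongrightarrow> 0"
      proof (rule Lim_null_comparison)
        show "\<forall>\<^sub>F n in sequentially. norm (nrm E (Y n)) \<le> \<delta> * (1 / 2) ^ n"
          using Ym by (intro always_eventually allI) (simp add: power_divide)
        show "(\<lambda>n. \<delta> * (1 / 2) ^ n) \<longlonglongrightarrow> 0"
          by (intro tendsto_mult_right_zero LIMSEQ_realpow_zero) auto
      qed
      have "(\<lambda>n. nrm E (Y n) + (nrm E ((\<Sum>k<n. v k) - x) + nrm E ((\<Sum>k<n. w k) - z))) \<longlonglongrightarrow> 0 + (0 + 0)"
        by (intro tendsto_add Y0 x z)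
      moreover have "nrm E (y - (x + z)) \<le> nrm E (Y n) + (nrm E ((\<Sum>k<n. v k) - x) + nrm E ((\<Sum>k<n. w k) - z))" for n
      proof -
        have m: "(\<Sum>k<n. v k) \<in> carr E" "(\<Sum>k<n. w k) \<in> carr E" using vwE by auto
        have eq: "y - (x + z) = Y n + (((\<Sum>k<n. v k) - x) + ((\<Sum>k<n. w k) - z))" by (simp add: Yn algebra_simps)
        have "nrm E (Y n + (((\<Sum>k<n. v k) - x) + ((\<Sum>k<n. w k) - z)))
            \<le> nrm E (Y n) + nrm E (((\<Sum>k<n. v k) - x) + ((\<Sum>k<n. w k) - z))"
          using Ym m xz by (intro nrm_add) auto
        moreover have "nrm E (((\<Sum>k<n. v k) - x) + ((\<Sum>k<n. w k) - z))
            \<le> nrm E ((\<Sum>k<n. v k) - x) + nrm E ((\<Sum>k<n. w k) - z)"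
          using m xz by (intro nrm_add) auto
        ultimately show ?thesis unfolding eq by linarith
      qed
      ultimately have "nrm E (y - (x + z)) \<le> 0 + (0 + 0)"
        by (intro LIMSEQ_le_const) auto
      then have "y = x + z"
        using nrm_eq0[of "y - (x + z)"] nrm_ge0[of "y - (x + z)"] y xz by (simp add: order_antisym)
      moreover have "nrm E x \<le> (2 * C + 1) * nrm E y"
        using x(3) \<delta> by (simp add: \<delta>_def algebra_simps)
      ultimately show ?thesis using x(1) z(1) by blast
    qed
  qed
qed

text \<open>Closed complementary subspaces V, W whose projections commute with the generator on its domain.\<close>

locale reducing_pair = scale_semigroup K sc E G T lam Fn Es M \<omega>
  for K :: "complex set" and sc :: "complex \<Rightarrow> 'a::banach \<Rightarrow> 'a" and E :: "'a nspace"
    and G :: "'a oper" and T :: "real \<Rightarrow> 'a \<Rightarrow> 'a" and lam :: complex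
    and Fn :: "real \<Rightarrow> 'a nspace \<Rightarrow> 'a nspace \<Rightarrow> 'a nspace" and Es :: "real \<Rightarrow> 'a nspace"
    and M \<omega> :: real +
  fixes V W :: "'a set"
  assumes direct: "direct_sum K sc E V W" and closed: "closed_in E V" "closed_in E W"
    and commute: "\<And>y. y \<in> odom G \<Longrightarrow> proj V W y \<in> odom G \<and> proj W V y \<in> odom G \<and>
      oap G (proj W V y) = proj W V (oap G y)"
begin

lemma sub: "V \<subseteq> carr E" "W \<subseteq> carr E"
  and subspace: "subspace_in K sc V" "subspace_in K sc W"
  using direct unfolding direct_sum_def by auto

lemma sub_add: "Z \<in> {V, W} \<Longrightarrow> x \<in> Z \<Longrightarrow> y \<in> Z \<Longrightarrow> x + y \<in> Z"
  and sub_zero: "Z \<in> {V, W} \<Longrightarrow> 0 \<in> Z"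
  using subspace unfolding subspace_in_def by auto

lemma sub_scaleR: "Z \<in> {V, W} \<Longrightarrow> x \<in> Z \<Longrightarrow> r *\<^sub>R x \<in> Z"
  using subspace real_scalar[OF scalar, of r] unfolding subspace_in_def by (metis empty_iff insert_iff)

lemma sub_diff: "Z \<in> {V, W} \<Longrightarrow> x \<in> Z \<Longrightarrow> y \<in> Z \<Longrightarrow> x - y \<in> Z"
  using sub_add[of Z x "- y"] sub_scaleR[of Z y "-1"] by simp

lemma decomposition_unique:
  assumes "v \<in> V" "w \<in> W" "v' \<in> V" "w' \<in> W" "v + w = v' + w'"
  shows "v = v'" "w = w'"
proof -
  have "v + w \<in> carr E" using assms sub by blast
  then have "\<exists>!p. p \<in> V \<times> W \<and> v + w = fst p + snd p" using direct unfolding direct_sum_def by auto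
  moreover have "(v, w) \<in> V \<times> W \<and> v + w = fst (v, w) + snd (v, w)"
    "(v', w') \<in> V \<times> W \<and> v + w = fst (v', w') + snd (v', w')" using assms by auto
  ultimately have "(v, w) = (v', w')" by blast
  then show "v = v'" "w = w'" by auto
qed

lemma proj_sum:
  assumes "v \<in> V" "w \<in> W"
  shows "proj V W (v + w) = v" "proj W V (v + w) = w"
proof -
  show "proj V W (v + w) = v"
    unfolding proj_def by (rule the_equality) (use assms decomposition_unique in blast)+
  show "proj W V (v + w) = w"
    unfolding proj_def
  proof (rule the_equality)
    show "w \<in> W \<and> (\<exists>va\<in>V. v + w = w + va)" using assms by (auto intro: bexI[of _ v] simp: add.commute)
    fix u assume "u \<in> W \<and> (\<exists>va\<in>V. v + w = u + va)"
    then obtain va where "u \<in> W" "va \<in> V" "v + w = va + u" by (auto simp: add.commute)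
    then show "u = w" using decomposition_unique(2)[OF assms] by blast
  qed
qed

lemma decompose:
  assumes "y \<in> carr E"
  shows "proj V W y \<in> V" "proj W V y \<in> W" "proj V W y + proj W V y = y"
proof -
  obtain v w where "v \<in> V" "w \<in> W" "y = v + w"
    using direct assms unfolding direct_sum_def by (metis mem_Times_iff)
  then show "proj V W y \<in> V" "proj W V y \<in> W" "proj V W y + proj W V y = y" by (auto simp: proj_sum)
qed

lemma proj_mem [simp]: "y \<in> carr E \<Longrightarrow> proj V W y \<in> carr E" "y \<in> carr E \<Longrightarrow> proj W V y \<in> carr E"
  using decompose sub by auto

lemma proj_diff:
  assumes "x \<in> carr E" "y \<in> carr E"
  shows "proj V W (x - y) = proj V W x - proj V W y" "proj W V (x - y) = proj W V x - proj W V y"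
proof -
  have "x - y = (proj V W x - proj V W y) + (proj W V x - proj W V y)"
    using decompose(3)[OF assms(1)] decompose(3)[OF assms(2)] by (simp add: algebra_simps)
  moreover have "proj V W x - proj V W y \<in> V" "proj W V x - proj W V y \<in> W"
    using assms decompose sub_diff[of V] sub_diff[of W] by auto
  ultimately show "proj V W (x - y) = proj V W x - proj V W y" "proj W V (x - y) = proj W V x - proj W V y"
    using proj_sum by metis+
qed

lemma proj_scaleR:
  assumes "x \<in> carr E"
  shows "proj W V (r *\<^sub>R x) = r *\<^sub>R proj W V x"
proof -
  have "r *\<^sub>R x = r *\<^sub>R proj V W x + r *\<^sub>R proj W V x"
    using decompose(3)[OF assms] by (metis scaleR_add_right)
  moreover have "r *\<^sub>R proj V W x \<in> V" "r *\<^sub>R proj W V x \<in> W"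
    using assms decompose sub_scaleR[of V] sub_scaleR[of W] by auto
  ultimately show ?thesis using proj_sum(2) by metis
qed

lemma proj_of_V: "v \<in> V \<Longrightarrow> proj V W v = v" "v \<in> V \<Longrightarrow> proj W V v = 0"
  using proj_sum[of v 0] sub_zero[of W] by auto

lemma proj_bounded:
  obtains c where "c > 0" "\<And>y. y \<in> carr E \<Longrightarrow> nrm E (proj V W y) \<le> c * nrm E y"
    "\<And>y. y \<in> carr E \<Longrightarrow> nrm E (proj W V y) \<le> c * nrm E y"
proof -
  have "\<exists>v\<in>V. \<exists>w\<in>W. y = v + w" if "y \<in> carr E" for y
    using decompose[OF that] by metis
  then obtain c where c: "c > 0"
    "\<And>y. y \<in> carr E \<Longrightarrow> \<exists>v\<in>V. \<exists>w\<in>W. y = v + w \<and> nrm E v \<le> c * nrm E y"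
    using E.complement_bounded[OF closed(1) subspace(1) closed(2) subspace(2) scalar] by metis
  have 1: "nrm E (proj V W y) \<le> c * nrm E y" if "y \<in> carr E" for y
    using c(2)[OF that] proj_sum(1) by auto
  have "nrm E (proj V W y) \<le> (c + 1) * nrm E y \<and> nrm E (proj W V y) \<le> (c + 1) * nrm E y" if "y \<in> carr E" for y
  proof -
    have "proj W V y = y - proj V W y" using decompose(3)[OF that] by (simp add: algebra_simps)
    then have "nrm E (proj W V y) \<le> nrm E y + nrm E (proj V W y)"
      using E.nrm_diff[OF that proj_mem(1)[OF that]] by simp
    then show ?thesis using 1[OF that] E.nrm_ge0[OF that] by (simp add: algebra_simps)
  qed
  then show thesis using that[of "c + 1"] c(1) by auto
qed

text \<open>For y in the domain and in V, the path \<open>s \<mapsto> T (t - s) (proj W V (T s y))\<close> has derivative 0, since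
  the projection commutes with the generator; so its values 0 at \<open>s = 0\<close> and \<open>proj W V (T t y)\<close> at
  \<open>s = t\<close> agree.\<close>

lemma T_invariant_dom:
  assumes t: "t \<ge> 0" and y: "y \<in> odom G" "y \<in> V"
  shows "T t y \<in> V"
proof -
  obtain c where c: "c > 0" "\<And>s x. 0 \<le> s \<Longrightarrow> s \<le> t \<Longrightarrow> x \<in> carr E \<Longrightarrow> nrm E (T s x) \<le> c * nrm E x"
    by (rule T_locally_bounded[of t]) blast
  obtain k where k: "k > 0" "\<And>y. y \<in> carr E \<Longrightarrow> nrm E (proj W V y) \<le> k * nrm E y"
    by (rule proj_bounded) blast
  define \<phi> where "\<phi> s = T (t - s) (proj W V (T s y))" for s
  have yE: "y \<in> carr E" using y dom_subset by blast
  have \<phi>m: "\<phi> s \<in> carr E" if "s \<in> {0..t}" for s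
    unfolding \<phi>_def using that yE by (intro T_mem proj_mem) auto
  have loc: "\<exists>d>0. \<forall>r\<in>{0..t}. \<bar>r - s\<bar> < d \<longrightarrow> nrm E (\<phi> r - \<phi> s) \<le> e * \<bar>r - s\<bar>"
    if s: "s \<in> {0..t}" and e: "e > 0" for s e
  proof -
    define z where "z = proj W V (T s y)"
    define u where "u = proj W V (T s (oap G y))"
    have Ty: "T s y \<in> odom G" using s y by (simp add: T_dom)
    have z: "z \<in> odom G" "oap G z = u" "z \<in> carr E" "u \<in> carr E"
      using commute[OF Ty] s y yE dom_subset unfolding z_def u_def by (auto simp: T_dom G_mem T_mem)
    obtain d1 where d1: "d1 > 0" "\<And>r. r \<ge> 0 \<Longrightarrow> \<bar>r - s\<bar> < d1 \<Longrightarrow>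
        nrm E (T r y - T s y - (r - s) *\<^sub>R T s (oap G y)) \<le> e / (3 * c * k) * \<bar>r - s\<bar>"
      by (rule T_derivative[OF y(1), of s "e / (3 * c * k)"]) (use s e c(1) k(1) in auto)
    obtain d2 where d2: "d2 > 0" "\<And>r. r \<ge> 0 \<Longrightarrow> \<bar>r - (t - s)\<bar> < d2 \<Longrightarrow>
        nrm E (T r z - T (t - s) z - (r - (t - s)) *\<^sub>R T (t - s) (oap G z)) \<le> e / 3 * \<bar>r - (t - s)\<bar>"
      by (rule T_derivative[OF z(1), of "t - s" "e / 3"]) (use s e in auto)
    have "((\<lambda>r. nrm E (T r u - T (t - s) u)) \<longlongrightarrow> 0) (at (t - s) within {0..})"
      using T_continuous[OF z(4)] s unfolding continuous_in_def by auto
    then have "\<forall>\<^sub>F r in at (t - s) within {0..}. nrm E (T r u - T (t - s) u) < e / 3"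
      using e by (intro order_tendstoD) auto
    then obtain d3 where d3: "d3 > 0" "\<And>r. r \<ge> 0 \<Longrightarrow> r \<noteq> t - s \<Longrightarrow> \<bar>r - (t - s)\<bar> < d3 \<Longrightarrow>
        nrm E (T r u - T (t - s) u) < e / 3"
      unfolding eventually_at by (auto simp: dist_real_def)
    show ?thesis
    proof (intro exI[of _ "min d1 (min d2 d3)"] conjI ballI impI)
      show "0 < min d1 (min d2 d3)" using d1(1) d2(1) d3(1) by simp
      fix r assume r: "r \<in> {0..t}" and rs: "\<bar>r - s\<bar> < min d1 (min d2 d3)"
      show "nrm E (\<phi> r - \<phi> s) \<le> e * \<bar>r - s\<bar>"
      proof (cases "r = s")
        case False
        (* R and q are the remainders of two first-order expansions; b collects what is left *)
        define R where "R = T r y - T s y - (r - s) *\<^sub>R T s (oap G y)"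
        define a where "a = T (t - r) (proj W V R)"
        define b where "b = (r - s) *\<^sub>R (T (t - r) u - T (t - s) u)"
        define q where "q = T (t - r) z - T (t - s) z - ((t - r) - (t - s)) *\<^sub>R T (t - s) (oap G z)"
        have mem: "T r y \<in> carr E" "T s y \<in> carr E" "T s (oap G y) \<in> carr E" "R \<in> carr E"
          unfolding R_def using r s yE y by (auto intro!: T_mem E.diff_mem E.scale_mem G_mem)
        have Tm: "T (t - r) x \<in> carr E" "T (t - s) x \<in> carr E" if "x \<in> carr E" for x
          using that r s by (auto intro: T_mem)
        have abq: "a \<in> carr E" "b \<in> carr E" "q \<in> carr E"
          unfolding a_def b_def q_def using mem z Tm by auto
        have "proj W V R = proj W V (T r y) - z - (r - s) *\<^sub>R u"
          unfolding R_def z_def u_def using mem by (simp add: proj_diff proj_scaleR)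
        then have "a = T (t - r) (proj W V (T r y)) - T (t - r) z - (r - s) *\<^sub>R T (t - r) u"
          unfolding a_def using r mem z by (simp add: T_diff T_scaleR)
        then have eq: "\<phi> r - \<phi> s = a + b + q"
          unfolding \<phi>_def b_def q_def z_def[symmetric] z(2) by (simp add: algebra_simps)
        have "nrm E (\<phi> r - \<phi> s) \<le> nrm E (a + b) + nrm E q"
          unfolding eq using abq by (intro E.nrm_add) auto
        also have "nrm E (a + b) + nrm E q \<le> nrm E a + nrm E b + nrm E q"
          using abq E.nrm_add[of a b] by simp
        finally have le: "nrm E (\<phi> r - \<phi> s) \<le> nrm E a + nrm E b + nrm E q" .
        have "nrm E a \<le> c * nrm E (proj W V R)"
          unfolding a_def using r mem by (intro c(2)) auto
        also have "\<dots> \<le> c * (k * nrm E R)"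
          using k(2)[OF mem(4)] c(1) by (intro mult_left_mono) auto
        also have "\<dots> \<le> c * (k * (e / (3 * c * k) * \<bar>r - s\<bar>))"
          using d1(2)[of r] r rs c(1) k(1) unfolding R_def by (intro mult_left_mono) auto
        also have "\<dots> = e / 3 * \<bar>r - s\<bar>" using c(1) k(1) by simp
        finally have a: "nrm E a \<le> e / 3 * \<bar>r - s\<bar>" .
        have sw: "\<bar>(t - r) - (t - s)\<bar> = \<bar>r - s\<bar>" by linarith
        have "nrm E b = \<bar>r - s\<bar> * nrm E (T (t - r) u - T (t - s) u)"
          unfolding b_def using Tm[OF z(4)] by (simp add: E.nrm_scale)
        also have "\<dots> \<le> \<bar>r - s\<bar> * (e / 3)"
          using d3(2)[of "t - r"] r rs sw False by (intro mult_left_mono) auto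
        finally have b: "nrm E b \<le> e / 3 * \<bar>r - s\<bar>" by (simp add: mult.commute)
        have q: "nrm E q \<le> e / 3 * \<bar>r - s\<bar>"
          using d2(2)[of "t - r"] r rs unfolding q_def sw by auto
        show ?thesis using le a b q by simp
      qed simp
    qed
  qed
  have "nrm E (\<phi> t - \<phi> 0) \<le> e * (t - 0)" if e: "e > 0" for e
  proof -
    have "0 \<le> a \<and> b \<le> t \<longrightarrow> nrm E (\<phi> b - \<phi> a) \<le> e * (b - a)" if "a \<le> b" for a b
    proof (rule Bolzano[OF that, where P="\<lambda>a b. 0 \<le> a \<and> b \<le> t \<longrightarrow> nrm E (\<phi> b - \<phi> a) \<le> e * (b - a)"])
      fix p q r :: real
      assume pq: "0 \<le> p \<and> q \<le> t \<longrightarrow> nrm E (\<phi> q - \<phi> p) \<le> e * (q - p)"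
        and qr: "0 \<le> q \<and> r \<le> t \<longrightarrow> nrm E (\<phi> r - \<phi> q) \<le> e * (r - q)" and le: "p \<le> q" "q \<le> r"
      show "0 \<le> p \<and> r \<le> t \<longrightarrow> nrm E (\<phi> r - \<phi> p) \<le> e * (r - p)"
      proof
        assume "0 \<le> p \<and> r \<le> t"
        then show "nrm E (\<phi> r - \<phi> p) \<le> e * (r - p)"
          using pq qr le E.nrm_triangle[OF \<phi>m \<phi>m \<phi>m, of r q p] by (simp add: algebra_simps)
      qed
    next
      fix s :: real
      show "\<exists>d>0. \<forall>a b. a \<le> s \<and> s \<le> b \<and> b - a < d \<longrightarrow> 0 \<le> a \<and> b \<le> t \<longrightarrow> nrm E (\<phi> b - \<phi> a) \<le> e * (b - a)"
      proof (cases "s \<in> {0..t}")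
        case False
        then show ?thesis by (intro exI[of _ 1]) auto
      next
        case True
        from loc[OF this e] obtain d where d: "d > 0"
          "\<And>r. r \<in> {0..t} \<Longrightarrow> \<bar>r - s\<bar> < d \<Longrightarrow> nrm E (\<phi> r - \<phi> s) \<le> e * \<bar>r - s\<bar>" by blast
        have "nrm E (\<phi> b - \<phi> a) \<le> e * (b - a)" if "a \<le> s" "s \<le> b" "b - a < d" "0 \<le> a" "b \<le> t" for a b
        proof -
          have "nrm E (\<phi> b - \<phi> s) \<le> e * (b - s)" "nrm E (\<phi> a - \<phi> s) \<le> e * (s - a)"
            using d(2)[of a] d(2)[of b] that by auto
          moreover have "nrm E (\<phi> b - \<phi> a) \<le> nrm E (\<phi> b - \<phi> s) + nrm E (\<phi> s - \<phi> a)"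
            using that by (intro E.nrm_triangle \<phi>m) auto
          moreover have "nrm E (\<phi> s - \<phi> a) = nrm E (\<phi> a - \<phi> s)"
            using that by (intro E.nrm_commute \<phi>m) auto
          ultimately show ?thesis by (simp add: algebra_simps)
        qed
        then show ?thesis using d(1) by blast
      qed
    qed
    then show ?thesis using t by blast
  qed
  from this[of "e / t" for e] have "nrm E (\<phi> t - \<phi> 0) \<le> 0 + e" if "e > 0" for e
    using that t by (cases "t = 0") auto
  then have "nrm E (\<phi> t - \<phi> 0) \<le> 0" by (rule field_le_epsilon)
  moreover have "\<phi> t \<in> carr E" "\<phi> 0 \<in> carr E" using \<phi>m t by auto
  ultimately have "\<phi> t = \<phi> 0"
    using E.nrm_eq0[of "\<phi> t - \<phi> 0"] E.nrm_ge0[of "\<phi> t - \<phi> 0"] by (simp add: order_antisym)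
  moreover have "\<phi> 0 = 0"
    using yE y(2) t T_scaleR[of t 0 0] by (simp add: \<phi>_def T_zero proj_of_V)
  moreover have "\<phi> t = proj W V (T t y)" using yE t by (simp add: \<phi>_def T_zero T_mem)
  ultimately have "proj W V (T t y) = 0" by simp
  then show ?thesis using decompose[of "T t y"] yE t by (simp add: T_mem)
qed

text \<open>The domain is dense, and its projection to V is dense in V since the projection is bounded.\<close>

lemma T_invariant:
  assumes t: "t \<ge> 0" and p: "p \<in> V"
  shows "T t p \<in> V"
proof -
  obtain c where c: "c > 0" "\<And>y. y \<in> carr E \<Longrightarrow> nrm E (T t y) \<le> c * nrm E y"
    by (rule T_locally_bounded[of t]) (use t in blast)
  obtain k where k: "k > 0" "\<And>y. y \<in> carr E \<Longrightarrow> nrm E (proj V W y) \<le> k * nrm E y"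
    by (rule proj_bounded) blast
  have pE: "p \<in> carr E" using p sub by blast
  have dense: "dense_in E (odom G)" using scale unfolding interp_extrap_scale_def by simp
  have "\<exists>v\<in>odom G. nrm E (v - p) < 1 / real (Suc n)" for n
    using dense pE unfolding dense_in_def by auto
  then obtain x where x: "\<And>n. x n \<in> odom G" "\<And>n. nrm E (x n - p) < 1 / real (Suc n)" by metis
  define v where "v n = proj V W (x n)" for n
  have xE: "x n \<in> carr E" for n using x(1) dom_subset by blast
  have v: "v n \<in> odom G" "v n \<in> V" "v n \<in> carr E" for n
    using commute[OF x(1)] decompose(1)[OF xE] sub unfolding v_def by auto
  have bound: "norm (nrm E (T t (v n) - T t p)) \<le> c * k * (1 / real (Suc n))" for n
  proof -
    have "T t (v n) - T t p = T t (v n - p)" using t v pE by (simp add: T_diff)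
    then have 1: "nrm E (T t (v n) - T t p) \<le> c * nrm E (v n - p)" using v pE c(2)[of "v n - p"] by simp
    have "v n - p = proj V W (x n - p)" using proj_diff(1)[OF xE pE] p by (simp add: v_def proj_of_V)
    then have "nrm E (v n - p) \<le> k * nrm E (x n - p)" using k(2)[of "x n - p"] xE pE by simp
    also have "\<dots> \<le> k * (1 / real (Suc n))"
      using x(2)[of n] k(1) by (intro mult_left_mono) auto
    finally have "c * nrm E (v n - p) \<le> c * (k * (1 / real (Suc n)))"
      using c(1) by (intro mult_left_mono) auto
    moreover have "0 \<le> nrm E (T t (v n) - T t p)" using t v pE by (intro E.nrm_ge0 E.diff_mem T_mem) auto
    ultimately show ?thesis using 1 unfolding mult.assoc by simp
  qed
  have lim: "(\<lambda>n. c * k * (1 / real (Suc n))) \<longlonglongrightarrow> 0"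
    by (intro tendsto_mult_right_zero LIMSEQ_Suc[OF lim_1_over_n])
  have "(\<lambda>n. nrm E (T t (v n) - T t p)) \<longlonglongrightarrow> 0"
    by (rule Lim_null_comparison[OF always_eventually lim]) (use bound in blast)
  then have "tends_in E (\<lambda>n. T t (v n)) (T t p)" using t pE by (simp add: tends_in_def T_mem)
  then show ?thesis by (rule closed_in_limit[OF closed(1) T_invariant_dom[OF t v(1,2)]])
qed

end

section \<open>Exponentially weighted paths and the contraction principle\<close>

text \<open>Product of three spaces with the sum of the norms, as in the norm of \<^const>\<open>C_eta\<close>.\<close>

definition prod_space :: "'a nspace \<Rightarrow> 'b nspace \<Rightarrow> 'c nspace \<Rightarrow> ('a \<times> 'b \<times> 'c) nspace" where
  "prod_space E F H = \<lparr>carr = carr E \<times> carr F \<times> carr H,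
     nrm = (\<lambda>p. nrm E (fst p) + nrm F (fst (snd p)) + nrm H (snd (snd p)))\<rparr>"

lemma carr_prod_space: "carr (prod_space E F H) = carr E \<times> carr F \<times> carr H"
  and nrm_prod_space: "nrm (prod_space E F H) p = nrm E (fst p) + nrm F (fst (snd p)) + nrm H (snd (snd p))"
  by (simp_all add: prod_space_def)

lemma tendsto_sum3_zero_iff:
  fixes a b c :: "'b \<Rightarrow> real"
  assumes "\<forall>\<^sub>F r in F. 0 \<le> a r \<and> 0 \<le> b r \<and> 0 \<le> c r"
  shows "((\<lambda>r. a r + b r + c r) \<longlongrightarrow> 0) F \<longleftrightarrow> (a \<longlongrightarrow> 0) F \<and> (b \<longlongrightarrow> 0) F \<and> (c \<longlongrightarrow> 0) F"
proof
  assume lim: "((\<lambda>r. a r + b r + c r) \<longlongrightarrow> 0) F"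
  have "(a \<longlongrightarrow> 0) F" by (rule Lim_null_comparison[OF _ lim]) (use assms in \<open>auto elim!: eventually_mono\<close>)
  moreover have "(b \<longlongrightarrow> 0) F" by (rule Lim_null_comparison[OF _ lim]) (use assms in \<open>auto elim!: eventually_mono\<close>)
  moreover have "(c \<longlongrightarrow> 0) F" by (rule Lim_null_comparison[OF _ lim]) (use assms in \<open>auto elim!: eventually_mono\<close>)
  ultimately show "(a \<longlongrightarrow> 0) F \<and> (b \<longlongrightarrow> 0) F \<and> (c \<longlongrightarrow> 0) F" by simp
next
  assume *: "(a \<longlongrightarrow> 0) F \<and> (b \<longlongrightarrow> 0) F \<and> (c \<longlongrightarrow> 0) F"
  have "((\<lambda>r. a r + b r + c r) \<longlongrightarrow> 0 + 0 + 0) F" using * by (intro tendsto_add) auto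
  then show "((\<lambda>r. a r + b r + c r) \<longlongrightarrow> 0) F" by simp
qed

lemma prod_space_complete:
  assumes "complete_carrier E" "complete_carrier F" "complete_carrier H"
  shows "complete_carrier (prod_space E F H)"
proof -
  interpret E: complete_carrier E by fact
  interpret F: complete_carrier F by fact
  interpret H: complete_carrier H by fact
  show ?thesis
  proof
    fix x y assume x: "x \<in> carr (prod_space E F H)" and y: "y \<in> carr (prod_space E F H)"
    show "nrm (prod_space E F H) (x + y) \<le> nrm (prod_space E F H) x + nrm (prod_space E F H) y"
      using x y E.nrm_add[of "fst x" "fst y"] F.nrm_add[of "fst (snd x)" "fst (snd y)"]
        H.nrm_add[of "snd (snd x)" "snd (snd y)"]
      by (auto simp: carr_prod_space nrm_prod_space)
  next
    fix x assume x: "x \<in> carr (prod_space E F H)"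
    then have "0 \<le> nrm E (fst x)" "0 \<le> nrm F (fst (snd x))" "0 \<le> nrm H (snd (snd x))"
      by (auto simp: carr_prod_space)
    then show "nrm (prod_space E F H) x = 0 \<longleftrightarrow> x = 0"
      using x E.nrm_eq0[of "fst x"] F.nrm_eq0[of "fst (snd x)"] H.nrm_eq0[of "snd (snd x)"]
      by (auto simp: carr_prod_space nrm_prod_space prod_eq_iff add_nonneg_eq_0_iff)
  next
    fix \<sigma> :: "nat \<Rightarrow> 'a \<times> 'b \<times> 'c"
    assume m: "\<And>n. \<sigma> n \<in> carr (prod_space E F H)"
      and c: "\<And>e. e > 0 \<Longrightarrow> \<exists>N. \<forall>m\<ge>N. \<forall>n\<ge>N. nrm (prod_space E F H) (\<sigma> m - \<sigma> n) < e"
    have mem: "fst (\<sigma> n) \<in> carr E" "fst (snd (\<sigma> n)) \<in> carr F" "snd (snd (\<sigma> n)) \<in> carr H" for n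
      using m[of n] by (auto simp: carr_prod_space)
    have le: "nrm E (fst (\<sigma> m) - fst (\<sigma> n)) \<le> nrm (prod_space E F H) (\<sigma> m - \<sigma> n)"
      "nrm F (fst (snd (\<sigma> m)) - fst (snd (\<sigma> n))) \<le> nrm (prod_space E F H) (\<sigma> m - \<sigma> n)"
      "nrm H (snd (snd (\<sigma> m)) - snd (snd (\<sigma> n))) \<le> nrm (prod_space E F H) (\<sigma> m - \<sigma> n)" for m n
      using mem[of m] mem[of n] by (auto simp: nrm_prod_space)
    obtain x where x: "tends_in E (\<lambda>n. fst (\<sigma> n)) x"
      using E.complete[of "\<lambda>n. fst (\<sigma> n)"] mem(1) c le(1) by (meson order.strict_trans1)
    obtain y where y: "tends_in F (\<lambda>n. fst (snd (\<sigma> n))) y"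
      using F.complete[of "\<lambda>n. fst (snd (\<sigma> n))"] mem(2) c le(2) by (meson order.strict_trans1)
    obtain z where z: "tends_in H (\<lambda>n. snd (snd (\<sigma> n))) z"
      using H.complete[of "\<lambda>n. snd (snd (\<sigma> n))"] mem(3) c le(3) by (meson order.strict_trans1)
    have "(\<lambda>n. nrm E (fst (\<sigma> n) - x) + nrm F (fst (snd (\<sigma> n)) - y) + nrm H (snd (snd (\<sigma> n)) - z)) \<longlonglongrightarrow> 0 + 0 + 0"
      using x y z by (intro tendsto_add) (auto simp: tends_in_def)
    then have "tends_in (prod_space E F H) \<sigma> (x, y, z)"
      using x y z by (simp add: tends_in_def carr_prod_space nrm_prod_space)
    then show "\<exists>x. tends_in (prod_space E F H) \<sigma> x" by blast
  qed (auto simp: carr_prod_space nrm_prod_space E.nrm_scale F.nrm_scale H.nrm_scale zero_prod_def algebra_simps)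
qed

lemma continuous_in_prod_space:
  assumes "normed_carrier E" "normed_carrier F" "normed_carrier H"
  shows "continuous_in (prod_space E F H) T w \<longleftrightarrow> continuous_in E T (\<lambda>t. fst (w t)) \<and>
    continuous_in F T (\<lambda>t. fst (snd (w t))) \<and> continuous_in H T (\<lambda>t. snd (snd (w t)))"
proof (cases "\<forall>t\<in>T. w t \<in> carr E \<times> carr F \<times> carr H")
  case True
  interpret E: normed_carrier E by fact
  interpret F: normed_carrier F by fact
  interpret H: normed_carrier H by fact
  have "((\<lambda>r. nrm (prod_space E F H) (w r - w s)) \<longlongrightarrow> 0) (at s within T) \<longleftrightarrow>
      ((\<lambda>r. nrm E (fst (w r) - fst (w s))) \<longlongrightarrow> 0) (at s within T) \<and>
      ((\<lambda>r. nrm F (fst (snd (w r)) - fst (snd (w s)))) \<longlongrightarrow> 0) (at s within T) \<and>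
      ((\<lambda>r. nrm H (snd (snd (w r)) - snd (snd (w s)))) \<longlongrightarrow> 0) (at s within T)" if s: "s \<in> T" for s
  proof -
    have "0 \<le> nrm E (fst (w r) - fst (w s)) \<and> 0 \<le> nrm F (fst (snd (w r)) - fst (snd (w s))) \<and>
        0 \<le> nrm H (snd (snd (w r)) - snd (snd (w s)))" if "r \<in> T" for r
    proof -
      have "w r \<in> carr E \<times> carr F \<times> carr H" "w s \<in> carr E \<times> carr F \<times> carr H" using True s that by auto
      then show ?thesis by (auto simp: mem_Times_iff)
    qed
    then have "\<forall>\<^sub>F r in at s within T. 0 \<le> nrm E (fst (w r) - fst (w s)) \<and>
        0 \<le> nrm F (fst (snd (w r)) - fst (snd (w s))) \<and> 0 \<le> nrm H (snd (snd (w r)) - snd (snd (w s)))"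
      by (auto simp: eventually_at_filter)
    from tendsto_sum3_zero_iff[OF this] show ?thesis by (simp add: nrm_prod_space)
  qed
  then show ?thesis using True unfolding continuous_in_def
    by (simp add: carr_prod_space mem_Times_iff) blast
next
  case False
  then show ?thesis unfolding continuous_in_def by (auto simp: carr_prod_space mem_Times_iff)
qed

text \<open>The space \<^const>\<open>C_eta\<close> for paths with values in a single space (see \<open>C_eta_eq\<close>).  As for \<^const>\<open>C_eta\<close>,
  its elements are extensional, so that a path is determined by its values at nonpositive times.\<close>

definition weighted_paths :: "real \<Rightarrow> 'p::real_vector nspace \<Rightarrow> (real \<Rightarrow> 'p) set" where
  "weighted_paths \<eta> P = {w \<in> extensional {..0}. continuous_in P {..0} w \<and>
     (\<exists>M. \<forall>t\<le>0. nrm P (w t) \<le> M * exp (\<eta> * t))}"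

lemma C_eta_eq:
  assumes "normed_carrier E" "normed_carrier F" "normed_carrier H"
  shows "C_eta \<eta> E F H = weighted_paths \<eta> (prod_space E F H)"
proof -
  have "exp (- \<eta> * t) * x \<le> M \<longleftrightarrow> x \<le> M * exp (\<eta> * t)" for t x M :: real
    by (simp add: exp_minus field_simps)
  then show ?thesis
    unfolding C_eta_def weighted_paths_def bdd_above_def continuous_in_prod_space[OF assms]
    by (auto simp: nrm_prod_space)
qed

context complete_carrier
begin

lemma weighted_paths_limit:
  assumes w: "\<And>n. w n \<in> weighted_paths \<eta> E" and v: "v \<in> extensional {..0}" "\<And>t. t \<le> 0 \<Longrightarrow> v t \<in> carr E"
    and le: "\<And>n t. t \<le> 0 \<Longrightarrow> nrm E (w n t - v t) \<le> a n * exp (\<eta> * t)" and a: "a \<longlonglongrightarrow> (0::real)"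
  shows "v \<in> weighted_paths \<eta> E"
proof -
  have m: "w n t \<in> carr E" if "t \<le> 0" for n t
    using w that unfolding weighted_paths_def continuous_in_def by auto
  have "continuous_in E {..0} v"
    unfolding continuous_in_def
  proof (intro ballI conjI)
    fix s :: real assume s: "s \<in> {..0}"
    then show "v s \<in> carr E" using v(2) by simp
    show "((\<lambda>r. nrm E (v r - v s)) \<longlongrightarrow> 0) (at s within {..0})"
    proof (rule tendstoI)
      fix e :: real assume e: "e > 0"
      define B where "B = exp (\<eta> * s) + 1"
      have B: "B > 0" by (simp add: B_def add_pos_pos)
      have "\<forall>\<^sub>F n in sequentially. a n < e / (3 * B)"
        using a e B by (intro order_tendstoD) auto
      then obtain n where n: "a n < e / (3 * B)" by (auto simp: eventually_sequentially)
      have small: "a n * x \<le> e / 3" if "0 \<le> x" "x \<le> B" for x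
      proof -
        have "a n * x \<le> e / (3 * B) * x" using n that by (intro mult_right_mono) auto
        also have "\<dots> \<le> e / (3 * B) * B" using e B that by (intro mult_left_mono) auto
        finally show ?thesis using B by simp
      qed
      have "((\<lambda>r. nrm E (w n r - w n s)) \<longlongrightarrow> 0) (at s within {..0})"
        using w[of n] s unfolding weighted_paths_def continuous_in_def by auto
      then have ev1: "\<forall>\<^sub>F r in at s within {..0}. nrm E (w n r - w n s) < e / 3"
        using e by (intro order_tendstoD) auto
      have "((\<lambda>r. exp (\<eta> * r)) \<longlongrightarrow> exp (\<eta> * s)) (at s within {..0})" by (intro tendsto_intros)
      then have ev2: "\<forall>\<^sub>F r in at s within {..0}. exp (\<eta> * r) < B"
        by (rule order_tendstoD) (simp add: B_def)
      have ev3: "\<forall>\<^sub>F r in at s within {..0}. r \<le> 0" by (simp add: eventually_at_filter)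
      show "\<forall>\<^sub>F r in at s within {..0}. dist (nrm E (v r - v s)) 0 < e"
        using ev1 ev2 ev3
      proof eventually_elim
        case (elim r)
        have rs: "v r \<in> carr E" "v s \<in> carr E" "w n r \<in> carr E" "w n s \<in> carr E" using elim s v m by auto
        have "nrm E (w n r - v r) \<le> e / 3" using le[of r n] small[of "exp (\<eta> * r)"] elim by simp
        moreover have "nrm E (w n s - v s) \<le> e / 3"
          using le[of s n] small[of "exp (\<eta> * s)"] s by (simp add: B_def)
        moreover have "nrm E (v r - v s) \<le> nrm E (w n r - v r) + nrm E (w n r - w n s) + nrm E (w n s - v s)"
        proof -
          have "nrm E (v r - v s) \<le> nrm E (v r - w n r) + nrm E (w n r - v s)"
            using rs by (intro nrm_triangle)
          moreover have "nrm E (w n r - v s) \<le> nrm E (w n r - w n s) + nrm E (w n s - v s)"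
            using rs by (intro nrm_triangle)
          moreover have "nrm E (v r - w n r) = nrm E (w n r - v r)" using rs by (intro nrm_commute)
          ultimately show ?thesis by linarith
        qed
        ultimately show ?case using elim rs by simp
      qed
    qed
  qed
  moreover have "\<exists>M. \<forall>t\<le>0. nrm E (v t) \<le> M * exp (\<eta> * t)"
  proof -
    obtain M where M: "\<And>t. t \<le> 0 \<Longrightarrow> nrm E (w 0 t) \<le> M * exp (\<eta> * t)"
      using w[of 0] unfolding weighted_paths_def by auto
    have "nrm E (v t) \<le> (M + a 0) * exp (\<eta> * t)" if "t \<le> 0" for t
      using M[OF that] le[OF that, of 0] nrm_reverse[of "v t" "w 0 t"] nrm_commute[of "v t" "w 0 t"]
        v(2)[OF that] m[OF that, of 0] by (simp add: algebra_simps)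
    then show ?thesis by blast
  qed
  ultimately show ?thesis using v(1) unfolding weighted_paths_def by simp
qed

lemma weighted_paths_diff_bound:
  assumes "w \<in> weighted_paths \<eta> E" "w' \<in> weighted_paths \<eta> E"
  obtains R where "R \<ge> 0" "\<And>t. t \<le> 0 \<Longrightarrow> nrm E (w t - w' t) \<le> R * exp (\<eta> * t)"
proof -
  obtain M M' where M: "\<And>t. t \<le> 0 \<Longrightarrow> nrm E (w t) \<le> M * exp (\<eta> * t)"
    "\<And>t. t \<le> 0 \<Longrightarrow> nrm E (w' t) \<le> M' * exp (\<eta> * t)"
    using assms unfolding weighted_paths_def by auto
  have m: "w t \<in> carr E" "w' t \<in> carr E" if "t \<le> 0" for t
    using assms that unfolding weighted_paths_def continuous_in_def by auto
  show thesis
  proof (rule that)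
    show "0 \<le> M + M'" using M[of 0] nrm_ge0[OF m(1)[of 0]] nrm_ge0[OF m(2)[of 0]] by simp
    show "nrm E (w t - w' t) \<le> (M + M') * exp (\<eta> * t)" if "t \<le> 0" for t
      using M[OF that] nrm_diff[OF m[OF that]] by (simp add: algebra_simps)
  qed
qed

text \<open>Contraction principle. The constant R bounds the weighted distance of two paths, so that the
  supremum defining the norm need not be mentioned.\<close>

lemma weighted_paths_fixed_point:
  assumes L: "\<And>w. w \<in> weighted_paths \<eta> E \<Longrightarrow> L w \<in> weighted_paths \<eta> E"
    and q: "0 \<le> q" "q < 1"
    and contr: "\<And>w w' R t. w \<in> weighted_paths \<eta> E \<Longrightarrow> w' \<in> weighted_paths \<eta> E \<Longrightarrow> R \<ge> 0 \<Longrightarrow>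
      (\<And>t. t \<le> 0 \<Longrightarrow> nrm E (w t - w' t) \<le> R * exp (\<eta> * t)) \<Longrightarrow> t \<le> 0 \<Longrightarrow>
      nrm E (L w t - L w' t) \<le> q * R * exp (\<eta> * t)"
  shows "\<exists>!w. w \<in> weighted_paths \<eta> E \<and> L w = w"
proof -
  have m: "w t \<in> carr E" if "w \<in> weighted_paths \<eta> E" "t \<le> 0" for w t
    using that unfolding weighted_paths_def continuous_in_def by auto
  define w where "w n = (L ^^ n) (\<lambda>t\<in>{..0}. 0)" for n
  have w0: "w 0 \<in> weighted_paths \<eta> E"
  proof -
    have "continuous_in E {..0} (w 0)"
      unfolding continuous_in_def w_def by (auto intro!: tendsto_eventually simp: eventually_at_filter)
    then show ?thesis by (auto simp: weighted_paths_def w_def intro!: exI[of _ 0])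
  qed
  have wS: "w (Suc n) = L (w n)" for n by (simp add: w_def)
  have wp: "w n \<in> weighted_paths \<eta> E" for n
    by (induction n) (use w0 in \<open>auto simp: wS intro: L\<close>)
  obtain R where R: "R \<ge> 0" "\<And>t. t \<le> 0 \<Longrightarrow> nrm E (w 1 t - w 0 t) \<le> R * exp (\<eta> * t)"
    by (rule weighted_paths_diff_bound[OF wp wp, of 1 0]) blast
  have step: "nrm E (w (Suc n) t - w n t) \<le> q ^ n * R * exp (\<eta> * t)" if "t \<le> 0" for n t
    using that
  proof (induction n arbitrary: t)
    case 0
    then show ?case using R(2) by simp
  next
    case (Suc n)
    then show ?case
      using contr[OF wp wp, of "q ^ n * R" "Suc n" n t] q(1) R(1) by (simp add: wS mult.assoc)
  qed
  define G where "G n = R * (\<Sum>k<n. q ^ k)" for n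
  define S where "S = R / (1 - q)"
  have Glim: "G \<longlonglongrightarrow> S"
    unfolding G_def S_def using geometric_sums[of q] q
    by (auto simp: sums_def divide_inverse intro!: tendsto_mult_left)
  have dom: "nrm E (w m t - w n t) \<le> G m * exp (\<eta> * t) - G n * exp (\<eta> * t)" if "t \<le> 0" "n \<le> m" for m n t
    using \<open>n \<le> m\<close>
  proof (induction m rule: dec_induct)
    case base
    then show ?case by simp
  next
    case (step k)
    have "nrm E (w (Suc k) t - w n t) \<le> nrm E (w (Suc k) t - w k t) + nrm E (w k t - w n t)"
      using that(1) by (intro nrm_triangle m wp)
    then show ?case
      using step.IH \<open>\<And>n t. t \<le> 0 \<Longrightarrow> nrm E (w (Suc n) t - w n t) \<le> q ^ n * R * exp (\<eta> * t)\<close>[OF that(1), of k]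
      by (simp add: G_def algebra_simps)
  qed
  have Gconv: "convergent (\<lambda>n. G n * exp (\<eta> * t))" for t
    using tendsto_mult_right[OF Glim] by (rule convergentI)
  have "\<exists>x. tends_in E (\<lambda>n. w n t) x" if "t \<le> 0" for t
    by (rule complete[OF m[OF wp that] dominated_Cauchy[OF m[OF wp that] dom[OF that] Gconv]])
  then obtain v0 where v0: "\<And>t. t \<le> 0 \<Longrightarrow> tends_in E (\<lambda>n. w n t) (v0 t)" by metis
  define v where "v = restrict v0 {..0}"
  have v: "v t \<in> carr E" "(\<lambda>n. nrm E (w n t - v t)) \<longlonglongrightarrow> 0" if "t \<le> 0" for t
    using v0[OF that] that by (auto simp: v_def tends_in_def)
  have le: "nrm E (w n t - v t) \<le> (S - G n) * exp (\<eta> * t)" if "t \<le> 0" for n t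
  proof (rule LIMSEQ_le)
    have "(\<lambda>m. nrm E ((w n t - w m t) - (w n t - v t))) \<longlonglongrightarrow> 0"
      using v(2)[OF that] nrm_commute[OF m[OF wp that] v(1)[OF that]] by (simp add: algebra_simps)
    then show "(\<lambda>m. nrm E (w n t - w m t)) \<longlonglongrightarrow> nrm E (w n t - v t)"
      using m[OF wp that] v(1)[OF that] by (intro nrm_tendsto) auto
    show "(\<lambda>m. (G m - G n) * exp (\<eta> * t)) \<longlonglongrightarrow> (S - G n) * exp (\<eta> * t)"
      by (intro tendsto_intros Glim)
    show "\<exists>N. \<forall>m\<ge>N. nrm E (w n t - w m t) \<le> (G m - G n) * exp (\<eta> * t)"
      using dom[OF that, of n] nrm_commute[OF m[OF wp that] m[OF wp that], of n]
      by (intro exI[of _ n]) (simp add: left_diff_distrib)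
  qed
  have "(\<lambda>n. S - G n) \<longlonglongrightarrow> S - S" by (intro tendsto_intros Glim)
  then have S0: "(\<lambda>n. S - G n) \<longlonglongrightarrow> 0" by simp
  have vp: "v \<in> weighted_paths \<eta> E"
    by (rule weighted_paths_limit[OF wp _ v(1) le S0]) (auto simp only: v_def restrict_extensional)
  have SG: "0 \<le> S - G n" for n
    using le[of 0 n] nrm_ge0[OF diff_mem[OF m[OF wp, of 0 n] v(1)[of 0]]] by simp
  have "L v t = v t" if t: "t \<le> 0" for t
  proof (rule limit_unique[of sequentially "\<lambda>n. w (Suc n) t"])
    show "(\<lambda>n. nrm E (w (Suc n) t - v t)) \<longlonglongrightarrow> 0" using v(2)[OF t] by (rule LIMSEQ_Suc)
    have "(\<lambda>n. q * (S - G n) * exp (\<eta> * t)) \<longlonglongrightarrow> q * 0 * exp (\<eta> * t)" by (intro tendsto_intros S0)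
    then have z: "(\<lambda>n. q * (S - G n) * exp (\<eta> * t)) \<longlonglongrightarrow> 0" by simp
    show "(\<lambda>n. nrm E (w (Suc n) t - L v t)) \<longlonglongrightarrow> 0"
    proof (rule Lim_null_comparison[OF _ z], intro always_eventually allI)
      fix n
      have "nrm E (w (Suc n) t - L v t) \<le> q * (S - G n) * exp (\<eta> * t)"
        unfolding wS by (rule contr[OF wp vp SG le t])
      then show "norm (nrm E (w (Suc n) t - L v t)) \<le> q * (S - G n) * exp (\<eta> * t)"
        using m[OF wp t, of "Suc n"] m[OF L[OF vp] t] by simp
    qed
  qed (use m[OF wp t] m[OF L[OF vp] t] v(1)[OF t] in auto)
  then have fix1: "L v = v"
    using L[OF vp] vp unfolding weighted_paths_def by (intro extensionalityI[of _ "{..0}"]) auto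
  show ?thesis
  proof (rule ex1I[of _ v])
    show "v \<in> weighted_paths \<eta> E \<and> L v = v" using vp fix1 by simp
    fix u assume u: "u \<in> weighted_paths \<eta> E \<and> L u = u"
    obtain R where R: "R \<ge> 0" "\<And>t. t \<le> 0 \<Longrightarrow> nrm E (u t - v t) \<le> R * exp (\<eta> * t)"
      by (rule weighted_paths_diff_bound[of u \<eta> v]) (use u vp in auto)
    have "nrm E (u t - v t) \<le> q ^ n * R * exp (\<eta> * t)" if "t \<le> 0" for n t
      using that
    proof (induction n arbitrary: t)
      case (Suc n)
      then show ?case
        using contr[of u v "q ^ n * R" t] u vp fix1 q(1) R(1) by (simp add: mult.assoc)
    qed (use R in simp)
    moreover have "(\<lambda>n. q ^ n * R * exp (\<eta> * t)) \<longlonglongrightarrow> 0" for t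
      using q by (intro tendsto_mult_left_zero LIMSEQ_realpow_zero)
    ultimately have "nrm E (u t - v t) \<le> 0" if "t \<le> 0" for t
      using that by (intro LIMSEQ_le_const[of "\<lambda>n. q ^ n * R * exp (\<eta> * t)"]) auto
    then have "u t = v t" if "t \<le> 0" for t
      using that nrm_eq0[of "u t - v t"] nrm_ge0[of "u t - v t"] m[of u t] m[of v t] u vp
      by (simp add: order_antisym)
    then show "u = v"
      using u vp unfolding weighted_paths_def by (intro extensionalityI[of _ "{..0}"]) auto
  qed
qed

end

text \<open>A system of three components with values in E, F and H, each depending on the whole path in the
  product space.  The first one is scaled by a, and the third one is subtracted from a given path h.
  The assumption \<open>gap\<close> says that the Lipschitz constants of the components add up to less than 1.\<close>

locale lp_system =
  E: complete_carrier E + F: complete_carrier F + H: complete_carrier H +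
  c1: lp_component E D1 U1 C1 \<theta>1 b1 "prod_space E F H" N1 l1 \<eta> \<kappa>1 +
  c2: lp_component F D2 U2 C2 \<theta>2 b2 "prod_space E F H" N2 l2 \<eta> \<kappa>2 +
  c3: lp_component H D3 U3 C3 \<theta>3 b3 "prod_space E F H" N3 l3 \<eta> \<kappa>3
  for E D1 :: "'x::banach nspace" and F H D2 D3 :: "'y::banach nspace"
    and U1 C1 \<theta>1 b1 U2 C2 \<theta>2 b2 U3 C3 \<theta>3 b3 N1 l1 \<kappa>1 N2 l2 \<kappa>2 N3 l3 \<kappa>3 \<eta> +
  fixes a :: real and h :: "real \<Rightarrow> 'y" and M :: real
  assumes a: "a \<ge> 0" and h: "continuous_in H {..0} h"
    and h_bound: "\<And>t. t \<le> 0 \<Longrightarrow> nrm H (h t) \<le> M * exp (\<eta> * t)"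
    and gap: "a * (C1 * Gamma \<theta>1 / (- (b1 + \<kappa>1 * \<eta>)) powr \<theta>1 * l1)
      + C2 * Gamma \<theta>2 / (- (b2 + \<kappa>2 * \<eta>)) powr \<theta>2 * l2
      + C3 * Gamma \<theta>3 / (- (b3 + \<kappa>3 * \<eta>)) powr \<theta>3 * l3 < 1"
begin

abbreviation "P \<equiv> prod_space E F H"
abbreviation "gain1 \<equiv> C1 * Gamma \<theta>1 / (- (b1 + \<kappa>1 * \<eta>)) powr \<theta>1 * l1"
abbreviation "gain2 \<equiv> C2 * Gamma \<theta>2 / (- (b2 + \<kappa>2 * \<eta>)) powr \<theta>2 * l2"
abbreviation "gain3 \<equiv> C3 * Gamma \<theta>3 / (- (b3 + \<kappa>3 * \<eta>)) powr \<theta>3 * l3"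

text \<open>The Lyapunov-Perron operator of the system.\<close>

definition \<Lambda> :: "(real \<Rightarrow> 'x \<times> 'y \<times> 'y) \<Rightarrow> real \<Rightarrow> 'x \<times> 'y \<times> 'y" where
  "\<Lambda> w = (\<lambda>t\<in>{..0}. (a *\<^sub>R c1.conv w t, c2.conv w t, h t - c3.conv w t))"

lemma bounded_pathE:
  assumes "w \<in> weighted_paths \<eta> P"
  obtains R where "c1.bounded_path w R" "c2.bounded_path w R" "c3.bounded_path w R"
  using assms unfolding weighted_paths_def c1.bounded_path_def c2.bounded_path_def c3.bounded_path_def
  by auto

lemma \<Lambda>_mem:
  assumes w: "w \<in> weighted_paths \<eta> P"
  shows "\<Lambda> w \<in> weighted_paths \<eta> P"
proof -
  obtain R where R: "c1.bounded_path w R" "c2.bounded_path w R" "c3.bounded_path w R"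
    by (rule bounded_pathE[OF w]) blast
  have "continuous_in P {..0} (\<lambda>t. (a *\<^sub>R c1.conv w t, c2.conv w t, h t - c3.conv w t))"
    unfolding continuous_in_prod_space[OF E.normed_carrier_axioms F.normed_carrier_axioms H.normed_carrier_axioms]
    using E.continuous_in_scale[OF c1.conv_continuous[OF R(1)]] c2.conv_continuous[OF R(2)]
      H.continuous_in_diff[OF h c3.conv_continuous[OF R(3)]] by simp
  then have "continuous_in P {..0} (\<Lambda> w)"
    by (subst continuous_in_cong[of _ _ "\<lambda>t. (a *\<^sub>R c1.conv w t, c2.conv w t, h t - c3.conv w t)"])
      (auto simp: \<Lambda>_def)
  moreover have "nrm P (\<Lambda> w t) \<le> (a * (gain1 * R) + gain2 * R + (M + gain3 * R)) * exp (\<eta> * t)" if t: "t \<le> 0" for t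
  proof -
    have "h t \<in> carr H" using h t unfolding continuous_in_def by auto
    then have "nrm H (h t - c3.conv w t) \<le> M * exp (\<eta> * t) + gain3 * R * exp (\<eta> * t)"
      using H.nrm_diff[of "h t" "c3.conv w t"] c3.conv_props(3)[OF R(3)] h_bound[OF t] c3.conv_bound[OF R(3), of t]
      by fastforce
    moreover have "nrm E (a *\<^sub>R c1.conv w t) \<le> a * (gain1 * R * exp (\<eta> * t))"
      using mult_left_mono[OF c1.conv_bound[OF R(1), of t] a] a
      by (simp only: E.nrm_scale[OF c1.conv_props(3)[OF R(1)]] abs_of_nonneg)
    ultimately show ?thesis
      using c2.conv_bound[OF R(2), of t] t by (simp add: \<Lambda>_def nrm_prod_space algebra_simps)
  qed
  ultimately show ?thesis unfolding weighted_paths_def by (auto simp: \<Lambda>_def)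
qed

lemma \<Lambda>_contraction:
  assumes w: "w \<in> weighted_paths \<eta> P" "w' \<in> weighted_paths \<eta> P" and R: "R \<ge> 0"
    and le: "\<And>t. t \<le> 0 \<Longrightarrow> nrm P (w t - w' t) \<le> R * exp (\<eta> * t)" and t: "t \<le> 0"
  shows "nrm P (\<Lambda> w t - \<Lambda> w' t) \<le> (a * gain1 + gain2 + gain3) * R * exp (\<eta> * t)"
proof -
  obtain S where S: "c1.bounded_path w S" "c2.bounded_path w S" "c3.bounded_path w S"
    by (rule bounded_pathE[OF w(1)]) blast
  obtain S' where S': "c1.bounded_path w' S'" "c2.bounded_path w' S'" "c3.bounded_path w' S'"
    by (rule bounded_pathE[OF w(2)]) blast
  have mem: "c1.conv w t \<in> carr E" "c1.conv w' t \<in> carr E" "c3.conv w t \<in> carr H" "c3.conv w' t \<in> carr H"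
    using c1.conv_props(3) c3.conv_props(3) S S' by blast+
  have "nrm E (a *\<^sub>R c1.conv w t - a *\<^sub>R c1.conv w' t) = a * nrm E (c1.conv w t - c1.conv w' t)"
    using mem a by (simp add: scaleR_diff_right[symmetric] E.nrm_scale)
  also have "\<dots> \<le> a * (gain1 * R * exp (\<eta> * t))"
    using c1.conv_Lipschitz[OF S(1) S'(1) R le] a by (intro mult_left_mono) auto
  finally have 1: "nrm E (a *\<^sub>R c1.conv w t - a *\<^sub>R c1.conv w' t) \<le> a * (gain1 * R * exp (\<eta> * t))" .
  have 2: "nrm F (c2.conv w t - c2.conv w' t) \<le> gain2 * R * exp (\<eta> * t)"
    by (rule c2.conv_Lipschitz[OF S(2) S'(2) R le])
  have "nrm H ((h t - c3.conv w t) - (h t - c3.conv w' t)) = nrm H (c3.conv w t - c3.conv w' t)"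
    using H.nrm_commute[OF mem(3,4)] by simp
  then have 3: "nrm H ((h t - c3.conv w t) - (h t - c3.conv w' t)) \<le> gain3 * R * exp (\<eta> * t)"
    using c3.conv_Lipschitz[OF S(3) S'(3) R le, of t] by simp
  show ?thesis using 1 2 3 t by (simp add: \<Lambda>_def nrm_prod_space algebra_simps)
qed

lemma unique_fixed_point: "\<exists>!w. w \<in> weighted_paths \<eta> P \<and> \<Lambda> w = w"
proof -
  interpret P: complete_carrier P
    by (rule prod_space_complete) unfold_locales
  show ?thesis
  proof (rule P.weighted_paths_fixed_point[OF \<Lambda>_mem _ gap \<Lambda>_contraction])
    have "0 \<le> gain1" "0 \<le> gain2" "0 \<le> gain3"
      using c1.C_nonneg c2.C_nonneg c3.C_nonneg c1.l_nonneg c2.l_nonneg c3.l_nonneg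
        c1.\<theta>_pos c2.\<theta>_pos c3.\<theta>_pos by (auto intro!: mult_nonneg_nonneg divide_nonneg_nonneg less_imp_le[OF Gamma_real_pos])
    then show "0 \<le> a * gain1 + gain2 + gain3"
      using mult_nonneg_nonneg[OF a, of gain1] by linarith
  qed
qed

end

section \<open>The Lyapunov-Perron operator\<close>

lemma Gamma_ge_1:
  assumes "0 < x" "x \<le> (1::real)"
  shows "1 \<le> Gamma x"
proof -
  define t where "t = (1 - x) / (2 - x)"
  have t: "0 \<le> t" "t < 1" using assms by (auto simp: t_def field_simps)
  have "t * (2 - x) = 1 - x" using assms by (simp add: t_def)
  then have t3: "(1 - t) * x + t * 2 = 1" by (simp add: algebra_simps)
  have "(ln \<circ> Gamma) ((1 - t) *\<^sub>R x + t *\<^sub>R 2) \<le> (1 - t) * (ln \<circ> Gamma) x + t * (ln \<circ> Gamma) 2"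
    using t assms by (intro convex_onD[OF log_convex_Gamma_real]) auto
  then have "0 \<le> (1 - t) * ln (Gamma x)" using t3 Gamma_numeral[of "num.Bit0 num.One", where 'a=real] by simp
  then have "0 \<le> ln (Gamma x)" using t(2) by (simp add: zero_le_mult_iff)
  then show ?thesis using Gamma_real_pos[OF assms(1)] by simp
qed

lemma continuous_in_local:
  assumes "\<And>s. s \<in> S \<Longrightarrow> \<exists>T. open T \<and> s \<in> T \<and> continuous_in E (S \<inter> T) u"
  shows "continuous_in E S u"
  unfolding continuous_in_def
proof
  fix s assume s: "s \<in> S"
  then obtain T where T: "open T" "s \<in> T" "continuous_in E (S \<inter> T) u" using assms by blast
  have "at s within S = at s within (S \<inter> T)" using T by (intro at_within_nhd[of s T]) auto
  then show "u s \<in> carr E \<and> ((\<lambda>r. nrm E (u r - u s)) \<longlongrightarrow> 0) (at s within S)"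
    using T s unfolding continuous_in_def by auto
qed

lemma linear_in_diff:
  assumes "scalar_mult K sc" "linear_in K sc E F T" "normed_carrier E" "x \<in> carr E" "y \<in> carr E"
  shows "T (x - y) = T x - T y"
proof -
  interpret normed_carrier E by fact
  have "T (x + - y) = T x + T (- y)"
    using assms(2,4) minus_mem[OF assms(5)] unfolding linear_in_def by blast
  moreover have "T (sc (complex_of_real (- 1)) y) = sc (complex_of_real (- 1)) (T y)"
    using assms(2,5) real_scalar(1)[OF assms(1)] unfolding linear_in_def by blast
  ultimately show ?thesis using real_scalar(2)[OF assms(1), of "-1"] by simp
qed

lemma (in embedded_carrier) closed_subspace_embedded:
  assumes "closed_in E V" "normed_carrier (subsp E V)"
  shows "embedded_carrier (subsp E V)"
proof -
  have "cont_embedded (subsp E V) type_space"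
    using embedded assms(1) unfolding cont_embedded_def closed_in_def by (auto simp: type_space_def)
  then show ?thesis
    using closed_subspace_complete[OF assms] by (simp add: embedded_carrier_def embedded_carrier_axioms_def)
qed

text \<open>A group on a subspace V that extends the semigroup is strongly continuous in the norm of
  \<open>Es 1\<close> also for negative times: near a given time it is the semigroup started far enough in the past.\<close>

lemma (in scale_semigroup) group_continuous:
  assumes V: "V \<subseteq> carr E" and grp: "c0_group K sc (subsp E V) TS"
    and ext: "\<And>t y. t \<ge> 0 \<Longrightarrow> y \<in> V \<Longrightarrow> TS t y = T t y"
    and backwards: "\<And>t y. t \<ge> 0 \<Longrightarrow> y \<in> V \<inter> carr (Es 1) \<Longrightarrow> TS (- t) y \<in> carr (Es 1)"
    and y: "y \<in> V \<inter> carr (Es 1)"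
  shows "continuous_in (Es 1) {..0} (\<lambda>t. TS t y)"
proof (rule continuous_in_local)
  interpret E1: complete_carrier "Es 1" by (rule Es_complete) simp
  fix s :: real assume s: "s \<in> {..0}"
  define n where "n = 1 - s"
  have n: "n > 0" "- n < s" using s by (auto simp: n_def)
  have TSm: "TS t v \<in> V" if "v \<in> V" for t v
    using grp that unfolding c0_group_def bounded_linear_in_def linear_in_def by auto
  have "continuous_in (Es 1) ({..0} \<inter> {- n<..}) (\<lambda>t. T (t + n) (TS (- n) y))"
    by (rule continuous_in_compose[OF T_continuous_1[OF backwards] _ _ E1.normed_carrier_axioms])
      (use n y in \<open>auto intro!: continuous_intros\<close>)
  moreover have "T (t + n) (TS (- n) y) = TS t y" if "t \<in> {..0} \<inter> {- n<..}" for t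
  proof -
    have "TS (t + n + - n) y = TS (t + n) (TS (- n) y)"
      using grp y unfolding c0_group_def by (metis IntD1 carr_subsp)
    moreover have "TS (t + n) (TS (- n) y) = T (t + n) (TS (- n) y)"
      using that y TSm by (intro ext) auto
    ultimately show ?thesis by simp
  qed
  ultimately have "continuous_in (Es 1) ({..0} \<inter> {- n<..}) (\<lambda>t. TS t y)"
    using continuous_in_cong[of "{..0} \<inter> {- n<..}" "\<lambda>t. T (t + n) (TS (- n) y)" "\<lambda>t. TS t y" "Es 1"] by blast
  then show "\<exists>T. open T \<and> s \<in> T \<and> continuous_in (Es 1) ({..0} \<inter> T) (\<lambda>t. TS t y)"
    using n by (intro exI[of _ "{- n<..}"]) auto
qed

theorem proposition5p1:
  fixes K :: "complex set"
    and scX :: "complex \<Rightarrow> 'xe::banach \<Rightarrow> 'xe" and scY :: "complex \<Rightarrow> 'ye::banach \<Rightarrow> 'ye"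
    and X :: "'xe nspace" and Y :: "'ye nspace"
    and A :: "'xe oper" and B :: "'ye oper"
    and TA :: "real \<Rightarrow> 'xe \<Rightarrow> 'xe" and TB :: "real \<Rightarrow> 'ye \<Rightarrow> 'ye"
    and FX :: "real \<Rightarrow> 'xe nspace \<Rightarrow> 'xe nspace \<Rightarrow> 'xe nspace"
    and FY :: "real \<Rightarrow> 'ye nspace \<Rightarrow> 'ye nspace \<Rightarrow> 'ye nspace"
    and Xs :: "real \<Rightarrow> 'xe nspace" and Ys :: "real \<Rightarrow> 'ye nspace" and lam :: complex
    and f :: "'xe \<Rightarrow> 'ye \<Rightarrow> 'xe" and g :: "'xe \<Rightarrow> 'ye \<Rightarrow> 'ye"
    and \<gamma>X \<delta>X \<delta>Y Lf Lg MA MB CA CB \<omega>A \<omega>B \<omega>f :: real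
    and YF YS :: "real \<Rightarrow> 'ye set" and TS :: "real \<Rightarrow> real \<Rightarrow> 'ye \<Rightarrow> 'ye"
    and \<zeta>0 CB' MB' :: real and NF NS :: "real \<Rightarrow> real"
    and \<epsilon> \<zeta> \<eta> :: real and v0 :: 'ye
  defines "prF \<equiv> \<lambda>z. proj (YF z) (YS z)" and "prS \<equiv> \<lambda>z. proj (YS z) (YF z)"
    and "X1 \<equiv> carr (Xs 1)" and "Y1 \<equiv> carr (Ys 1)"
  assumes field: "scalar_mult K scX" "scalar_mult K scY"
    and banach: "banach_space K scX X" "banach_space K scY Y"
    and eps: "\<epsilon> > 0"
    \<comment> \<open>(i)\<close>
    and A_op: "linear_oper K scX X A" "closed_oper X A"
    and A_gen: "c0_semigroup K scX X TA" "exp_stable X TA" "generates (at_right 0) X A TA"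
    and B_op: "linear_oper K scY Y B" "closed_oper Y B"
    and B_gen: "c0_semigroup K scY Y TB" "generates (at_right 0) Y B TB"
    \<comment> \<open>(ii)\<close>
    and X_scale: "interp_extrap_scale K scX X A FX Xs"
    and lam: "lam \<in> resolvent_set K scY Y B" "0 \<in> resolvent_set K scY Y B \<Longrightarrow> lam = 0"
    and Y_scale: "interp_extrap_scale K scY Y (shift_oper scY B lam) FY Ys"
    \<comment> \<open>(iii)\<close>
    and gammaX: "\<gamma>X \<in> {0<..1}" "\<not> holomorphic_semigroup K scX X TA \<Longrightarrow> \<gamma>X = 1"
    and deltaX: "\<delta>X \<in> {1 - \<gamma>X..1}"
    and deltaY: "\<delta>Y \<in> {0<..1}" "\<not> holomorphic_semigroup K scY Y TB \<Longrightarrow> \<delta>Y = 1"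
    \<comment> \<open>(iv)\<close>
    and f_cont: "continuous2_in (Xs \<delta>X) (Ys (1 - \<delta>X)) X f"
    and g_cont: "continuous2_in (Xs 1) (Ys 1) (Ys \<delta>Y) g"
    and fg0: "f 0 0 = 0" "g 0 0 = 0"
    and f_range: "\<And>x y. x \<in> X1 \<Longrightarrow> y \<in> Y1 \<Longrightarrow> f x y \<in> carr (Xs \<gamma>X)"
    and g_range: "\<And>x y. x \<in> X1 \<Longrightarrow> y \<in> Y1 \<Longrightarrow> g x y \<in> carr (Ys \<delta>Y)"
    and f_C1: "\<And>t u v. t > 0 \<Longrightarrow> C1_in (Xs \<delta>X) t u \<Longrightarrow> C1_in Y t v \<Longrightarrow>
          continuous_in (Ys (1 - \<delta>X)) {0..t} v \<Longrightarrow> C1_in (Xs (\<delta>X - 1)) t (\<lambda>s. f (u s) (v s))"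
    and L_pos: "Lf > 0" "Lg > 0"
    and f_Lip: "\<And>x1 x2 y1 y2. x1 \<in> X1 \<Longrightarrow> x2 \<in> X1 \<Longrightarrow> y1 \<in> Y1 \<Longrightarrow> y2 \<in> Y1 \<Longrightarrow>
          nrm (Xs \<gamma>X) (f x1 y1 - f x2 y2) \<le> Lf * (nrm (Xs 1) (x1 - x2) + nrm (Ys 1) (y1 - y2))"
    and f_C1_Lip: "\<And>t u1 u2 v1 v2. t > 0 \<Longrightarrow> C1_in (Xs \<delta>X) t u1 \<Longrightarrow> C1_in (Xs \<delta>X) t u2 \<Longrightarrow>
          C1_in Y t v1 \<Longrightarrow> C1_in Y t v2 \<Longrightarrow>
          continuous_in (Ys (1 - \<delta>X)) {0..t} v1 \<Longrightarrow> continuous_in (Ys (1 - \<delta>X)) {0..t} v2 \<Longrightarrow>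
          C1_norm (Xs (\<delta>X - 1)) t (\<lambda>s. f (u1 s) (v1 s) - f (u2 s) (v2 s))
            \<le> Lf * (C1_norm (Xs \<delta>X) t (\<lambda>s. u1 s - u2 s) + C1_norm Y t (\<lambda>s. v1 s - v2 s))"
    and g_Lip: "\<And>x1 x2 y1 y2. x1 \<in> X1 \<Longrightarrow> x2 \<in> X1 \<Longrightarrow> y1 \<in> Y1 \<Longrightarrow> y2 \<in> Y1 \<Longrightarrow>
          nrm (Ys \<delta>Y) (g x1 y1 - g x2 y2) \<le> Lg * (nrm (Xs 1) (x1 - x2) + nrm (Ys 1) (y1 - y2))"
    \<comment> \<open>(v)\<close>
    and ABC_pos: "MA > 0" "MB > 0" "CA > 0" "CB > 0" "\<omega>A < 0"
    and TA_11: "\<And>t. t > 0 \<Longrightarrow> op_bound (Xs 1) (Xs 1) (TA t) (MA * exp (\<omega>A * t))"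
    and TA_gamma: "\<And>t. t > 0 \<Longrightarrow>
          op_bound (Xs \<gamma>X) (Xs 1) (TA t) (CA * t powr (\<gamma>X - 1) * exp (\<omega>A * t))"
    and TA_delta: "\<And>t. t > 0 \<Longrightarrow>
          op_bound (Xs \<delta>X) (Xs 1) (TA t) (CA * t powr (\<delta>X - 1) * exp (\<omega>A * t))"
    and TB_11: "\<And>t. t > 0 \<Longrightarrow> op_bound (Ys 1) (Ys 1) (TB t) (MB * exp (\<omega>B * t))"
    and TB_delta: "\<And>t. t > 0 \<Longrightarrow>
          op_bound (Ys \<delta>Y) (Ys 1) (TB t) (CB * t powr (\<delta>Y - 1) * exp (\<omega>B * t))"
    \<comment> \<open>(vi)\<close>
    and omega_f: "\<gamma>X < 1 \<Longrightarrow> \<omega>f = \<omega>A + (2 * CA * Lf) powr (1 / \<gamma>X) *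
            (1 / \<gamma>X) powr ((1 - \<gamma>X) / \<gamma>X)"
          "\<gamma>X = 1 \<Longrightarrow> \<omega>f > \<omega>A + CA * Lf"
          "\<omega>f < 0"
    and Lf_small: "Lf * max (op_norm (Xs \<gamma>X) (Xs 1) (oinv A))
            (op_norm (Xs (\<delta>X - 1)) (Xs \<delta>X) (ext_inv A)) < 1"
    \<comment> \<open>splitting of the slow variable space, (1) to (6), for all small z\<close>
    and zeta0: "\<zeta>0 > 0"
    and split: "\<And>z. z \<in> {0<..\<zeta>0} \<Longrightarrow> direct_sum K scY Y (YF z) (YS z)"
    and split_closed: "\<And>z. z \<in> {0<..\<zeta>0} \<Longrightarrow> closed_in Y (YF z) \<and> closed_in Y (YS z)"
    and pr_commute: "\<And>z y. z \<in> {0<..\<zeta>0} \<Longrightarrow> y \<in> Y1 \<Longrightarrow>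
          prF z y \<in> Y1 \<and> oap B (prF z y) = prF z (oap B y) \<and>
          prS z y \<in> Y1 \<and> oap B (prS z y) = prS z (oap B y)"
    and split1_closed: "\<And>z. z \<in> {0<..\<zeta>0} \<Longrightarrow>
          closed_in (Ys 1) (YF z \<inter> Y1) \<and> closed_in (Ys 1) (YS z \<inter> Y1)"
    and prS_g: "\<And>z x x' yF yF' yS yS'. z \<in> {0<..\<zeta>0} \<Longrightarrow> x \<in> X1 \<Longrightarrow> x' \<in> X1 \<Longrightarrow>
          yF \<in> YF z \<inter> Y1 \<Longrightarrow> yF' \<in> YF z \<inter> Y1 \<Longrightarrow> yS \<in> YS z \<inter> Y1 \<Longrightarrow> yS' \<in> YS z \<inter> Y1 \<Longrightarrow>
          prS z (g x (yF + yS) - g x' (yF' + yS')) \<in> Y1 \<and>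
          nrm (Ys 1) (prS z (g x (yF + yS) - g x' (yF' + yS')))
            \<le> Lg * z powr (\<delta>Y - 1) *
              (nrm (Xs 1) (x - x') + nrm (Ys 1) (yF - yF') + nrm (Ys 1) (yS - yS'))"
    and TS_group: "\<And>z. z \<in> {0<..\<zeta>0} \<Longrightarrow> c0_group K scY (subsp Y (YS z)) (TS z) \<and>
          generates (at 0) (subsp Y (YS z)) (realization B (YS z)) (TS z) \<and>
          (\<forall>t\<ge>0. \<forall>y\<in>YS z. TS z t y = TB t y)"
    and BF_resolvent: "\<And>z. z \<in> {0<..\<zeta>0} \<Longrightarrow>
          0 \<in> resolvent_set K scY (subsp Y (YF z)) (realization B (YF z))"
    and CB'_MB'_pos: "CB' > 0" "MB' > 0"
    and NF_NS: "\<And>z. z \<in> {0<..\<zeta>0} \<Longrightarrow> 0 \<le> NF z \<and> NF z < NS z"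
    and TB_F: "\<And>z t. z \<in> {0<..\<zeta>0} \<Longrightarrow> t > 0 \<Longrightarrow>
          op_bound (subsp (Ys \<delta>Y) (YF z \<inter> carr (Ys \<delta>Y))) (Ys 1) (TB t)
            (CB' * t powr (\<delta>Y - 1) * exp ((NF z + \<omega>A / z) * t))"
    and TB_S: "\<And>z t. z \<in> {0<..\<zeta>0} \<Longrightarrow> t \<ge> 0 \<Longrightarrow>
          op_bound (subsp (Ys 1) (YS z \<inter> Y1)) (Ys 1) (TS z (- t))
            (MB' * exp (- (NS z + \<omega>A / z) * t))"
    \<comment> \<open>(7)\<close>
    and zeta: "\<zeta> \<in> {0<..\<zeta>0}"
    and base_pos: "2 * (\<epsilon> / \<zeta> - 1) * \<omega>A + \<epsilon> * (NS \<zeta> + NF \<zeta>) > 0"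
    and gap: "2 powr \<gamma>X * Lf * CA * Gamma \<gamma>X /
            (2 * (\<epsilon> / \<zeta> - 1) * \<omega>A + \<epsilon> * (NS \<zeta> + NF \<zeta>)) powr \<gamma>X
          + 2 powr \<delta>Y * Lg * CB' * Gamma \<delta>Y / (NS \<zeta> - NF \<zeta>) powr \<delta>Y
          + 2 * \<zeta> powr (\<delta>Y - 1) * Lg * MB' * Gamma \<delta>Y / (NS \<zeta> - NF \<zeta>) < 1"
    \<comment> \<open>the counterpart of (3) for the other projection: Lg also bounds its composition with g\<close>
    and prF_g: "\<And>x x' yF yF' yS yS'. x \<in> X1 \<Longrightarrow> x' \<in> X1 \<Longrightarrow>
          yF \<in> YF \<zeta> \<inter> Y1 \<Longrightarrow> yF' \<in> YF \<zeta> \<inter> Y1 \<Longrightarrow> yS \<in> YS \<zeta> \<inter> Y1 \<Longrightarrow> yS' \<in> YS \<zeta> \<inter> Y1 \<Longrightarrow>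
          prF \<zeta> (g x (yF + yS) - g x' (yF' + yS')) \<in> carr (Ys \<delta>Y) \<and>
          nrm (Ys \<delta>Y) (prF \<zeta> (g x (yF + yS) - g x' (yF' + yS')))
            \<le> Lg * (nrm (Xs 1) (x - x') + nrm (Ys 1) (yF - yF') + nrm (Ys 1) (yS - yS'))"
    and eta: "\<eta> = \<omega>A / \<zeta> + (NS \<zeta> + NF \<zeta>) / 2"
    and v0: "v0 \<in> YS \<zeta> \<inter> Y1"
  defines "Ceta \<equiv> C_eta \<eta> (Xs 1) (subsp (Ys 1) (YF \<zeta> \<inter> Y1)) (subsp (Ys 1) (YS \<zeta> \<inter> Y1))"
    and "L \<equiv> LP_operator \<epsilon> TA TB (TS \<zeta>) (prF \<zeta>) (prS \<zeta>) f g v0"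
  shows "(\<forall>w\<in>Ceta. \<forall>t\<le>0.
            abs_integrable_in (Xs 1) (fast_integrand \<epsilon> TA f w t) {..t} \<and>
            abs_integrable_in (Ys 1) (slow_integrand TB (prF \<zeta>) g w t) {..t} \<and>
            abs_integrable_in (Ys 1) (slow_integrand (TS \<zeta>) (prS \<zeta>) g w t) {t..0})
       \<and> L \<in> Ceta \<rightarrow> Ceta
       \<and> (\<exists>!w. w \<in> Ceta \<and> L w = w)"
proof -
  have K0: "0 \<in> K" using real_scalar(1)[OF field(1), of 0] by simp
  have lamK: "lam \<in> K" using lam(1) unfolding resolvent_set_def by simp
  have \<epsilon>: "\<epsilon> > 0" and \<zeta>: "\<zeta> > 0" using eps zeta by auto
  have \<gamma>: "0 < \<gamma>X" "\<gamma>X \<le> 1" and \<delta>: "0 < \<delta>Y" "\<delta>Y \<le> 1" using gammaX(1) deltaY(1) by auto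
  have N: "NF \<zeta> < NS \<zeta>" using NF_NS[OF zeta] by simp
  interpret X: scale_semigroup K scX X A TA 0 FX Xs MA \<omega>A
    using field(1) banach(1) A_op(1) K0 A_gen(1,3) X_scale ABC_pos(1) TA_11
    by (intro scale_semigroup.intro) (simp_all only: shift_oper_zero[OF field(1)])
  have Ysg: "scale_semigroup K scY Y B TB lam FY Ys MB \<omega>B"
    using field(2) banach(2) B_op(1) lamK B_gen Y_scale ABC_pos(2) TB_11
    by (intro scale_semigroup.intro)
  interpret Y: reducing_pair K scY Y B TB lam FY Ys MB \<omega>B "YF \<zeta>" "YS \<zeta>"
  proof (rule reducing_pair.intro[OF Ysg reducing_pair_axioms.intro])
    show "direct_sum K scY Y (YF \<zeta>) (YS \<zeta>)" by (rule split[OF zeta])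
    show "closed_in Y (YF \<zeta>)" "closed_in Y (YS \<zeta>)" using split_closed[OF zeta] by auto
    fix y assume "y \<in> odom B"
    then show "proj (YF \<zeta>) (YS \<zeta>) y \<in> odom B \<and> proj (YS \<zeta>) (YF \<zeta>) y \<in> odom B \<and>
        oap B (proj (YS \<zeta>) (YF \<zeta>) y) = proj (YS \<zeta>) (YF \<zeta>) (oap B y)"
      using pr_commute[OF zeta, of y] scale_semigroup.carr_1[OF Ysg]
      by (simp add: Y1_def prF_def prS_def)
  qed
  interpret X1: embedded_carrier "Xs 1" by (rule X.E1_embedded)
  interpret Y1: embedded_carrier "Ys 1" by (rule Y.E1_embedded)
  interpret X\<gamma>: complete_carrier "Xs \<gamma>X" by (rule X.Es_complete) (use \<gamma> in simp)
  interpret Y\<delta>: complete_carrier "Ys \<delta>Y" by (rule Y.Es_complete) (use \<delta> in simp)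

  define F where "F = subsp (Ys 1) (YF \<zeta> \<inter> Y1)"
  define H where "H = subsp (Ys 1) (YS \<zeta> \<inter> Y1)"
  define DF where "DF = subsp (Ys \<delta>Y) (YF \<zeta> \<inter> carr (Ys \<delta>Y))"
  have carrF: "carr F = YF \<zeta> \<inter> Y1" "nrm F = nrm (Ys 1)" and carrH: "carr H = YS \<zeta> \<inter> Y1" "nrm H = nrm (Ys 1)"
    and carrDF: "carr DF = YF \<zeta> \<inter> carr (Ys \<delta>Y)" "nrm DF = nrm (Ys \<delta>Y)"
    by (simp_all add: F_def H_def DF_def)
  have normed: "normed_carrier F" "normed_carrier H" "normed_carrier DF"
    unfolding F_def H_def DF_def Y1_def
    by (intro Y1.subspace_carrier Y\<delta>.subspace_carrier;
        auto intro: Y.sub_add Y.sub_scaleR Y.sub_zero)+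
  interpret F: embedded_carrier F
    using Y1.closed_subspace_embedded normed(1) split1_closed[OF zeta] unfolding F_def by blast
  interpret H: embedded_carrier H
    using Y1.closed_subspace_embedded normed(2) split1_closed[OF zeta] unfolding H_def by blast
  interpret DF: normed_carrier DF by (rule normed(3))
  define P where "P = prod_space (Xs 1) F H"
  interpret P: complete_carrier P
    unfolding P_def by (rule prod_space_complete) unfold_locales
  have P_mem: "u \<in> X1 \<and> vF \<in> YF \<zeta> \<inter> Y1 \<and> vS \<in> YS \<zeta> \<inter> Y1 \<and> vF + vS \<in> Y1" if "(u, vF, vS) \<in> carr P" for u vF vS
    using that Y1.add_mem[of vF vS] by (auto simp: P_def carr_prod_space carrF carrH X1_def Y1_def)
  have P_nrm: "nrm P (u, vF, vS) = nrm (Xs 1) u + nrm (Ys 1) vF + nrm (Ys 1) vS" for u vF vS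
    by (simp add: P_def nrm_prod_space carrF carrH)

  define N1 where "N1 = (\<lambda>(u, vF, vS). f u (vF + vS))"
  define N2 where "N2 = (\<lambda>(u, vF, vS). prF \<zeta> (g u (vF + vS)))"
  define N3 where "N3 = (\<lambda>(u, vF, vS). prS \<zeta> (g u (vF + vS)))"
  define U1 where "U1 \<sigma> = TA (\<sigma> / \<epsilon>)" for \<sigma>
  define U3 where "U3 \<sigma> = TS \<zeta> (- \<sigma>)" for \<sigma>

  have g_mem: "g u (vF + vS) \<in> carr Y" if "(u, vF, vS) \<in> carr P" for u vF vS
    using g_range[of u "vF + vS"] P_mem[OF that] Y.Es_subset[of \<delta>Y] \<delta> by auto
  have zero_X1: "0 \<in> X1" and zero_F: "0 \<in> YF \<zeta> \<inter> Y1" and zero_S: "0 \<in> YS \<zeta> \<inter> Y1"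
    using X1.zero_mem F.zero_mem H.zero_mem by (simp_all add: X1_def carrF carrH)

  have TS_mem: "TS \<zeta> t y \<in> YS \<zeta>" if "y \<in> YS \<zeta>" for t y
    using TS_group[OF zeta] that unfolding c0_group_def bounded_linear_in_def linear_in_def by auto
  have TS_back: "TS \<zeta> (- t) y \<in> carr (Ys 1)" if "t \<ge> 0" "y \<in> YS \<zeta> \<inter> carr (Ys 1)" for t y
    using TB_S[OF zeta that(1)] that(2) unfolding op_bound_def by (auto simp: Y1_def)
  have TS_cont: "continuous_in (Ys 1) {..0} (\<lambda>t. TS \<zeta> t y)" if "y \<in> YS \<zeta> \<inter> carr (Ys 1)" for y
    by (rule Y.group_continuous[where V="YS \<zeta>"]) (use TS_group[OF zeta] TS_back that Y.sub(2) in auto)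

  (* rescaling time by eps turns the constant CA into CA * eps powr (1 - gammaX) *)
  have S1: "smoothing_family (Xs 1) (Xs \<gamma>X) U1 (CA * \<epsilon> powr (1 - \<gamma>X)) \<gamma>X (\<omega>A / \<epsilon>)"
  proof (intro smoothing_family.intro smoothing_family_axioms.intro)
    show "embedded_carrier (Xs 1)" "normed_carrier (Xs \<gamma>X)" by unfold_locales
    show "\<gamma>X > 0" "0 \<le> CA * \<epsilon> powr (1 - \<gamma>X)" using \<gamma> ABC_pos by auto
    have sub: "carr (Xs \<gamma>X) \<subseteq> carr X" using X.Es_subset[of \<gamma>X] \<gamma> by auto
    fix \<sigma> :: real and p assume \<sigma>: "\<sigma> > 0" and p: "p \<in> carr (Xs \<gamma>X)"
    have "\<sigma> / \<epsilon> > 0" using \<sigma> \<epsilon> by simp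
    from TA_gamma[OF this] p
    have *: "TA (\<sigma> / \<epsilon>) p \<in> carr (Xs 1)" "nrm (Xs 1) (TA (\<sigma> / \<epsilon>) p)
        \<le> CA * (\<sigma> / \<epsilon>) powr (\<gamma>X - 1) * exp (\<omega>A * (\<sigma> / \<epsilon>)) * nrm (Xs \<gamma>X) p"
      unfolding op_bound_def by auto
    then show "U1 \<sigma> p \<in> carr (Xs 1)" by (simp add: U1_def)
    have "(\<sigma> / \<epsilon>) powr (\<gamma>X - 1) = \<epsilon> powr (1 - \<gamma>X) * \<sigma> powr (\<gamma>X - 1)"
      using \<sigma> \<epsilon> powr_minus_divide[of \<epsilon> "\<gamma>X - 1"] by (simp add: powr_divide)
    then show "nrm (Xs 1) (U1 \<sigma> p) \<le> CA * \<epsilon> powr (1 - \<gamma>X) * \<sigma> powr (\<gamma>X - 1) * exp (\<omega>A / \<epsilon> * \<sigma>) * nrm (Xs \<gamma>X) p"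
      using *(2) by (simp add: U1_def mult.assoc)
    show "U1 \<sigma> (p - q) = U1 \<sigma> p - U1 \<sigma> q" if "q \<in> carr (Xs \<gamma>X)" for q
      unfolding U1_def using \<sigma> \<epsilon> p that sub by (intro X.T_diff) auto
  next
    fix p assume p: "p \<in> carr (Xs \<gamma>X)"
    have pX: "p \<in> carr X" using p X.Es_subset[of \<gamma>X] \<gamma> by auto
    have m: "TA \<tau> p \<in> carr (Xs 1)" if "\<tau> > 0" for \<tau>
      using TA_gamma[OF that] p unfolding op_bound_def by auto
    show "continuous_in (Xs 1) {0<..} (\<lambda>\<sigma>. U1 \<sigma> p)"
      unfolding U1_def
      by (rule continuous_in_compose[OF X.T_continuous_smoothing[OF pX m] _ _ X1.normed_carrier_axioms])
        (use \<epsilon> in \<open>auto intro!: continuous_intros\<close>)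
  qed
  have S2: "smoothing_family F DF TB CB' \<delta>Y (NF \<zeta> + \<omega>A / \<zeta>)"
  proof (intro smoothing_family.intro smoothing_family_axioms.intro)
    show "embedded_carrier F" "normed_carrier DF" by unfold_locales
    show "\<delta>Y > 0" "0 \<le> CB'" using \<delta> CB'_MB'_pos by auto
    fix \<sigma> :: real and p assume \<sigma>: "\<sigma> > 0" and p: "p \<in> carr DF"
    have *: "TB \<sigma> p \<in> carr (Ys 1)" "nrm (Ys 1) (TB \<sigma> p)
        \<le> CB' * \<sigma> powr (\<delta>Y - 1) * exp ((NF \<zeta> + \<omega>A / \<zeta>) * \<sigma>) * nrm (Ys \<delta>Y) p"
      using TB_F[OF zeta \<sigma>] p unfolding op_bound_def by (auto simp: carrDF)
    have pF: "p \<in> YF \<zeta>" using p by (simp add: carrDF)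
    show "TB \<sigma> p \<in> carr F"
      using *(1) Y.T_invariant[OF less_imp_le[OF \<sigma>] pF] by (simp add: carrF Y1_def)
    show "nrm F (TB \<sigma> p) \<le> CB' * \<sigma> powr (\<delta>Y - 1) * exp ((NF \<zeta> + \<omega>A / \<zeta>) * \<sigma>) * nrm DF p"
      using *(2) by (simp add: carrF carrDF)
    show "TB \<sigma> (p - q) = TB \<sigma> p - TB \<sigma> q" if "q \<in> carr DF" for q
      using \<sigma> pF that Y.sub(1) by (intro Y.T_diff) (auto simp: carrDF)
  next
    fix p assume p: "p \<in> carr DF"
    have pF: "p \<in> YF \<zeta>" using p by (simp add: carrDF)
    have m: "TB \<tau> p \<in> carr (Ys 1)" if "\<tau> > 0" for \<tau>
      using TB_F[OF zeta that] p unfolding op_bound_def by (auto simp: carrDF)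
    have "continuous_in (Ys 1) {0<..} (\<lambda>\<sigma>. TB \<sigma> p)"
      using pF Y.sub(1) by (intro Y.T_continuous_smoothing m) auto
    then show "continuous_in F {0<..} (\<lambda>\<sigma>. TB \<sigma> p)"
      unfolding F_def using m Y.T_invariant[OF _ pF]
      by (subst continuous_in_subsp) (auto simp: Y1_def)
  qed
  have S3: "smoothing_family H H U3 MB' 1 (- (NS \<zeta> + \<omega>A / \<zeta>))"
  proof (intro smoothing_family.intro smoothing_family_axioms.intro)
    show "embedded_carrier H" "normed_carrier H" by unfold_locales
    show "(0::real) < 1" "0 \<le> MB'" using CB'_MB'_pos by auto
    fix \<sigma> :: real and p assume \<sigma>: "\<sigma> > 0" and p: "p \<in> carr H"
    have *: "TS \<zeta> (- \<sigma>) p \<in> carr (Ys 1)" "nrm (Ys 1) (TS \<zeta> (- \<sigma>) p)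
        \<le> MB' * exp (- (NS \<zeta> + \<omega>A / \<zeta>) * \<sigma>) * nrm (Ys 1) p"
      using TB_S[OF zeta less_imp_le[OF \<sigma>]] p unfolding op_bound_def by (auto simp: carrH)
    show "U3 \<sigma> p \<in> carr H" using *(1) p TS_mem by (auto simp: carrH Y1_def U3_def)
    show "nrm H (U3 \<sigma> p) \<le> MB' * \<sigma> powr (1 - 1) * exp (- (NS \<zeta> + \<omega>A / \<zeta>) * \<sigma>) * nrm H p"
      using *(2) \<sigma> by (simp add: carrH U3_def)
    have lin: "linear_in K scY (subsp Y (YS \<zeta>)) (subsp Y (YS \<zeta>)) (TS \<zeta> (- \<sigma>))"
      using TS_group[OF zeta] unfolding c0_group_def bounded_linear_in_def by auto
    have "normed_carrier (subsp Y (YS \<zeta>))"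
      by (intro Y.E.subspace_carrier Y.sub) (auto intro: Y.sub_add Y.sub_scaleR Y.sub_zero)
    from linear_in_diff[OF field(2) lin this, of p]
    show "U3 \<sigma> (p - q) = U3 \<sigma> p - U3 \<sigma> q" if "q \<in> carr H" for q
      using p that by (simp add: carrH U3_def)
  next
    fix p assume p: "p \<in> carr H"
    have "continuous_in (Ys 1) {0<..} (\<lambda>\<sigma>. TS \<zeta> (- \<sigma>) p)"
      by (rule continuous_in_compose[OF TS_cont _ _ Y1.normed_carrier_axioms])
        (use p in \<open>auto intro!: continuous_intros simp: carrH Y1_def\<close>)
    then show "continuous_in H {0<..} (\<lambda>\<sigma>. U3 \<sigma> p)"
      unfolding H_def U3_def using p TS_mem TS_back
      by (subst continuous_in_subsp) (auto simp: Y1_def carrH)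
  qed

  (* in each component the rate of the integrand in sigma is negative *)
  have d1: "\<omega>A / \<epsilon> + - 1 * \<eta> < 0"
    and base: "2 * (\<epsilon> / \<zeta> - 1) * \<omega>A + \<epsilon> * (NS \<zeta> + NF \<zeta>) = 2 * \<epsilon> * (- (\<omega>A / \<epsilon> + - 1 * \<eta>))"
  proof -
    show base: "2 * (\<epsilon> / \<zeta> - 1) * \<omega>A + \<epsilon> * (NS \<zeta> + NF \<zeta>) = 2 * \<epsilon> * (- (\<omega>A / \<epsilon> + - 1 * \<eta>))"
      using \<epsilon> by (simp add: eta field_simps)
    show "\<omega>A / \<epsilon> + - 1 * \<eta> < 0"
      using base_pos \<epsilon> unfolding base by (simp add: zero_less_mult_iff)
  qed
  have d2: "- (NF \<zeta> + \<omega>A / \<zeta> + - 1 * \<eta>) = (NS \<zeta> - NF \<zeta>) / 2"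
    and d3: "- (- (NS \<zeta> + \<omega>A / \<zeta>) + 1 * \<eta>) = (NS \<zeta> - NF \<zeta>) / 2"
    by (simp_all add: eta field_simps)

  have c1: "lp_component (Xs 1) (Xs \<gamma>X) U1 (CA * \<epsilon> powr (1 - \<gamma>X)) \<gamma>X (\<omega>A / \<epsilon>) P N1 Lf \<eta> (- 1)"
  proof (intro lp_component.intro S1 lp_component_axioms.intro)
    show "normed_carrier P" by unfold_locales
    fix x assume "x \<in> carr P"
    then show "N1 x \<in> carr (Xs \<gamma>X)"
      by (cases x) (auto simp: N1_def intro!: f_range dest: P_mem)
  next
    fix x y assume xy: "x \<in> carr P" "y \<in> carr P"
    obtain u vF vS u' vF' vS' where eq: "x = (u, vF, vS)" "y = (u', vF', vS')" by (metis prod_cases3)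
    note m = P_mem[OF xy(1)[unfolded eq]] P_mem[OF xy(2)[unfolded eq]]
    have "nrm (Xs \<gamma>X) (f u (vF + vS) - f u' (vF' + vS'))
        \<le> Lf * (nrm (Xs 1) (u - u') + nrm (Ys 1) (vF + vS - (vF' + vS')))"
      using m by (intro f_Lip) auto
    also have "\<dots> \<le> Lf * nrm P (x - y)"
    proof (rule mult_left_mono)
      have "nrm (Ys 1) ((vF - vF') + (vS - vS')) \<le> nrm (Ys 1) (vF - vF') + nrm (Ys 1) (vS - vS')"
        using m by (intro Y1.nrm_add Y1.diff_mem) (auto simp: Y1_def)
      then show "nrm (Xs 1) (u - u') + nrm (Ys 1) (vF + vS - (vF' + vS')) \<le> nrm P (x - y)"
        by (simp add: eq P_nrm algebra_simps)
    qed (use L_pos in simp)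
    finally show "nrm (Xs \<gamma>X) (N1 x - N1 y) \<le> Lf * nrm P (x - y)" by (simp add: N1_def eq)
  qed (use d1 L_pos fg0 in \<open>auto simp: N1_def zero_prod_def\<close>)

  have c2: "lp_component F DF TB CB' \<delta>Y (NF \<zeta> + \<omega>A / \<zeta>) P N2 Lg \<eta> (- 1)"
  proof (intro lp_component.intro S2 lp_component_axioms.intro)
    show "normed_carrier P" by unfold_locales
    fix x assume x: "x \<in> carr P"
    obtain u vF vS where eq: "x = (u, vF, vS)" by (metis prod_cases3)
    note m = P_mem[OF x[unfolded eq]]
    have "prF \<zeta> (g u (vF + vS) - g 0 (0 + 0)) \<in> carr (Ys \<delta>Y)"
      using prF_g[of u 0 vF 0 vS 0] m zero_X1 zero_F zero_S by blast
    then show "N2 x \<in> carr DF"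
      using Y.decompose(1)[OF g_mem[OF x[unfolded eq]]] fg0(2) by (simp add: N2_def eq carrDF prF_def)
  next
    fix x y assume xy: "x \<in> carr P" "y \<in> carr P"
    obtain u vF vS u' vF' vS' where eq: "x = (u, vF, vS)" "y = (u', vF', vS')" by (metis prod_cases3)
    note m = P_mem[OF xy(1)[unfolded eq]] P_mem[OF xy(2)[unfolded eq]]
    have "prF \<zeta> (g u (vF + vS) - g u' (vF' + vS')) = N2 x - N2 y"
      using Y.proj_diff(1)[OF g_mem g_mem, OF xy[unfolded eq]] by (simp add: N2_def eq prF_def)
    then show "nrm DF (N2 x - N2 y) \<le> Lg * nrm P (x - y)"
      using prF_g[of u u' vF vF' vS vS'] m by (simp add: eq P_nrm carrDF)
  next
    show "NF \<zeta> + \<omega>A / \<zeta> + - 1 * \<eta> < 0" unfolding neg_0_less_iff_less[symmetric] d2 using N by simp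
    show "N2 0 = 0" using Y.proj_of_V(1)[of 0] zero_F fg0 by (simp add: N2_def zero_prod_def prF_def)
  qed (use L_pos in auto)

  have c3: "lp_component H H U3 MB' 1 (- (NS \<zeta> + \<omega>A / \<zeta>)) P N3 (Lg * \<zeta> powr (\<delta>Y - 1)) \<eta> 1"
  proof (intro lp_component.intro S3 lp_component_axioms.intro)
    show "normed_carrier P" by unfold_locales
    fix x assume x: "x \<in> carr P"
    obtain u vF vS where eq: "x = (u, vF, vS)" by (metis prod_cases3)
    note m = P_mem[OF x[unfolded eq]]
    have "prS \<zeta> (g u (vF + vS) - g 0 (0 + 0)) \<in> Y1"
      using prS_g[OF zeta, of u 0 vF 0 vS 0] m zero_X1 zero_F zero_S by blast
    then show "N3 x \<in> carr H"
      using Y.decompose(2)[OF g_mem[OF x[unfolded eq]]] fg0(2) by (simp add: N3_def eq carrH prS_def)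
  next
    fix x y assume xy: "x \<in> carr P" "y \<in> carr P"
    obtain u vF vS u' vF' vS' where eq: "x = (u, vF, vS)" "y = (u', vF', vS')" by (metis prod_cases3)
    note m = P_mem[OF xy(1)[unfolded eq]] P_mem[OF xy(2)[unfolded eq]]
    have "prS \<zeta> (g u (vF + vS) - g u' (vF' + vS')) = N3 x - N3 y"
      using Y.proj_diff(2)[OF g_mem g_mem, OF xy[unfolded eq]] by (simp add: N3_def eq prS_def)
    then show "nrm H (N3 x - N3 y) \<le> Lg * \<zeta> powr (\<delta>Y - 1) * nrm P (x - y)"
      using prS_g[OF zeta, of u u' vF vF' vS vS'] m by (simp add: eq P_nrm carrH)
  next
    show "- (NS \<zeta> + \<omega>A / \<zeta>) + 1 * \<eta> < 0" unfolding neg_0_less_iff_less[symmetric] d3 using N by simp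
    show "N3 0 = 0" using Y.proj_of_V(2)[of 0] zero_F fg0 by (simp add: N3_def zero_prod_def prS_def)
  qed (use L_pos in auto)

  define gain1 where "gain1 = CA * \<epsilon> powr (1 - \<gamma>X) * Gamma \<gamma>X / (- (\<omega>A / \<epsilon> + - 1 * \<eta>)) powr \<gamma>X * Lf"
  define gain2 where "gain2 = CB' * Gamma \<delta>Y / (- (NF \<zeta> + \<omega>A / \<zeta> + - 1 * \<eta>)) powr \<delta>Y * Lg"
  define gain3 where "gain3 = MB' * Gamma 1 / (- (- (NS \<zeta> + \<omega>A / \<zeta>) + 1 * \<eta>)) powr 1 * (Lg * \<zeta> powr (\<delta>Y - 1))"
  (* the three terms of the gap condition, the last one only up to an inequality *)
  have "1 / \<epsilon> * gain1 = 2 powr \<gamma>X * Lf * CA * Gamma \<gamma>X /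
      (2 * (\<epsilon> / \<zeta> - 1) * \<omega>A + \<epsilon> * (NS \<zeta> + NF \<zeta>)) powr \<gamma>X"
  proof -
    define r where "r = - (\<omega>A / \<epsilon> + - 1 * \<eta>)"
    have r: "r > 0" using d1 by (simp add: r_def)
    have "(2 * \<epsilon> * r) powr \<gamma>X = 2 powr \<gamma>X * \<epsilon> powr \<gamma>X * r powr \<gamma>X"
      using \<epsilon> r by (simp add: powr_mult)
    moreover have "\<epsilon> powr (1 - \<gamma>X) = \<epsilon> / \<epsilon> powr \<gamma>X" using \<epsilon> by (simp add: powr_diff)
    ultimately show ?thesis
      unfolding base gain1_def r_def[symmetric] using \<epsilon> r by (simp add: field_simps)
  qed
  moreover have "gain2 = 2 powr \<delta>Y * Lg * CB' * Gamma \<delta>Y / (NS \<zeta> - NF \<zeta>) powr \<delta>Y"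
    unfolding gain2_def d2 using N by (simp add: powr_divide)
  moreover have "gain3 \<le> 2 * \<zeta> powr (\<delta>Y - 1) * Lg * MB' * Gamma \<delta>Y / (NS \<zeta> - NF \<zeta>)"
  proof -
    have "gain3 = 2 * \<zeta> powr (\<delta>Y - 1) * Lg * MB' / (NS \<zeta> - NF \<zeta>) * 1"
      unfolding gain3_def d3 using N by (simp add: powr_one)
    also have "\<dots> \<le> 2 * \<zeta> powr (\<delta>Y - 1) * Lg * MB' / (NS \<zeta> - NF \<zeta>) * Gamma \<delta>Y"
      using N L_pos CB'_MB'_pos Gamma_ge_1[OF \<delta>] by (intro mult_left_mono) auto
    finally show ?thesis by simp
  qed
  ultimately have gain: "1 / \<epsilon> * gain1 + gain2 + gain3 < 1" using gap by linarith

  (* the free evolution of v0 decays at least as fast as the weight, because NS exceeds the mean of NF and NS *)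
  have h_cont: "continuous_in H {..0} (\<lambda>t. TS \<zeta> t v0)"
    unfolding H_def using TS_cont[of v0] v0 TS_mem TS_back[of "- t" v0 for t]
    by (subst continuous_in_subsp) (auto simp: Y1_def)
  have h_bound: "nrm H (TS \<zeta> t v0) \<le> MB' * nrm (Ys 1) v0 * exp (\<eta> * t)" if "t \<le> 0" for t
  proof -
    have v0m: "0 \<le> nrm (Ys 1) v0" using v0 by (simp add: Y1_def)
    have "nrm (Ys 1) (TS \<zeta> (- (- t)) v0) \<le> MB' * exp (- (NS \<zeta> + \<omega>A / \<zeta>) * (- t)) * nrm (Ys 1) v0"
      using TB_S[OF zeta, of "- t"] that v0 unfolding op_bound_def by auto
    also have "\<dots> \<le> MB' * exp (\<eta> * t) * nrm (Ys 1) v0"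
    proof (intro mult_right_mono mult_left_mono v0m)
      have "\<eta> \<le> NS \<zeta> + \<omega>A / \<zeta>" using N by (simp add: eta)
      then have "(NS \<zeta> + \<omega>A / \<zeta>) * t \<le> \<eta> * t" using that by (intro mult_right_mono_neg)
      then show "exp (- (NS \<zeta> + \<omega>A / \<zeta>) * (- t)) \<le> exp (\<eta> * t)" by (simp add: algebra_simps)
    qed (use CB'_MB'_pos in simp)
    finally show ?thesis by (simp add: carrH mult_ac)
  qed

  interpret lp: lp_system "Xs 1" "Xs \<gamma>X" F H DF H U1 "CA * \<epsilon> powr (1 - \<gamma>X)" \<gamma>X "\<omega>A / \<epsilon>"
    TB CB' \<delta>Y "NF \<zeta> + \<omega>A / \<zeta>" U3 MB' 1 "- (NS \<zeta> + \<omega>A / \<zeta>)" N1 Lf "- 1" N2 Lg "- 1"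
    N3 "Lg * \<zeta> powr (\<delta>Y - 1)" 1 \<eta> "1 / \<epsilon>" "\<lambda>t. TS \<zeta> t v0" "MB' * nrm (Ys 1) v0"
    by (intro lp_system.intro lp_system_axioms.intro c1[unfolded P_def] c2[unfolded P_def] c3[unfolded P_def]
        h_cont h_bound gain[unfolded gain1_def gain2_def gain3_def] X1.complete_carrier_axioms
        F.complete_carrier_axioms H.complete_carrier_axioms) (use \<epsilon> in auto)

  have Ceta: "Ceta = weighted_paths \<eta> P"
    unfolding Ceta_def P_def F_def[symmetric] H_def[symmetric]
    by (rule C_eta_eq) unfold_locales
  have fast: "fast_integrand \<epsilon> TA f w t = (\<lambda>s. U1 (t - s) (N1 (w s)))" for w t
    by (simp add: fun_eq_iff fast_integrand_def U1_def N1_def)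
  have slowF: "slow_integrand TB (prF \<zeta>) g w t = (\<lambda>s. TB (t - s) (N2 (w s)))" for w t
    by (simp add: fun_eq_iff slow_integrand_def N2_def split: prod.split)
  have slowS: "slow_integrand (TS \<zeta>) (prS \<zeta>) g w t = (\<lambda>s. U3 (s - t) (N3 (w s)))" for w t
    by (simp add: fun_eq_iff slow_integrand_def N3_def U3_def split: prod.split)

  have int: "abs_integrable_in (Xs 1) (fast_integrand \<epsilon> TA f w t) {..t} \<and>
      abs_integrable_in (Ys 1) (slow_integrand TB (prF \<zeta>) g w t) {..t} \<and>
      abs_integrable_in (Ys 1) (slow_integrand (TS \<zeta>) (prS \<zeta>) g w t) {t..0} \<and>
      integral {..t} (fast_integrand \<epsilon> TA f w t) = lp.c1.conv w t \<and>
      integral {..t} (slow_integrand TB (prF \<zeta>) g w t) = lp.c2.conv w t \<and>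
      integral {t..0} (slow_integrand (TS \<zeta>) (prS \<zeta>) g w t) = lp.c3.conv w t"
    if w: "w \<in> Ceta" and t: "t \<le> 0" for w t
  proof -
    obtain R where R: "lp.c1.bounded_path w R" "lp.c2.bounded_path w R" "lp.c3.bounded_path w R"
      by (rule lp.bounded_pathE[of w]) (use w in \<open>auto simp: Ceta P_def\<close>)
    show ?thesis
      using lp.c1.conv_past[OF R(1) refl t] lp.c2.conv_past[OF R(2) refl t] lp.c3.conv_future[OF R(3) refl t]
      by (auto simp: abs_integrable_in_def fast slowF slowS carrF carrH integral_unique)
  qed
  have L: "L w = lp.\<Lambda> w" if "w \<in> Ceta" for w
    unfolding L_def LP_operator_def lp.\<Lambda>_def
    by (rule restrict_ext) (use int[OF that] in simp)
  have "L \<in> Ceta \<rightarrow> Ceta"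
    using L lp.\<Lambda>_mem by (auto simp: Ceta P_def)
  moreover have "\<exists>!w. w \<in> Ceta \<and> L w = w"
  proof -
    have "(w \<in> Ceta \<and> L w = w) \<longleftrightarrow> (w \<in> weighted_paths \<eta> lp.P \<and> lp.\<Lambda> w = w)" for w
      using L[of w] by (auto simp: Ceta P_def)
    then show ?thesis using lp.unique_fixed_point by simp
  qed
  ultimately show ?thesis using int by blast
qed

end
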